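(* For $\omega\neq\pm1$, any $\omega$-degenerate surface and any $-1$-degenerate surface cannot intersect each other in $\mathcal R_{EH}$. That is, for any $0\le e<1$ and any $n_1,n_2\in\mathbf N$, $\Pi_{n_1}(\omega,e)\cap\Pi_{n_2}(-1,e)=\emptyset$.
   Context: $\xi_{\alpha,\beta,e}$ is the fundamental solution ($\xi(0)=I_4$) on $[0,2\pi]$ of $\xi'=J\begin{pmatrix}1&0&0&1\\0&1&-1&0\\0&-1&1-\frac{1+\alpha+3\beta}{1+e\cos t}&0\\1&0&0&1-\frac{1+\alpha-3\beta}{1+e\cos t}\end{pmatrix}\xi$; with $\tilde\alpha=\alpha-\beta$, $\tilde\beta=-\alpha+3\beta-1$, $\tilde\xi_{\tilde\alpha,\tilde\beta,e}:=\xi_{\alpha,\beta,e}$. $\mathcal R_{EH}=\{\tilde\beta>0,\tilde\alpha>0,e\in[0,1)\}$. $i_\omega,\nu_\omega$ are the $\omega$-Maslov-type index and nullity. For $\omega\in\mathbf U$, $n\in\mathbf N$: $\tilde\beta_n(\tilde\alpha,\omega,e)=\min\{\tilde\beta>0:[i_\omega(\tilde\xi_{\tilde\alpha,\tilde\beta,e})+\nu_\omega(\tilde\xi_{\tilde\alpha,\tilde\beta,e})]-[i_\omega(\tilde\xi_{0,0,e})+\nu_\omega(\tilde\xi_{0,0,e})]\ge n\}$, and $\Pi_n(\omega,e)=\{(\tilde\alpha,\tilde\beta_n(\tilde\alpha,\omega,e),e):\tilde\alpha>0,\tilde\beta>0\}$. *)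

theory Defs
  imports "HOL-Analysis.Analysis"
begin

definition J4 :: "real^4^4" where
  "J4 = vector [vector [0,0,-1,0], vector [0,0,0,-1],
                vector [1,0,0,0],  vector [0,1,0,0]]"

definition B_EH :: "real \<Rightarrow> real \<Rightarrow> real \<Rightarrow> real \<Rightarrow> real^4^4" where
  "B_EH \<alpha> \<beta> e t =
     vector [vector [1, 0, 0, 1],
             vector [0, 1, -1, 0],
             vector [0, -1, 1 - (1 + \<alpha> + 3*\<beta>) / (1 + e * cos t), 0],
             vector [1, 0, 0, 1 - (1 + \<alpha> - 3*\<beta>) / (1 + e * cos t)]]"

text \<open>Fundamental solution xi_{alpha,beta,e} on [0,2pi] of xi' = J B xi, xi(0) = I
  (normalised to 0 outside [0,2pi] so that it is uniquely determined).\<close>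
definition xi_EH :: "real \<Rightarrow> real \<Rightarrow> real \<Rightarrow> real \<Rightarrow> real^4^4" where
  "xi_EH \<alpha> \<beta> e = (THE \<xi>. \<xi> 0 = mat 1 \<and>
      (\<forall>t\<in>{0..2*pi}. (\<xi> has_vector_derivative (J4 ** B_EH \<alpha> \<beta> e t ** \<xi> t))
                        (at t within {0..2*pi})) \<and>
      (\<forall>t. t \<notin> {0..2*pi} \<longrightarrow> \<xi> t = 0))"

text \<open>Reparametrisation: tilde-alpha = alpha - beta, tilde-beta = -alpha + 3 beta - 1,
  i.e. alpha = (3 ta + tb + 1)/2, beta = (ta + tb + 1)/2.\<close>
definition xi_tilde :: "real \<Rightarrow> real \<Rightarrow> real \<Rightarrow> real \<Rightarrow> real^4^4" where
  "xi_tilde ta tb e = xi_EH ((3*ta + tb + 1)/2) ((ta + tb + 1)/2) e"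

definition cmat :: "real^4^4 \<Rightarrow> complex^4^4" where
  "cmat M = (\<chi> i j. complex_of_real (M $ i $ j))"

definition cnullity :: "complex^4^4 \<Rightarrow> nat" where
  "cnullity A = vec.dim {v. A *v v = 0}"

definition nullity_om :: "complex \<Rightarrow> (real \<Rightarrow> real^4^4) \<Rightarrow> nat" where
  "nullity_om \<omega> \<gamma> = cnullity (\<chi> i j. cmat (\<gamma> (2*pi)) $ i $ j - (if i = j then \<omega> else 0))"

text \<open>Projections onto the +-1 eigenspaces of iJ, and the matrix pencil whose
  unit-circle roots are the eigenvalues (with multiplicity) of the unitary
  U_{Gr(omega I)}^{-1} U_{Gr(M)} attached to the Lagrangian pair (Gr(omega I), Gr(M)).\<close>
definition Pplus :: "complex^4^4" where
  "Pplus = (\<chi> i j. ((if i = j then 1 else 0) + \<i> * complex_of_real (J4 $ i $ j)) / 2)"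
definition Pminus :: "complex^4^4" where
  "Pminus = (\<chi> i j. ((if i = j then 1 else 0) - \<i> * complex_of_real (J4 $ i $ j)) / 2)"

definition pencil :: "complex \<Rightarrow> real^4^4 \<Rightarrow> complex \<Rightarrow> complex^4^4" where
  "pencil \<omega> M z = (\<chi> i j. cmat M $ i $ j
       - \<omega> * (inverse z * Pplus $ i $ j + z * Pminus $ i $ j))"

text \<open>theta is a continuous lift on [0,2pi] of the four eigenvalues (with multiplicity)
  of the unitary path associated with gamma and omega.\<close>
definition eig_lift :: "complex \<Rightarrow> (real \<Rightarrow> real^4^4) \<Rightarrow> (4 \<Rightarrow> real \<Rightarrow> real) \<Rightarrow> bool" where
  "eig_lift \<omega> \<gamma> \<theta> \<longleftrightarrow>
     (\<forall>j. continuous_on {0..2*pi} (\<theta> j)) \<and>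
     (\<forall>t\<in>{0..2*pi}. \<forall>z. cmod z = 1 \<longrightarrow>
        card {j. cis (\<theta> j t) = z} = cnullity (pencil \<omega> (\<gamma> t) z))"

text \<open>omega-index i_omega(gamma) (Long's normalisation: i_1 of the constant path is -n,
  i_omega of the constant path is 0 for omega /= 1), computed as the spectral flow of the
  eigenvalues through 1 (Maslov index of Lagrangian pair), with endpoint conventions
  making i_omega the lower and i_omega + nu_omega the upper index.\<close>
definition index_om :: "complex \<Rightarrow> (real \<Rightarrow> real^4^4) \<Rightarrow> int" where
  "index_om \<omega> \<gamma> =
     (let \<theta> = (SOME \<theta>. eig_lift \<omega> \<gamma> \<theta>) in
       (\<Sum>j\<in>UNIV. \<lceil>\<theta> j (2*pi) / (2*pi)\<rceil> - 1 - \<lfloor>\<theta> j 0 / (2*pi)\<rfloor>)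
       + (if \<omega> = 1 then 2 else 0))"

definition idx_gap :: "complex \<Rightarrow> real \<Rightarrow> real \<Rightarrow> real \<Rightarrow> int" where
  "idx_gap \<omega> ta tb e =
     (index_om \<omega> (xi_tilde ta tb e) + int (nullity_om \<omega> (xi_tilde ta tb e)))
     - (index_om \<omega> (xi_tilde 0 0 e) + int (nullity_om \<omega> (xi_tilde 0 0 e)))"

text \<open>Pi_n(omega,e): points (ta, tb, e) with ta > 0 and tb = tilde-beta_n(ta,omega,e), i.e. tb is
  the minimum of {b > 0 : gap >= n} (only where this minimum exists).\<close>
definition Pi_surf :: "nat \<Rightarrow> complex \<Rightarrow> real \<Rightarrow> (real \<times> real \<times> real) set" where
  "Pi_surf n \<omega> e = {(ta, tb, e') | ta tb e'. e' = e \<and> ta > 0 \<and> tb > 0 \<and>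
      idx_gap \<omega> ta tb e \<ge> int n \<and>
      (\<forall>b. b > 0 \<and> idx_gap \<omega> ta b e \<ge> int n \<longrightarrow> tb \<le> b)}"

end

(* At a common point of an omega-degenerate and a (-1)-degenerate surface, minimality forces the monodromy
   matrix M to have the eigenvalues omega, conj omega and -1: otherwise the index would be locally constant,
   because the unit-circle eigenvalues defining it lift continuously, jointly in time and in the parameter.

   On the other hand M always has an eigenvalue mu > 0. Look for solutions e^(kt) times a periodic function
   of (1 + e cos t)(q1'' - 2 q2') = l3 q1, (1 + e cos t)(q2'' + 2 q1') = l4 q2, where l3 > 0 > l4.
   At k = 0 the constant modes have zero acceleration, so the truncated Fourier system splits into the
   constant modes and two conjugate blocks, and its real determinant is l3 l4 times a square, hence <= 0; for
   large k it is positive. The truncated systems are thus singular at some bounded k >= 0, and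
   their kernel vectors are approximate quasi-periodic solutions whose limit is an eigenvector for exp(2 pi k).

   So M has four distinct eigenvalues with product -mu < 0, whereas det M > 0 by continuity from det I = 1. *)
theory Submission
  imports Defs
    "HOL-Computational_Algebra.Fundamental_Theorem_Algebra"
    "Jordan_Normal_Form.Determinant"
begin

no_notation Matrix.vec_index (infixl \<open>$\<close> 100)
no_notation Matrix.scalar_prod (infix \<open>\<bullet>\<close> 70)
hide_const (open) Matrix.vec Matrix.mat Determinant.det Matrix.row Matrix.rows Matrix.col Matrix.cols
  Matrix.transpose_mat Matrix.unit_vec Matrix.vec_index
hide_fact (open) Matrix.vec_eq_iff Matrix.mat_def

subsection \<open>Linear differential equations depending on a parameter\<close>

text \<open>In the coordinates of the statement l3 = 1 + \<alpha> + 3\<beta> = 3 + 3 ta + 2 tb and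
  l4 = 1 + \<alpha> - 3\<beta> = -tb, which is where ta > 0 and tb > 0 enter the search for a
  positive multiplier. The equations are multiplied by 1 + e cos t rather than divided by it, so
  that each Fourier mode meets only its two neighbours, with total weight e/2 + e/2 < 1. This strict
  dominance takes the place of a theory of infinite determinants: it excludes kernels at large k for
  every truncation order at once, and it makes the accelerations decay, so that the defect left at
  the cut-off tends to 0 uniformly in k. On the index side the obstacle is that
  \<open>index_om\<close> picks an arbitrary lift for each path. The floor sums have to be shown
  independent of the lift, and comparing two parameter values requires one lift over a whole
  rectangle. Eigenvalues may collide, so they cannot be followed one by one; sorted lifts with a
  prescribed sum are unique and hence continuous through collisions.\<close>

lemma bounded_bilinear_matrix_mult:
  "bounded_bilinear ((**) :: real^'n^'m \<Rightarrow> real^'p^'n \<Rightarrow> real^'p^'m)"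
  unfolding bilinear_conv_bounded_bilinear[symmetric] bilinear_def
  by (intro conjI allI linearI)
     (simp_all add: matrix_add_ldistrib scalar_matrix_assoc matrix_scalar_ac
        matrix_matrix_mult_def vec_eq_iff algebra_simps sum.distrib sum_distrib_left)

text \<open>The terms of the Peano-Baker series, whose sum is the fundamental solution.\<close>

primrec picard_term :: "('p \<Rightarrow> real \<Rightarrow> real^'n^'n) \<Rightarrow> nat \<Rightarrow> 'p \<Rightarrow> real \<Rightarrow> real^'n^'n" where
  "picard_term A 0 p t = mat 1"
| "picard_term A (Suc n) p t = integral {0..t} (\<lambda>s. A p s ** picard_term A n p s)"

lemma picard_term_0: "picard_term A 0 p = (\<lambda>t. mat 1)"
  and picard_term_Suc: "picard_term A (Suc n) p = (\<lambda>t. integral {0..t} (\<lambda>s. A p s ** picard_term A n p s))"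
  by auto

text \<open>The substitution s = t u moves the variable upper limit into the integrand, and
  continuity under an integral over the fixed interval [0,1] applies.\<close>

lemma continuous_on_integral_upper:
  fixes f :: "'p::metric_space \<Rightarrow> real \<Rightarrow> 'a::euclidean_space"
  assumes f: "continuous_on (S \<times> {0..T}) (\<lambda>(p, t). f p t)"
  shows "continuous_on (S \<times> {0..T}) (\<lambda>(p, t). integral {0..t} (f p))"
proof -
  have eq: "integral {0..t} (f p) = integral (cbox 0 1) (\<lambda>u. t *\<^sub>R f p (t * u))"
    if "p \<in> S" "t \<in> {0..T}" for p t
  proof -
    have sub: "continuous_on {0..t} (f p)"
      by (rule continuous_on_compose2[OF f, of "{0..t}" "\<lambda>s. (p, s)", simplified])
         (use that in \<open>auto intro!: continuous_intros\<close>)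
    have "((\<lambda>u. t *\<^sub>R f p (t * u)) has_integral (integral {t * 0..t * 1} (f p))) {0..1}"
    proof (rule has_integral_substitution[where c = 0 and d = t])
      show "(*) t ` {0..1} \<subseteq> {0..t}"
        using that mult_left_le[of _ t] by auto
      show "((*) t has_real_derivative t) (at u within {0..1})" for u
        by (auto intro!: derivative_eq_intros)
    qed (use that sub in auto)
    from integral_unique[OF this] show ?thesis by (simp del: integral_scaleR_right)
  qed
  have sub: "(\<lambda>x. (fst (fst x), snd (fst x) * snd x)) ` ((S \<times> {0..T}) \<times> cbox 0 1) \<subseteq> S \<times> {0..T}"
  proof -
    have "t * u \<in> {0..T}" if "t \<in> {0..T}" "u \<in> {0..1}" for t u :: real
      using that mult_left_le[of u t] by auto
    then show ?thesis by auto
  qed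
  have "continuous_on ((S \<times> {0..T}) \<times> cbox 0 1) (\<lambda>(q, u). snd q *\<^sub>R f (fst q) (snd q * u))"
  proof -
    have "continuous_on ((S \<times> {0..T}) \<times> cbox 0 1) (\<lambda>x. (fst (fst x), snd (fst x) * snd x :: real))"
      by (intro continuous_intros)
    from continuous_on_compose2[OF f this sub]
    have "continuous_on ((S \<times> {0..T}) \<times> cbox 0 1) (\<lambda>x. f (fst (fst x)) (snd (fst x) * snd x))"
      by (simp add: split_beta)
    then show ?thesis
      unfolding split_beta by (intro continuous_on_scaleR continuous_on_snd continuous_on_fst continuous_on_id)
  qed
  from integral_continuous_on_param[OF this]
  have "continuous_on (S \<times> {0..T}) (\<lambda>q. integral (cbox 0 1) (\<lambda>u. snd q *\<^sub>R f (fst q) (snd q * u)))" .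
  then show ?thesis
    by (rule continuous_on_eq) (clarsimp simp only: eq split: prod.splits, simp only: fst_conv snd_conv)
qed

text \<open>Compactness of S bounds A uniformly over the parameters, so the n-th term is dominated
  by (C t)^n / n! up to a constant. The M-test then gives uniform convergence in p and t together,
  which is what joint continuity needs.\<close>

lemma linear_ode_exists:
  fixes A :: "'p::metric_space \<Rightarrow> real \<Rightarrow> real^'n^'n"
  assumes A: "continuous_on (S \<times> {0..T}) (\<lambda>(p, t). A p t)" and S: "compact S" and T: "0 \<le> T"
  obtains X where "continuous_on (S \<times> {0..T}) (\<lambda>(p, t). X p t)"
    and "\<And>p. p \<in> S \<Longrightarrow> X p 0 = mat 1"
    and "\<And>p t. p \<in> S \<Longrightarrow> t \<in> {0..T} \<Longrightarrow>
           (X p has_vector_derivative A p t ** X p t) (at t within {0..T})"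
proof -
  interpret bb: bounded_bilinear "(**) :: real^'n^'n \<Rightarrow> real^'n^'n \<Rightarrow> real^'n^'n"
    by (rule bounded_bilinear_matrix_mult)
  let ?Y = "picard_term A"
  let ?K = "S \<times> {0..T}"
  have contY: "continuous_on ?K (\<lambda>(p, t). ?Y n p t)" for n
  proof (induction n)
    case (Suc n)
    have "continuous_on ?K (\<lambda>(p, t). A p t ** ?Y n p t)"
      using bb.continuous_on[OF A Suc] by (simp add: split_beta)
    from continuous_on_integral_upper[OF this] show ?case by simp
  qed (simp add: split_beta)
  obtain C0 where C0: "0 < C0" "\<And>(B :: real^'n^'n) (D :: real^'n^'n). norm (B ** D) \<le> norm B * norm D * C0"
    using bb.pos_bounded by blast
  have "bounded ((\<lambda>(p, t). A p t) ` ?K)"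
    by (intro compact_imp_bounded compact_continuous_image A compact_Times S compact_Icc)
  then obtain C1 where C1: "0 < C1" "\<And>p t. p \<in> S \<Longrightarrow> t \<in> {0..T} \<Longrightarrow> norm (A p t) \<le> C1"
    by (auto simp: bounded_pos)
  define C where "C = C1 * C0"
  have C: "0 < C" using C0 C1 by (simp add: C_def)
  have AB: "norm (A p t ** B) \<le> C * norm B" if "p \<in> S" "t \<in> {0..T}" for p t and B :: "real^'n^'n"
  proof -
    have "norm (A p t ** B) \<le> norm (A p t) * (norm B * C0)" using C0(2)[of "A p t" B] by (simp add: mult_ac)
    also have "\<dots> \<le> C1 * (norm B * C0)"
      by (intro mult_right_mono C1 that) (use C0 in auto)
    finally show ?thesis by (simp add: C_def mult_ac)
  qed
  let ?c = "norm (mat 1 :: real^'n^'n)"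
  have contY1: "continuous_on {0..T} (?Y n p)" if "p \<in> S" for n p
    by (rule continuous_on_compose2[OF contY[of n], of "{0..T}" "\<lambda>s. (p, s)", simplified])
       (use that in \<open>auto intro!: continuous_intros\<close>)
  have contA1: "continuous_on {0..T} (A p)" if "p \<in> S" for p
    by (rule continuous_on_compose2[OF A, of "{0..T}" "\<lambda>s. (p, s)", simplified])
       (use that in \<open>auto intro!: continuous_intros\<close>)
  have contAY: "continuous_on {0..T} (\<lambda>s. A p s ** ?Y n p s)" if "p \<in> S" for n p
    by (intro bb.continuous_on contA1 contY1 that)
  have bound: "norm (?Y n p t) \<le> ?c * (C * t) ^ n / fact n" if "p \<in> S" "t \<in> {0..T}" for n p t
    using that(2)
  proof (induction n arbitrary: t)
    case (Suc n)
    have "((\<lambda>s. C * (?c * (C * s) ^ n / fact n)) has_integral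
            (?c * (C * t) ^ Suc n / fact (Suc n) - ?c * (C * 0) ^ Suc n / fact (Suc n))) {0..t}"
    proof (rule fundamental_theorem_of_calculus)
      fix s assume "s \<in> {0..t}"
      have "((\<lambda>s. ?c * (C * s) ^ Suc n / fact (Suc n)) has_real_derivative
          ?c * (real (Suc n) * (C * s) ^ n * C) / fact (Suc n)) (at s within {0..t})"
      proof -
        have "((\<lambda>s. C * s) has_real_derivative C) (at s within {0..t})"
          by (auto intro!: derivative_eq_intros)
        from DERIV_cdivide[OF DERIV_cmult[OF DERIV_power[OF this, of "Suc n"], of ?c], of "fact (Suc n)"]
        show ?thesis by (simp only: mult_ac diff_Suc_Suc diff_zero of_nat_Suc)
      qed
      moreover have "?c * (real (Suc n) * (C * s) ^ n * C) / fact (Suc n) = C * (?c * (C * s) ^ n / fact n)"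
        by (simp add: field_simps del: of_nat_Suc)
      ultimately show "((\<lambda>s. ?c * (C * s) ^ Suc n / fact (Suc n)) has_vector_derivative
           C * (?c * (C * s) ^ n / fact n)) (at s within {0..t})"
        by (simp only: has_real_derivative_iff_has_vector_derivative)
    qed (use Suc in auto)
    then have int: "((\<lambda>s. C * (?c * (C * s) ^ n / fact n)) has_integral
            (?c * (C * t) ^ Suc n / fact (Suc n))) {0..t}" by simp
    have "norm (integral {0..t} (\<lambda>s. A p s ** ?Y n p s)) \<le> integral {0..t} (\<lambda>s. C * (?c * (C * s) ^ n / fact n))"
    proof (rule integral_norm_bound_integral)
      show "(\<lambda>s. A p s ** ?Y n p s) integrable_on {0..t}"
        by (intro integrable_continuous_interval continuous_on_subset[OF contAY[OF that(1)]]) (use Suc.prems in auto)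
      show "(\<lambda>s. C * (?c * (C * s) ^ n / fact n)) integrable_on {0..t}" using int by blast
      fix s assume s: "s \<in> {0..t}"
      have "norm (A p s ** ?Y n p s) \<le> C * norm (?Y n p s)"
        using s Suc.prems by (intro AB that) auto
      also have "\<dots> \<le> C * (?c * (C * s) ^ n / fact n)"
        using s Suc.prems C by (intro mult_left_mono Suc.IH) auto
      finally show "norm (A p s ** ?Y n p s) \<le> C * (?c * (C * s) ^ n / fact n)" .
    qed
    then show ?case unfolding integral_unique[OF int] by simp
  qed simp
  let ?M = "\<lambda>n. ?c * (C * T) ^ n / fact n"
  have bound': "norm (?Y n p t) \<le> ?M n" if "p \<in> S" "t \<in> {0..T}" for n p t
  proof -
    have "?c * (C * t) ^ n / fact n \<le> ?M n"
      using that C by (intro divide_right_mono mult_left_mono power_mono) auto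
    with bound[OF that, of n] show ?thesis by linarith
  qed
  have sumM: "summable ?M"
  proof -
    have "summable (\<lambda>n. ?c * (inverse (fact n) * (C * T) ^ n))"
      by (intro summable_mult summable_exp)
    then show ?thesis by (simp add: divide_inverse mult_ac)
  qed
  define X where "X p t = (\<Sum>n. ?Y n p t)" for p t
  have ul: "uniform_limit ?K (\<lambda>n q. \<Sum>i<n. ?Y i (fst q) (snd q)) (\<lambda>q. X (fst q) (snd q)) sequentially"
    unfolding X_def by (rule Weierstrass_m_test[OF _ sumM]) (use bound' in auto)
  have "continuous_on ?K (\<lambda>(p, t). X p t)"
    unfolding split_beta
    by (rule uniform_limit_theorem[OF _ ul])
       (use contY in \<open>auto intro!: continuous_on_sum eventuallyI simp: split_beta\<close>)
  moreover have sums: "(\<lambda>n. ?Y n p t) sums X p t" if "p \<in> S" "t \<in> {0..T}" for p t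
    unfolding X_def by (rule summable_sums, rule summable_comparison_test'[OF sumM]) (rule bound'[OF that])
  have X0: "X p 0 = mat 1" if "p \<in> S" for p
  proof -
    have "?Y n p 0 = (if n = 0 then mat 1 else 0)" for n by (cases n) auto
    then have "X p 0 = (\<Sum>n. if n = 0 then mat 1 else 0)" unfolding X_def by (rule arg_cong[where f = suminf, OF ext])
    also have "\<dots> = mat 1" using suminf_finite[of "{0::nat}" "\<lambda>n. if n = 0 then mat 1 else (0::real^'n^'n)"] by simp
    finally show ?thesis .
  qed
  moreover have "(X p has_vector_derivative A p t ** X p t) (at t within {0..T})"
    if p: "p \<in> S" and t: "t \<in> {0..T}" for p t
  proof -
    \<comment> \<open>The partial sums of these derivatives are A times the partial sums of the
      series with one term fewer, so their uniform convergence follows from that of the series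
      itself.\<close>
    define f' where "f' n s = (case n of 0 \<Rightarrow> 0 | Suc m \<Rightarrow> A p s ** ?Y m p s)" for n s
    have "\<exists>g. \<forall>s\<in>{0..T}. (\<lambda>n. ?Y n p s) sums g s \<and>
          (g has_derivative (\<lambda>h. h *\<^sub>R (A p s ** X p s))) (at s within {0..T})"
    proof (rule has_derivative_series[where f' = "\<lambda>n s h. h *\<^sub>R f' n s" and f = "\<lambda>n. ?Y n p"
          and S = "{0..T}" and x = t and l = "X p t"])
      fix n s assume s: "s \<in> {0..T}"
      have "(?Y n p has_vector_derivative f' n s) (at s within {0..T})"
        using integral_has_vector_derivative[OF contAY[OF p] s]
        by (cases n) (auto simp: f'_def[abs_def] picard_term_0 picard_term_Suc)
      then show "(?Y n p has_derivative (\<lambda>h. h *\<^sub>R f' n s)) (at s within {0..T})"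
        by (simp add: has_vector_derivative_def)
    next
      fix e :: real assume "0 < e"
      then have "\<forall>\<^sub>F n in sequentially. \<forall>q\<in>?K. dist (\<Sum>i<n. ?Y i (fst q) (snd q)) (X (fst q) (snd q)) < e / C"
        using ul C by (auto simp: uniform_limit_iff)
      then have "\<forall>\<^sub>F n in sequentially. \<forall>q\<in>?K. dist (\<Sum>i<n - 1. ?Y i (fst q) (snd q)) (X (fst q) (snd q)) < e / C"
        by (rule eventually_compose_filterlim) (rule filterlim_minus_const_nat_at_top)
      then show "\<forall>\<^sub>F n in sequentially. \<forall>s\<in>{0..T}. \<forall>h.
          norm ((\<Sum>i<n. h *\<^sub>R f' i s) - h *\<^sub>R (A p s ** X p s)) \<le> e * norm h"
      proof (rule eventually_mono[OF eventually_conj[OF _ eventually_gt_at_top[of 0]]], intro ballI allI)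
        fix n s h assume n: "(\<forall>q\<in>?K. dist (\<Sum>i<n - 1. ?Y i (fst q) (snd q)) (X (fst q) (snd q)) < e / C) \<and> 0 < n"
          and s: "s \<in> {0..T}"
        obtain m where m: "n = Suc m" using n by (cases n) auto
        have "(\<Sum>i<n. h *\<^sub>R f' i s) = h *\<^sub>R (A p s ** (\<Sum>i<m. ?Y i p s))"
          unfolding m sum.lessThan_Suc_shift by (simp add: f'_def bb.sum_right scaleR_sum_right)
        then have "norm ((\<Sum>i<n. h *\<^sub>R f' i s) - h *\<^sub>R (A p s ** X p s))
            = \<bar>h\<bar> * norm (A p s ** ((\<Sum>i<m. ?Y i p s) - X p s))"
          by (simp add: bb.diff_right scaleR_diff_right flip: norm_scaleR)
        also have "\<dots> \<le> \<bar>h\<bar> * (C * (e / C))"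
        proof (intro mult_left_mono order_trans[OF AB[OF p s]])
          have "dist (\<Sum>i<n - 1. ?Y i (fst (p, s)) (snd (p, s))) (X (fst (p, s)) (snd (p, s))) < e / C"
            using n p s by blast
          then show "norm ((\<Sum>i<m. ?Y i p s) - X p s) \<le> e / C" by (simp add: m dist_norm)
        qed (use C in auto)
        finally show "norm ((\<Sum>i<n. h *\<^sub>R f' i s) - h *\<^sub>R (A p s ** X p s)) \<le> e * norm h"
          using C by (simp add: mult.commute)
      qed
    qed (use t sums[OF p t] in auto)
    then obtain g where g: "\<And>s. s \<in> {0..T} \<Longrightarrow> (\<lambda>n. ?Y n p s) sums g s"
      "\<And>s. s \<in> {0..T} \<Longrightarrow> (g has_derivative (\<lambda>h. h *\<^sub>R (A p s ** X p s))) (at s within {0..T})"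
      by blast
    have "g s = X p s" if "s \<in> {0..T}" for s
      using g(1)[OF that] sums[OF p that] sums_unique2 by blast
    then have "(X p has_derivative (\<lambda>h. h *\<^sub>R (A p t ** X p t))) (at t within {0..T})"
      by (intro has_derivative_transform[OF t _ g(2)[OF t]]) simp
    then show ?thesis by (simp add: has_vector_derivative_def)
  qed
  ultimately show thesis using that by blast
qed

section \<open>The Hamiltonian system and its dependence on the parameter\<close>

lemma vector_4 [simp]:
  fixes w x y z :: "'a::zero"
  shows "(vector [w, x, y, z] :: 'a^4) $ 1 = w" "(vector [w, x, y, z] :: 'a^4) $ 2 = x"
    "(vector [w, x, y, z] :: 'a^4) $ 3 = y" "(vector [w, x, y, z] :: 'a^4) $ 4 = z"
  unfolding vector_def by simp_all

lemma J4_simps: "transpose J4 = - J4" "J4 ** J4 = - mat 1"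
  by (simp_all add: J4_def vec_eq_iff forall_4 transpose_def matrix_matrix_mult_def sum_4 mat_def)

lemma transpose_B_EH: "transpose (B_EH a b e t) = B_EH a b e t"
  by (simp add: B_EH_def vec_eq_iff forall_4 transpose_def)

text \<open>The conditions of \<open>xi_EH\<close> without its zero extension outside [0,2pi], so
  that any solution produced by the existence theorem qualifies.\<close>

definition EH_solution :: "real \<Rightarrow> real \<Rightarrow> real \<Rightarrow> (real \<Rightarrow> real^4^4) \<Rightarrow> bool" where
  "EH_solution a b e X \<longleftrightarrow> X 0 = mat 1 \<and>
     (\<forall>t\<in>{0..2*pi}. (X has_vector_derivative J4 ** B_EH a b e t ** X t) (at t within {0..2*pi}))"

lemma continuous_on_B_EH:
  assumes "0 \<le> e" "e < 1"
  shows "continuous_on UNIV (\<lambda>(tb, t). J4 ** B_EH ((3*ta + tb + 1)/2) ((ta + tb + 1)/2) e t)"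
proof -
  have [simp]: "1 + e * cos t \<noteq> 0" for t
  proof -
    have "\<bar>e * cos t\<bar> \<le> e * 1" unfolding abs_mult using assms by (intro mult_mono) auto
    then show ?thesis using assms by linarith
  qed
  have entry: "continuous_on UNIV (\<lambda>x. B_EH ((3*ta + fst x + 1)/2) ((ta + fst x + 1)/2) e (snd x) $ i $ j)" for i j :: 4
    using exhaust_4[of i] exhaust_4[of j]
    by (elim disjE) (simp_all add: B_EH_def, (intro continuous_intros; simp)+)
  have "continuous_on UNIV (\<lambda>x. \<chi> i j. B_EH ((3*ta + fst x + 1)/2) ((ta + fst x + 1)/2) e (snd x) $ i $ j)"
    by (intro continuous_on_vec_lambda entry)
  then have "continuous_on UNIV (\<lambda>x. B_EH ((3*ta + fst x + 1)/2) ((ta + fst x + 1)/2) e (snd x))"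
    by simp
  from bounded_bilinear.continuous_on[OF bounded_bilinear_matrix_mult continuous_on_const[of _ J4] this]
  show ?thesis by (simp add: split_beta)
qed

lemma bounded_linear_transpose: "bounded_linear (transpose :: real^'n^'m \<Rightarrow> real^'m^'n)"
  by (auto intro!: linear_conv_bounded_linear[THEN iffD1] linearI simp: transpose_def vec_eq_iff)

lemma has_vector_derivative_transpose:
  fixes f :: "real \<Rightarrow> real^'n^'m"
  assumes "(f has_vector_derivative f') F"
  shows "((\<lambda>t. transpose (f t)) has_vector_derivative transpose f') F"
  by (rule bounded_linear.has_vector_derivative[OF bounded_linear_transpose assms])

text \<open>The derivative of X^T J Y cancels because B is symmetric, J^T = -J and J^2 = -1. Taking
  two solutions covers both uses: X = Y gives symplecticity, and different ones give
  uniqueness.\<close>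

lemma EH_solution_symplectic_product:
  fixes X Y :: "real \<Rightarrow> real^4^4"
  assumes "EH_solution a b e X" "EH_solution a b e Y" "t \<in> {0..2*pi}"
  shows "transpose (X t) ** J4 ** Y t = J4"
proof -
  interpret bb: bounded_bilinear "(**) :: real^4^4 \<Rightarrow> real^4^4 \<Rightarrow> real^4^4"
    by (rule bounded_bilinear_matrix_mult)
  let ?G = "\<lambda>t. transpose (X t) ** J4 ** Y t"
  have "(?G has_vector_derivative 0) (at s within {0..2*pi})" if s: "s \<in> {0..2*pi}" for s
  proof -
    let ?B = "B_EH a b e s"
    have X: "(X has_vector_derivative J4 ** ?B ** X s) (at s within {0..2*pi})"
      and Y: "(Y has_vector_derivative J4 ** ?B ** Y s) (at s within {0..2*pi})"
      using assms s by (auto simp: EH_solution_def)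
    have "((\<lambda>t. transpose (X t) ** J4) has_vector_derivative transpose (J4 ** ?B ** X s) ** J4)
        (at s within {0..2*pi})"
      using bb.has_vector_derivative[OF has_vector_derivative_transpose[OF X] has_vector_derivative_const[of J4]]
      by (simp add: bb.zero_right)
    from bb.has_vector_derivative[OF this Y]
    have "(?G has_vector_derivative transpose (X s) ** J4 ** (J4 ** ?B ** Y s) +
         transpose (J4 ** ?B ** X s) ** J4 ** Y s) (at s within {0..2*pi})" .
    moreover have "transpose (X s) ** J4 ** (J4 ** ?B ** Y s) = transpose (X s) ** (J4 ** J4) ** ?B ** Y s"
      by (simp add: matrix_mul_assoc)
    moreover have "transpose (J4 ** ?B ** X s) ** J4 ** Y s = - (transpose (X s) ** ?B ** (J4 ** J4) ** Y s)"
      by (simp add: matrix_transpose_mul transpose_B_EH J4_simps(1) bb.minus_right bb.minus_left matrix_mul_assoc)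
    ultimately show ?thesis
      by (simp add: J4_simps bb.minus_right bb.minus_left)
  qed
  then obtain c where "\<And>s. s \<in> {0..2*pi} \<Longrightarrow> ?G s = c"
    using has_vector_derivative_zero_constant[of "{0..2*pi}" ?G] by auto
  from this[of t] this[of 0] assms show ?thesis
    by (simp add: EH_solution_def transpose_mat)
qed

lemma EH_solution_unique:
  assumes X: "EH_solution a b e X" and Y: "EH_solution a b e Y" and t: "t \<in> {0..2*pi}"
  shows "X t = Y t"
proof -
  have 1: "transpose (X t) ** J4 ** X t = J4" "transpose (X t) ** J4 ** Y t = J4"
    using EH_solution_symplectic_product X Y t by blast+
  interpret bb: bounded_bilinear "(**) :: real^4^4 \<Rightarrow> real^4^4 \<Rightarrow> real^4^4"
    by (rule bounded_bilinear_matrix_mult)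
  \<comment> \<open>X^T J X = J makes this the inverse of X(t), and X^T J Y = J makes it a left
    inverse of Y(t) too.\<close>
  let ?L = "- (J4 ** (transpose (X t) ** J4))"
  have "?L ** X t = mat 1" using 1(1) by (simp add: bb.minus_left J4_simps flip: matrix_mul_assoc)
  moreover have "?L ** Y t = mat 1" using 1(2) by (simp add: bb.minus_left J4_simps flip: matrix_mul_assoc)
  moreover from calculation(1) have "X t ** ?L = mat 1" using matrix_left_right_inverse by blast
  ultimately show ?thesis by (metis matrix_mul_assoc matrix_mul_lid matrix_mul_rid)
qed

text \<open>Resolves the \<open>THE\<close>: a solution cut off outside [0,2pi] meets the
  description, and uniqueness on the interval makes it the only one.\<close>

lemma xi_EH_eq:
  assumes "EH_solution a b e X" and "t \<in> {0..2*pi}"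
  shows "xi_EH a b e t = X t"
proof -
  let ?P = "\<lambda>\<xi>. \<xi> 0 = mat 1 \<and>
      (\<forall>t\<in>{0..2*pi}. (\<xi> has_vector_derivative (J4 ** B_EH a b e t ** \<xi> t)) (at t within {0..2*pi})) \<and>
      (\<forall>t. t \<notin> {0..2*pi} \<longrightarrow> \<xi> t = 0)"
  define Z where "Z t = (if t \<in> {0..2*pi} then X t else 0)" for t
  have "?P Z"
  proof (intro conjI ballI allI impI)
    fix t assume t: "t \<in> {0..2*pi}"
    then have "(X has_vector_derivative (J4 ** B_EH a b e t ** X t)) (at t within {0..2*pi})"
      using assms by (auto simp: EH_solution_def)
    then have "(Z has_vector_derivative (J4 ** B_EH a b e t ** X t)) (at t within {0..2*pi})"
      by (rule has_vector_derivative_transform[OF t, rotated]) (simp add: Z_def)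
    then show "(Z has_vector_derivative (J4 ** B_EH a b e t ** Z t)) (at t within {0..2*pi})"
      using t by (simp add: Z_def)
  qed (use assms in \<open>auto simp: Z_def EH_solution_def\<close>)
  moreover have "Z' = Z" if "?P Z'" for Z'
  proof
    fix t show "Z' t = Z t"
    proof (cases "t \<in> {0..2*pi}")
      case True
      have "EH_solution a b e Z'" using that by (simp add: EH_solution_def)
      then show ?thesis using EH_solution_unique[OF _ assms(1) True] True by (simp add: Z_def)
    qed (use that in \<open>auto simp: Z_def\<close>)
  qed
  ultimately have "xi_EH a b e = Z" unfolding xi_EH_def by (rule the_equality)
  then show ?thesis using assms by (simp add: Z_def)
qed

text \<open>Joint continuity is in (tb, t) with ta fixed because tb is the variable over which the
  minimum in \<open>Pi_surf\<close> is taken.\<close>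

lemma xi_tilde_properties:
  assumes e: "0 \<le> e" "e < 1"
  shows xi_tilde_solution: "EH_solution ((3*ta + tb + 1)/2) ((ta + tb + 1)/2) e (xi_tilde ta tb e)"
    and continuous_on_xi_tilde: "continuous_on ({b0..b1} \<times> {0..2*pi}) (\<lambda>(tb, t). xi_tilde ta tb e t)"
proof -
  let ?A = "\<lambda>tb t. J4 ** B_EH ((3*ta + tb + 1)/2) ((ta + tb + 1)/2) e t"
  have *: "continuous_on ({b0..b1} \<times> {0..2*pi}) (\<lambda>(tb, t). xi_tilde ta tb e t) \<and>
    (\<forall>tb\<in>{b0..b1}. EH_solution ((3*ta + tb + 1)/2) ((ta + tb + 1)/2) e (xi_tilde ta tb e))" for b0 b1
  proof -
    have "continuous_on ({b0..b1} \<times> {0..2*pi}) (\<lambda>(tb, t). ?A tb t)"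
      by (rule continuous_on_subset[OF continuous_on_B_EH[OF e]]) auto
    from linear_ode_exists[OF this compact_Icc]
    obtain X where X: "continuous_on ({b0..b1} \<times> {0..2*pi}) (\<lambda>(p, t). X p t)"
      "\<And>p. p \<in> {b0..b1} \<Longrightarrow> X p 0 = mat 1"
      "\<And>p t. p \<in> {b0..b1} \<Longrightarrow> t \<in> {0..2*pi} \<Longrightarrow>
           (X p has_vector_derivative ?A p t ** X p t) (at t within {0..2*pi})"
      by auto
    have sol: "EH_solution ((3*ta + tb + 1)/2) ((ta + tb + 1)/2) e (X tb)" if "tb \<in> {b0..b1}" for tb
      using X that by (simp add: EH_solution_def)
    then have eq: "xi_tilde ta tb e t = X tb t" if "tb \<in> {b0..b1}" "t \<in> {0..2*pi}" for tb t
      using that xi_EH_eq by (simp add: xi_tilde_def)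
    have "continuous_on ({b0..b1} \<times> {0..2*pi}) (\<lambda>(tb, t). xi_tilde ta tb e t)"
      by (rule continuous_on_eq[OF X(1)]) (auto simp: eq)
    moreover have "EH_solution ((3*ta + tb + 1)/2) ((ta + tb + 1)/2) e (xi_tilde ta tb e)"
      if "tb \<in> {b0..b1}" for tb
      unfolding EH_solution_def
    proof (intro conjI ballI)
      show "xi_tilde ta tb e 0 = mat 1" using eq[OF that, of 0] X(2)[OF that] by simp
      fix t assume t: "t \<in> {0..2*pi}"
      have "(X tb has_vector_derivative ?A tb t ** X tb t) (at t within {0..2*pi})"
        using X(3) that t by blast
      then have "(xi_tilde ta tb e has_vector_derivative ?A tb t ** X tb t) (at t within {0..2*pi})"
        by (rule has_vector_derivative_transform[OF t eq[OF that], rotated])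
      then show "(xi_tilde ta tb e has_vector_derivative ?A tb t ** xi_tilde ta tb e t) (at t within {0..2*pi})"
        using eq[OF that t] by simp
    qed
    ultimately show ?thesis by blast
  qed
  from *[of tb tb] show "EH_solution ((3*ta + tb + 1)/2) ((ta + tb + 1)/2) e (xi_tilde ta tb e)" by simp
  from * show "continuous_on ({b0..b1} \<times> {0..2*pi}) (\<lambda>(tb, t). xi_tilde ta tb e t)" by blast
qed

subsection \<open>Determinants of linear maps between truncated sequences\<close>

text \<open>Vectors of varying length m are sequences read below m, since the truncation order has
  to grow inside the proof. The last clause says that F ignores the entries from m on.\<close>

definition seq_linear :: "nat \<Rightarrow> ((nat \<Rightarrow> real) \<Rightarrow> nat \<Rightarrow> real) \<Rightarrow> bool" where
  "seq_linear m F \<longleftrightarrow> (\<forall>x y i. F (\<lambda>l. x l + y l) i = F x i + F y i) \<and>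
     (\<forall>c x i. F (\<lambda>l. c * x l) i = c * F x i) \<and>
     (\<forall>x y. (\<forall>l<m. x l = y l) \<longrightarrow> F x = F y)"

definition seq_unit :: "nat \<Rightarrow> nat \<Rightarrow> real" where
  "seq_unit j l = of_bool (l = j)"

definition seq_mat :: "nat \<Rightarrow> ((nat \<Rightarrow> real) \<Rightarrow> nat \<Rightarrow> real) \<Rightarrow> real Matrix.mat" where
  "seq_mat m F = Matrix.mat m m (\<lambda>(i, j). F (seq_unit j) i)"

lemma seq_mat_carrier [simp]: "seq_mat m F \<in> carrier_mat m m"
  by (simp add: seq_mat_def)

lemma seq_linear_expand:
  assumes F: "seq_linear m F"
  shows "F x i = (\<Sum>j<m. x j * F (seq_unit j) i)"
proof -
  have add: "F (\<lambda>l. x l + y l) i = F x i + F y i" and smult: "F (\<lambda>l. c * x l) i = c * F x i"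
    and cong: "(\<forall>l<m. x l = y l) \<Longrightarrow> F x = F y" for x y c i
    using F unfolding seq_linear_def by blast+
  have zero: "F (\<lambda>_. 0) i = 0" using smult[of 0 "\<lambda>_. 0" i] by simp
  have "F (\<lambda>l. \<Sum>j<n. x j * seq_unit j l) i = (\<Sum>j<n. x j * F (seq_unit j) i)" for n
    by (induction n) (simp_all add: zero add smult)
  moreover have "F x = F (\<lambda>l. \<Sum>j<m. x j * seq_unit j l)"
    by (rule cong) (simp add: seq_unit_def)
  ultimately show ?thesis by simp
qed

lemma seq_mat_singular:
  assumes F: "seq_linear m F" and det: "Determinant.det (seq_mat m F) = 0"
  obtains x where "\<exists>j<m. x j \<noteq> 0" "\<And>i. i < m \<Longrightarrow> F x i = 0"
proof -
  obtain v where v: "v \<in> carrier_vec m" "v \<noteq> 0\<^sub>v m" "seq_mat m F *\<^sub>v v = 0\<^sub>v m"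
    using det det_0_iff_vec_prod_zero_field[OF seq_mat_carrier] by blast
  define x where "x j = Matrix.vec_index v j" for j
  have "\<exists>j<m. x j \<noteq> 0"
  proof (rule ccontr)
    assume "\<not> ?thesis"
    then have "v = 0\<^sub>v m" using v(1) by (intro eq_vecI) (auto simp: x_def)
    with v(2) show False by simp
  qed
  moreover have "F x i = 0" if "i < m" for i
  proof -
    have "Matrix.vec_index (seq_mat m F *\<^sub>v v) i = 0" using v(3) that by simp
    also have "Matrix.vec_index (seq_mat m F *\<^sub>v v) i = (\<Sum>j<m. F (seq_unit j) i * x j)"
      using that v(1)
      by (auto simp: seq_mat_def mult_mat_vec_def Matrix.scalar_prod_def x_def lessThan_atLeast0 intro!: sum.cong)
    finally show ?thesis by (subst seq_linear_expand[OF F]) (simp add: mult.commute)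
  qed
  ultimately show thesis using that by blast
qed

lemma continuous_on_det_seq_mat:
  assumes "\<And>i j. i < m \<Longrightarrow> j < m \<Longrightarrow> continuous_on S (\<lambda>s. F s (seq_unit j) i)"
  shows "continuous_on S (\<lambda>s. Determinant.det (seq_mat m (F s)))"
proof -
  have "Determinant.det (seq_mat m (F s)) = (\<Sum>p | p permutes {0..<m}. signof p * (\<Prod>i = 0..<m. F s (seq_unit (p i)) i))" for s
    unfolding det_def'[OF seq_mat_carrier]
    by (intro sum.cong refl arg_cong2[where f = "(*)"] prod.cong) (auto simp: seq_mat_def)
  then show ?thesis
    by (simp only:) (intro continuous_intros continuous_on_sum continuous_on_prod assms, auto)
qed

lemma det_seq_mat_scalar:
  assumes "\<And>x i. i < m \<Longrightarrow> F x i = c * x i"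
  shows "Determinant.det (seq_mat m F) = c ^ m"
proof -
  have "seq_mat m F = c \<cdot>\<^sub>m 1\<^sub>m m"
    by (rule eq_matI) (auto simp: seq_mat_def assms seq_unit_def)
  then show ?thesis by simp
qed

text \<open>In the splitting 2 + P + P the matrix is block upper triangular, with a diagonal head
  and the remaining block diag(T, T); R collects the couplings of the other modes into the head
  rows. The repeated block produces the square.\<close>

lemma det_seq_mat_blocks:
  assumes m: "m = 2 + 2 * P"
    and head: "\<And>i j. j < 2 \<Longrightarrow> i < m \<Longrightarrow> F (seq_unit j) i = (if i = j then d j else 0)"
    and off1: "\<And>i j. j \<in> {2..<2+P} \<Longrightarrow> i \<in> {2+P..<m} \<Longrightarrow> F (seq_unit j) i = 0"
    and off2: "\<And>i j. j \<in> {2+P..<m} \<Longrightarrow> i \<in> {2..<2+P} \<Longrightarrow> F (seq_unit j) i = 0"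
    and shift: "\<And>i j. i \<in> {2..<2+P} \<Longrightarrow> j \<in> {2..<2+P} \<Longrightarrow> F (seq_unit (j + P)) (i + P) = F (seq_unit j) i"
  shows "\<exists>t. Determinant.det (seq_mat m F) = d 0 * d 1 * t\<^sup>2"
proof -
  define D where "D = Matrix.mat 2 2 (\<lambda>(i, j). if i = j then d j else 0)"
  define R where "R = Matrix.mat 2 (2 * P) (\<lambda>(i, j). F (seq_unit (j + 2)) i)"
  define T where "T = Matrix.mat P P (\<lambda>(i, j). F (seq_unit (j + 2)) (i + 2))"
  define TT where "TT = four_block_mat T (0\<^sub>m P P) (0\<^sub>m P P) T"
  have T: "T \<in> carrier_mat P P" and TT: "TT \<in> carrier_mat (2 * P) (2 * P)"
    and D: "D \<in> carrier_mat 2 2" and R: "R \<in> carrier_mat 2 (2 * P)"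
    by (auto simp: T_def TT_def D_def R_def)
  have "seq_mat m F = four_block_mat D R (0\<^sub>m (2 * P) 2) TT"
  proof (rule eq_matI)
    fix i j assume "i < dim_row (four_block_mat D R (0\<^sub>m (2 * P) 2) TT)"
      and "j < dim_col (four_block_mat D R (0\<^sub>m (2 * P) 2) TT)"
    then have ij: "i < m" "j < m" using D TT m by auto
    show "seq_mat m F $$ (i, j) = four_block_mat D R (0\<^sub>m (2 * P) 2) TT $$ (i, j)"
    proof (cases "j < 2")
      case True
      then show ?thesis using ij head m by (auto simp: seq_mat_def D_def TT_def T_def R_def)
    next
      case j: False
      then have [simp]: "Suc (Suc (j - 2)) = j" by simp
      show ?thesis
      proof (cases "i < 2")
        case True
        then show ?thesis using ij j m by (auto simp: seq_mat_def D_def TT_def T_def R_def)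
      next
        case i: False
        then have [simp]: "Suc (Suc (i - 2)) = i" by simp
        have off1': "F (seq_unit j) i = 0" if "j < 2 + P" "\<not> i < 2 + P"
          using off1[of j i] ij i j that by simp
        have off2': "F (seq_unit j) i = 0" if "\<not> j < 2 + P" "i < 2 + P"
          using off2[of j i] ij i j that by simp
        have shift': "F (seq_unit j) i = F (seq_unit (j - P)) (i - P)" if "\<not> j < 2 + P" "\<not> i < 2 + P"
        proof -
          have "i - P \<in> {2..<2+P}" "j - P \<in> {2..<2+P}" "i - P + P = i" "j - P + P = j"
            using ij that unfolding m by auto
          then show ?thesis using shift by metis
        qed
        have [simp]: "Suc (Suc (j - 2 - P)) = j - P" "Suc (Suc (i - 2 - P)) = i - P" "Suc (Suc (j - Suc (Suc P))) = j - P" "Suc (Suc (i - Suc (Suc P))) = i - P"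
          if "\<not> j < 2 + P" "\<not> i < 2 + P" using that by auto
        have *: "i - 2 < P \<longleftrightarrow> i < 2 + P" "j - 2 < P \<longleftrightarrow> j < 2 + P" using i j by auto
        have ij': "i - 2 < 2 * P" "j - 2 < 2 * P" using ij i j m by auto
        have "TT $$ (i - 2, j - 2) = F (seq_unit j) i"
          using ij' ij i j off1' off2' shift' m
          by (auto simp: TT_def T_def * numeral_2_eq_2 Suc_diff_Suc)
        then show ?thesis using ij i j D TT m by (simp add: seq_mat_def)
      qed
    qed
  qed (use D TT m in \<open>auto simp: seq_mat_def\<close>)
  then have "Determinant.det (seq_mat m F) = Determinant.det D * Determinant.det TT"
    using det_four_block_mat_lower_left_zero[OF D R _ TT] by simp
  also have "Determinant.det TT = (Determinant.det T)\<^sup>2"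
    unfolding TT_def by (subst det_four_block_mat_lower_left_zero[OF T _ _ T]) (auto simp: power2_eq_square)
  also have "Determinant.det D = d 0 * d 1"
    by (subst det_upper_triangular[OF _ D]) (auto simp: D_def upper_triangular_def diag_mat_def numeral_2_eq_2)
  finally show ?thesis by blast
qed

subsection \<open>The truncated Fourier system\<close>

text \<open>Mode n - 1. Below mode 0 comes mode -1, which for a real function is the conjugate of
  mode 1.\<close>

fun prv :: "(nat \<Rightarrow> complex) \<Rightarrow> nat \<Rightarrow> complex" where
  "prv c 0 = cnj (c 1)"
| "prv c (Suc n) = c n"

text \<open>The truncated system lives on the modes $|n| \le N$ of a real function $e^{kt} \sum a_n e^{int}$, with
  $a_{-n} = \overline{a_n}$, so only $n \ge 0$ is stored. The real unknowns are the two zero modes, then the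
  real parts of modes $1, \dots, N$, then their imaginary parts. The second component carries an extra factor $i$:
  at $k = 0$ this makes the real and the imaginary block decouple and obey the same real matrix.\<close>

definition mode_a :: "nat \<Rightarrow> (nat \<Rightarrow> real) \<Rightarrow> nat \<Rightarrow> complex" where
  "mode_a N x n = (if n = 0 then of_real (x 0) else if n \<le> N then Complex (x (2*n)) (x (2*N + 2*n)) else 0)"

definition mode_b :: "nat \<Rightarrow> (nat \<Rightarrow> real) \<Rightarrow> nat \<Rightarrow> complex" where
  "mode_b N x n = (if n = 0 then of_real (x 1) else if n \<le> N then \<i> * Complex (x (2*n + 1)) (x (2*N + 2*n + 1)) else 0)"

text \<open>The parameter $\tau$ deforms the system ($\tau = 1$) into $k^2$ times the identity ($\tau = 0$).\<close>

definition expo :: "real \<Rightarrow> real \<Rightarrow> nat \<Rightarrow> complex" where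
  "expo \<tau> k n = Complex k (\<tau> * n)"

text \<open>At \<tau> = 1 these are the modes of q1'' - 2 q2' and, in \<open>accel2\<close>, of q2''
  + 2 q1', for functions q1 and q2 with the coefficients a and b.\<close>

definition accel1 :: "real \<Rightarrow> real \<Rightarrow> (nat \<Rightarrow> complex) \<Rightarrow> (nat \<Rightarrow> complex) \<Rightarrow> nat \<Rightarrow> complex" where
  "accel1 \<tau> k a b n = (expo \<tau> k n)\<^sup>2 * a n - 2 * of_real \<tau> * expo \<tau> k n * b n"
definition accel2 :: "real \<Rightarrow> real \<Rightarrow> (nat \<Rightarrow> complex) \<Rightarrow> (nat \<Rightarrow> complex) \<Rightarrow> nat \<Rightarrow> complex" where
  "accel2 \<tau> k a b n = 2 * of_real \<tau> * expo \<tau> k n * a n + (expo \<tau> k n)\<^sup>2 * b n"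

text \<open>At \<tau> = 1 this is mode n of (1 + e cos t) c - l a; the factor e/2 comes from cos t =
  (e^{it} + e^{-it})/2.\<close>

definition balance :: "real \<Rightarrow> real \<Rightarrow> real \<Rightarrow> (nat \<Rightarrow> complex) \<Rightarrow> (nat \<Rightarrow> complex) \<Rightarrow> nat \<Rightarrow> complex" where
  "balance \<tau> e l c a n = c n + of_real (\<tau> * e / 2) * (prv c n + c (Suc n)) - of_real (\<tau> * l) * a n"

definition mode_eq1 where
  "mode_eq1 \<tau> k e l a b n = balance \<tau> e l (accel1 \<tau> k a b) a n"
definition mode_eq2 where
  "mode_eq2 \<tau> k e l a b n = balance \<tau> e l (accel2 \<tau> k a b) b n"

text \<open>Rows are ordered like the unknowns. For modes n >= 1 the entries Im and -Re of the
  second equation are its real and imaginary parts after multiplication by -i, which undoes the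
  factor i of \<open>mode_b\<close>; without this the homotopy would not start at a multiple of the
  identity.\<close>

definition galerkin :: "real \<Rightarrow> real \<Rightarrow> real \<Rightarrow> nat \<Rightarrow> real \<Rightarrow> real \<Rightarrow> (nat \<Rightarrow> real) \<Rightarrow> nat \<Rightarrow> real" where
  "galerkin e l3 l4 N \<tau> k x i = (let E1 = mode_eq1 \<tau> k e l3 (mode_a N x) (mode_b N x); E2 = mode_eq2 \<tau> k e l4 (mode_a N x) (mode_b N x) in
     if i = 0 then Re (E1 0) else if i = 1 then Re (E2 0)
     else if i < 2 * N + 2 then (if even i then Re (E1 (i div 2)) else Im (E2 (i div 2)))
     else (if even i then Im (E1 (i div 2 - N)) else - Re (E2 (i div 2 - N))))"

lemma mode_a_add: "mode_a N (\<lambda>l. x l + y l) = (\<lambda>n. mode_a N x n + mode_a N y n)"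
  and mode_b_add: "mode_b N (\<lambda>l. x l + y l) = (\<lambda>n. mode_b N x n + mode_b N y n)"
  and mode_a_smult: "mode_a N (\<lambda>l. c * x l) = (\<lambda>n. of_real c * mode_a N x n)"
  and mode_b_smult: "mode_b N (\<lambda>l. c * x l) = (\<lambda>n. of_real c * mode_b N x n)"
  by (auto simp: mode_a_def mode_b_def fun_eq_iff complex_eq_iff algebra_simps)

lemma prv_add: "prv (\<lambda>n. c n + d n) n = prv c n + prv d n" by (cases n) auto
lemma prv_smult: "prv (\<lambda>n. of_real r * c n) n = of_real r * prv c n" by (cases n) auto

lemma accel_add: "accel1 \<tau> k (\<lambda>n. a n + a' n) (\<lambda>n. b n + b' n) = (\<lambda>n. accel1 \<tau> k a b n + accel1 \<tau> k a' b' n)"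
  "accel2 \<tau> k (\<lambda>n. a n + a' n) (\<lambda>n. b n + b' n) = (\<lambda>n. accel2 \<tau> k a b n + accel2 \<tau> k a' b' n)"
  by (auto simp: accel1_def accel2_def fun_eq_iff algebra_simps)
lemma accel_smult: "accel1 \<tau> k (\<lambda>n. z * a n) (\<lambda>n. z * b n) = (\<lambda>n. z * accel1 \<tau> k a b n)"
  "accel2 \<tau> k (\<lambda>n. z * a n) (\<lambda>n. z * b n) = (\<lambda>n. z * accel2 \<tau> k a b n)"
  by (auto simp: accel1_def accel2_def fun_eq_iff algebra_simps)

lemma mode_eq_add:
  "mode_eq1 \<tau> k e l (\<lambda>n. a n + a' n) (\<lambda>n. b n + b' n) n = mode_eq1 \<tau> k e l a b n + mode_eq1 \<tau> k e l a' b' n"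
  "mode_eq2 \<tau> k e l (\<lambda>n. a n + a' n) (\<lambda>n. b n + b' n) n = mode_eq2 \<tau> k e l a b n + mode_eq2 \<tau> k e l a' b' n"
  unfolding mode_eq1_def mode_eq2_def accel_add balance_def prv_add by (simp_all add: algebra_simps)
lemma mode_eq_smult:
  "mode_eq1 \<tau> k e l (\<lambda>n. of_real r * a n) (\<lambda>n. of_real r * b n) n = of_real r * mode_eq1 \<tau> k e l a b n"
  "mode_eq2 \<tau> k e l (\<lambda>n. of_real r * a n) (\<lambda>n. of_real r * b n) n = of_real r * mode_eq2 \<tau> k e l a b n"
  unfolding mode_eq1_def mode_eq2_def accel_smult balance_def prv_smult by (simp_all add: algebra_simps)

lemma seq_linear_galerkin: "seq_linear (2 + 2 * (2 * N)) (galerkin e l3 l4 N \<tau> k)"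
  unfolding seq_linear_def
proof (intro conjI allI impI)
  fix x y i
  show "galerkin e l3 l4 N \<tau> k (\<lambda>l. x l + y l) i = galerkin e l3 l4 N \<tau> k x i + galerkin e l3 l4 N \<tau> k y i"
    unfolding galerkin_def mode_a_add mode_b_add mode_eq_add Let_def by simp
next
  fix c x i
  show "galerkin e l3 l4 N \<tau> k (\<lambda>l. c * x l) i = c * galerkin e l3 l4 N \<tau> k x i"
    unfolding galerkin_def mode_a_smult mode_b_smult mode_eq_smult Let_def by simp
next
  fix x y :: "nat \<Rightarrow> real" assume "\<forall>l<2 + 2 * (2 * N). x l = y l"
  then have "mode_a N x = mode_a N y" "mode_b N x = mode_b N y"
    by (auto simp: mode_a_def mode_b_def fun_eq_iff)
  then show "galerkin e l3 l4 N \<tau> k x = galerkin e l3 l4 N \<tau> k y"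
    by (intro ext) (simp only: galerkin_def)
qed

lemma galerkin_eq_0D:
  assumes "\<And>i. i < 2 + 2 * (2 * N) \<Longrightarrow> galerkin e l3 l4 N \<tau> k x i = 0" and "n \<le> N"
  shows "mode_eq1 \<tau> k e l3 (mode_a N x) (mode_b N x) n = 0" "mode_eq2 \<tau> k e l4 (mode_a N x) (mode_b N x) n = 0"
proof -
  have "mode_eq1 \<tau> k e l3 (mode_a N x) (mode_b N x) n = 0 \<and> mode_eq2 \<tau> k e l4 (mode_a N x) (mode_b N x) n = 0"
  proof (cases "n = 0")
    case True
    \<comment> \<open>At mode 0 the two neighbours are conjugate, so both equations are real and
      their real parts carry everything.\<close>
    have "Im (mode_eq1 \<tau> k e l3 (mode_a N x) (mode_b N x) 0) = 0" "Im (mode_eq2 \<tau> k e l4 (mode_a N x) (mode_b N x) 0) = 0"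
      by (simp_all add: mode_eq1_def mode_eq2_def balance_def accel1_def accel2_def expo_def mode_a_def mode_b_def
          power2_eq_square)
    then show ?thesis using assms(1)[of 0] assms(1)[of 1] True
      by (simp add: galerkin_def complex_eq_iff)
  next
    case False
    have "even (2 * n)" "odd (2 * n + 1)" "2 * n div 2 = n" "(2 * n + 1) div 2 = n"
      "(2 * N + 2 * n) div 2 - N = n" "(2 * N + 2 * n + 1) div 2 - N = n" by auto
    then show ?thesis using False assms(2)
      assms(1)[of "2 * n"] assms(1)[of "2 * n + 1"] assms(1)[of "2 * N + 2 * n"] assms(1)[of "2 * N + 2 * n + 1"]
      by (simp add: galerkin_def complex_eq_iff)
  qed
  then show "mode_eq1 \<tau> k e l3 (mode_a N x) (mode_b N x) n = 0" "mode_eq2 \<tau> k e l4 (mode_a N x) (mode_b N x) n = 0" by auto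
qed

lemma galerkin_homotopy_start:
  assumes "i < 2 + 2 * (2 * N)"
  shows "galerkin e l3 l4 N 0 k x i = k\<^sup>2 * x i"
proof -
  have *: "even i \<Longrightarrow> 2 * (i div 2) = i" "odd i \<Longrightarrow> Suc (2 * (i div 2)) = i" by auto
  have **: "2 * (i div 2 - N) = 2 * (i div 2) - 2 * N" by (simp add: diff_mult_distrib2)
  have ***: "x (Suc (2 * N + (2 * (i div 2) - 2 * N))) = x i" if "odd i" "\<not> i < 2 * N + 2"
  proof -
    have "Suc (2 * N + (2 * (i div 2) - 2 * N)) = i" using that *(2) by linarith
    then show ?thesis by (rule arg_cong)
  qed
  show ?thesis using assms * ***
    by (auto simp: galerkin_def mode_eq1_def mode_eq2_def balance_def accel1_def accel2_def expo_def mode_a_def mode_b_def ** Let_def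
       power2_eq_square not_less Suc_le_eq)
qed

lemma galerkin_0_head:
  assumes x: "\<And>l. 2 \<le> l \<Longrightarrow> x l = 0"
  shows "galerkin e l3 l4 N 1 0 x i = (if i = 0 then - l3 * x 0 else if i = 1 then - l4 * x 1 else 0)"
proof -
  have ab: "mode_a N x = (\<lambda>n. if n = 0 then of_real (x 0) else 0)" "mode_b N x = (\<lambda>n. if n = 0 then of_real (x 1) else 0)"
    using x by (auto simp: mode_a_def mode_b_def fun_eq_iff complex_eq_iff)
  have c: "accel1 1 0 (mode_a N x) (mode_b N x) = (\<lambda>_. 0)" "accel2 1 0 (mode_a N x) (mode_b N x) = (\<lambda>_. 0)"
    by (auto simp: ab accel1_def accel2_def expo_def fun_eq_iff complex_eq_iff)
  have p: "prv (\<lambda>_. 0) n = 0" for n by (cases n) auto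
  show ?thesis
    unfolding galerkin_def mode_eq1_def mode_eq2_def c balance_def p Let_def by (auto simp: ab)
qed

text \<open>At k = 0 the exponent is s = i n: s^2 is real and s imaginary, so real a with imaginary
  b form an invariant class. This is the purpose of the factor i in \<open>mode_b\<close>;
  \<open>galerkin_0_imag\<close> treats imaginary a with real b in the same way.\<close>

lemma galerkin_0_real:
  assumes x: "x 0 = 0" "x 1 = 0" "\<And>l. 2 * N + 2 \<le> l \<Longrightarrow> x l = 0" and i: "2 * N + 2 \<le> i"
  shows "galerkin e l3 l4 N 1 0 x i = 0"
proof -
  have a: "Im (mode_a N x n) = 0" and b: "Re (mode_b N x n) = 0" for n
    using x by (auto simp: mode_a_def mode_b_def)
  have c: "Im (accel1 1 0 (mode_a N x) (mode_b N x) n) = 0" "Re (accel2 1 0 (mode_a N x) (mode_b N x) n) = 0" for n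
    by (auto simp: accel1_def accel2_def expo_def a b power2_eq_square)
  have p: "Im (prv f n) = 0" if "\<And>n. Im (f n) = 0" for f n using that by (cases n) auto
  have p': "Re (prv f n) = 0" if "\<And>n. Re (f n) = 0" for f n using that by (cases n) auto
  have "Im (mode_eq1 1 0 e l3 (mode_a N x) (mode_b N x) n) = 0" "Re (mode_eq2 1 0 e l4 (mode_a N x) (mode_b N x) n) = 0" for n
    by (auto simp: mode_eq1_def mode_eq2_def balance_def a b c p[OF c(1)] p'[OF c(2)])
  then show ?thesis using i by (auto simp: galerkin_def Let_def)
qed

lemma galerkin_0_imag:
  assumes x: "\<And>l. l < 2 * N + 2 \<Longrightarrow> x l = 0" and i: "2 \<le> i" "i < 2 * N + 2"
  shows "galerkin e l3 l4 N 1 0 x i = 0"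
proof -
  have a: "Re (mode_a N x n) = 0" and b: "Im (mode_b N x n) = 0" for n
    using x by (auto simp: mode_a_def mode_b_def)
  have c: "Re (accel1 1 0 (mode_a N x) (mode_b N x) n) = 0" "Im (accel2 1 0 (mode_a N x) (mode_b N x) n) = 0" for n
    by (auto simp: accel1_def accel2_def expo_def a b power2_eq_square)
  have p: "Im (prv f n) = 0" if "\<And>n. Im (f n) = 0" for f n using that by (cases n) auto
  have p': "Re (prv f n) = 0" if "\<And>n. Re (f n) = 0" for f n using that by (cases n) auto
  have "Re (mode_eq1 1 0 e l3 (mode_a N x) (mode_b N x) n) = 0" "Im (mode_eq2 1 0 e l4 (mode_a N x) (mode_b N x) n) = 0" for n
    by (auto simp: mode_eq1_def mode_eq2_def balance_def a b c p[OF c(2)] p'[OF c(1)])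
  then show ?thesis using i by (auto simp: galerkin_def Let_def)
qed

text \<open>Multiplication by i carries the first block of unknowns to the second. Conjugation
  enters \<open>prv\<close> only at mode 0, so the rows n > 0 are complex linear and commute with
  it.\<close>

lemma galerkin_0_shift:
  assumes x: "\<And>l. l < 2 \<Longrightarrow> x l = 0" "\<And>l. 2 * N + 2 \<le> l \<Longrightarrow> x l = 0"
    and y: "\<And>l. l < 2 * N + 2 \<Longrightarrow> y l = 0" "\<And>l. 2 * N + 2 \<le> l \<Longrightarrow> y l = x (l - 2 * N)"
    and i: "2 \<le> i" "i < 2 * N + 2"
  shows "galerkin e l3 l4 N 1 0 y (i + 2 * N) = galerkin e l3 l4 N 1 0 x i"
proof -
  have a: "mode_a N y = (\<lambda>n. \<i> * mode_a N x n)" and b: "mode_b N y = (\<lambda>n. \<i> * mode_b N x n)"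
    using x y by (auto simp: mode_a_def mode_b_def fun_eq_iff complex_eq_iff)
  have c0: "accel1 1 0 (mode_a N x) (mode_b N x) 0 = 0" "accel2 1 0 (mode_a N x) (mode_b N x) 0 = 0"
    by (simp_all add: accel1_def accel2_def expo_def complex_eq_iff)
  have p: "prv (\<lambda>n. \<i> * f n) n = \<i> * prv f n" if "0 < n" for f n using that by (cases n) auto
  have E: "mode_eq1 1 0 e l3 (mode_a N y) (mode_b N y) n = \<i> * mode_eq1 1 0 e l3 (mode_a N x) (mode_b N x) n"
     "mode_eq2 1 0 e l4 (mode_a N y) (mode_b N y) n = \<i> * mode_eq2 1 0 e l4 (mode_a N x) (mode_b N x) n" if "0 < n" for n
    unfolding mode_eq1_def mode_eq2_def a b accel_smult balance_def p[OF that] by (simp_all add: algebra_simps)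
  have "(i + 2 * N) div 2 - N = i div 2" "0 < i div 2" using i by auto
  then show ?thesis using i E[of "i div 2"] by (auto simp: galerkin_def Let_def)
qed

text \<open>At $k = 0$ the zero modes have no acceleration, so they decouple from the others; the rest consists of two
  copies of one block. The determinant is therefore $\lambda_3 \lambda_4$ times a square.\<close>

lemma det_galerkin_0:
  assumes "0 \<le> l3" "l4 \<le> 0"
  shows "Determinant.det (seq_mat (2 + 2 * (2 * N)) (galerkin e l3 l4 N 1 0)) \<le> 0"
proof -
  have "\<exists>t. Determinant.det (seq_mat (2 + 2 * (2 * N)) (galerkin e l3 l4 N 1 0))
      = (if 0 = (0::nat) then - l3 else - l4) * (if 1 = (0::nat) then - l3 else - l4) * t\<^sup>2"
  proof (rule det_seq_mat_blocks[where d = "\<lambda>i. if i = 0 then - l3 else - l4"])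
    fix i j :: nat assume "j < 2"
    then have "j = 0 \<or> j = 1" by auto
    then show "galerkin e l3 l4 N 1 0 (seq_unit j) i = (if i = j then if j = 0 then - l3 else - l4 else 0)"
      by (subst galerkin_0_head) (auto simp: seq_unit_def)
  next
    fix i j assume "j \<in> {2..<2 + 2 * N}" "i \<in> {2 + 2 * N..<2 + 2 * (2 * N)}"
    then show "galerkin e l3 l4 N 1 0 (seq_unit j) i = 0"
      by (intro galerkin_0_real) (auto simp: seq_unit_def)
  next
    fix i j assume "j \<in> {2 + 2 * N..<2 + 2 * (2 * N)}" "i \<in> {2..<2 + 2 * N}"
    then show "galerkin e l3 l4 N 1 0 (seq_unit j) i = 0"
      by (intro galerkin_0_imag) (auto simp: seq_unit_def)
  next
    fix i j assume "i \<in> {2..<2 + 2 * N}" "j \<in> {2..<2 + 2 * N}"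
    then show "galerkin e l3 l4 N 1 0 (seq_unit (j + 2 * N)) (i + 2 * N) = galerkin e l3 l4 N 1 0 (seq_unit j) i"
      by (intro galerkin_0_shift) (auto simp: seq_unit_def)
  qed simp
  then obtain t where "Determinant.det (seq_mat (2 + 2 * (2 * N)) (galerkin e l3 l4 N 1 0)) = (l3 * l4) * t\<^sup>2" by auto
  moreover have "l3 * l4 \<le> 0" using assms by (simp add: mult_nonneg_nonpos)
  ultimately show ?thesis by (simp add: mult_nonpos_nonneg)
qed

text \<open>In the coordinates $a \pm i b$ the symbol is diagonal, with entries $s(s \pm 2 i \tau)$.\<close>

lemma symbol_lower_bound:
  assumes "\<mu> \<le> cmod (expo \<tau> k n * (expo \<tau> k n + 2 * \<i> * of_real \<tau>))"
      and "\<mu> \<le> cmod (expo \<tau> k n * (expo \<tau> k n - 2 * \<i> * of_real \<tau>))" and "0 \<le> \<mu>"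
  shows "\<mu> * (cmod (a n) + cmod (b n)) \<le> 2 * (cmod (accel1 \<tau> k a b n) + cmod (accel2 \<tau> k a b n))"
proof -
  let ?s = "expo \<tau> k n"
  have p: "?s * (?s + 2 * \<i> * of_real \<tau>) * (a n + \<i> * b n) = accel1 \<tau> k a b n + \<i> * accel2 \<tau> k a b n"
    by (simp add: accel1_def accel2_def algebra_simps power2_eq_square)
  have m: "?s * (?s - 2 * \<i> * of_real \<tau>) * (a n - \<i> * b n) = accel1 \<tau> k a b n - \<i> * accel2 \<tau> k a b n"
    by (simp add: accel1_def accel2_def algebra_simps power2_eq_square)
  have P: "\<mu> * cmod (a n + \<i> * b n) \<le> cmod (accel1 \<tau> k a b n) + cmod (accel2 \<tau> k a b n)"
  proof -
    have "\<mu> * cmod (a n + \<i> * b n) \<le> cmod (accel1 \<tau> k a b n + \<i> * accel2 \<tau> k a b n)"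
      unfolding p[symmetric] norm_mult[of "_ * _"] by (intro mult_right_mono assms) simp
    also have "\<dots> \<le> cmod (accel1 \<tau> k a b n) + cmod (\<i> * accel2 \<tau> k a b n)" by (rule norm_triangle_ineq)
    finally show ?thesis by (simp add: norm_mult)
  qed
  have M: "\<mu> * cmod (a n - \<i> * b n) \<le> cmod (accel1 \<tau> k a b n) + cmod (accel2 \<tau> k a b n)"
  proof -
    have "\<mu> * cmod (a n - \<i> * b n) \<le> cmod (accel1 \<tau> k a b n - \<i> * accel2 \<tau> k a b n)"
      unfolding m[symmetric] norm_mult[of "_ * _"] by (intro mult_right_mono assms) simp
    also have "\<dots> \<le> cmod (accel1 \<tau> k a b n) + cmod (\<i> * accel2 \<tau> k a b n)" by (rule norm_triangle_ineq4)
    finally show ?thesis by (simp add: norm_mult)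
  qed
  have "2 * cmod (a n) = cmod ((a n + \<i> * b n) + (a n - \<i> * b n))" by (simp add: norm_mult flip: mult_2)
  also have "\<dots> \<le> cmod (a n + \<i> * b n) + cmod (a n - \<i> * b n)" by (rule norm_triangle_ineq)
  finally have 1: "2 * cmod (a n) \<le> cmod (a n + \<i> * b n) + cmod (a n - \<i> * b n)" .
  have "2 * cmod (b n) = cmod ((a n + \<i> * b n) - (a n - \<i> * b n))" by (simp add: norm_mult flip: mult_2)
  also have "\<dots> \<le> cmod (a n + \<i> * b n) + cmod (a n - \<i> * b n)" by (rule norm_triangle_ineq4)
  finally have "cmod (a n) + cmod (b n) \<le> cmod (a n + \<i> * b n) + cmod (a n - \<i> * b n)" using 1 by simp
  then have "\<mu> * (cmod (a n) + cmod (b n)) \<le> \<mu> * cmod (a n + \<i> * b n) + \<mu> * cmod (a n - \<i> * b n)"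
    unfolding distrib_left[symmetric] by (rule mult_left_mono[OF _ assms(3)])
  also have "\<dots> \<le> (cmod (accel1 \<tau> k a b n) + cmod (accel2 \<tau> k a b n)) + (cmod (accel1 \<tau> k a b n) + cmod (accel2 \<tau> k a b n))"
    by (rule add_mono[OF P M])
  finally show ?thesis by (simp only: mult_2)
qed

section \<open>A priori bounds and singular truncations\<close>

lemma cmod_prv: "cmod (prv c n) = cmod (c (if n = 0 then 1 else n - 1))"
  by (cases n) auto

lemma balance_bound:
  assumes "balance \<tau> e l c a n = 0" "0 \<le> \<tau>" "\<tau> \<le> 1" "0 \<le> e"
  shows "cmod (c n) \<le> \<bar>l\<bar> * cmod (a n) + e / 2 * (cmod (c (if n = 0 then 1 else n - 1)) + cmod (c (Suc n)))"
proof -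
  have "c n = of_real (\<tau> * l) * a n - of_real (\<tau> * e / 2) * (prv c n + c (Suc n))"
    using assms(1) by (simp add: balance_def algebra_simps add_eq_0_iff)
  then have "cmod (c n) \<le> cmod (of_real (\<tau> * l) * a n) + cmod (of_real (\<tau> * e / 2) * (prv c n + c (Suc n)))"
    by (metis norm_triangle_ineq4)
  also have "cmod (of_real (\<tau> * l) * a n) = (\<tau> * \<bar>l\<bar>) * cmod (a n)"
    unfolding norm_mult norm_of_real abs_mult using assms by simp
  also have "cmod (of_real (\<tau> * e / 2) * (prv c n + c (Suc n))) = (\<tau> * e / 2) * cmod (prv c n + c (Suc n))"
    unfolding norm_mult norm_of_real using assms by simp
  also have "(\<tau> * \<bar>l\<bar>) * cmod (a n) + (\<tau> * e / 2) * cmod (prv c n + c (Suc n))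
     \<le> (1 * \<bar>l\<bar>) * cmod (a n) + (1 * e / 2) * (cmod (prv c n) + cmod (c (Suc n)))"
    by (intro add_mono mult_mono divide_right_mono norm_triangle_ineq) (use assms in auto)
  finally show ?thesis unfolding cmod_prv by simp
qed

definition mode_solution :: "real \<Rightarrow> real \<Rightarrow> real \<Rightarrow> real \<Rightarrow> real \<Rightarrow> nat \<Rightarrow> (nat \<Rightarrow> complex) \<Rightarrow> (nat \<Rightarrow> complex) \<Rightarrow> bool" where
  "mode_solution \<tau> k e l3 l4 N a b \<longleftrightarrow>
     (\<forall>n\<le>N. mode_eq1 \<tau> k e l3 a b n = 0 \<and> mode_eq2 \<tau> k e l4 a b n = 0) \<and>
     (\<forall>n>N. a n = 0 \<and> b n = 0) \<and> Im (a 0) = 0 \<and> Im (b 0) = 0"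

definition amp :: "(nat \<Rightarrow> complex) \<Rightarrow> (nat \<Rightarrow> complex) \<Rightarrow> nat \<Rightarrow> real" where
  "amp a b n = cmod (a n) + cmod (b n)"
definition acc :: "real \<Rightarrow> real \<Rightarrow> (nat \<Rightarrow> complex) \<Rightarrow> (nat \<Rightarrow> complex) \<Rightarrow> nat \<Rightarrow> real" where
  "acc \<tau> k a b n = cmod (accel1 \<tau> k a b n) + cmod (accel2 \<tau> k a b n)"

lemma amp_acc_nonneg [simp]: "0 \<le> amp a b n" "0 \<le> acc \<tau> k a b n"
  by (simp_all add: amp_def acc_def)

lemma mode_solution_acc:
  assumes S: "mode_solution \<tau> k e l3 l4 N a b" and "0 \<le> \<tau>" "\<tau> \<le> 1" "0 \<le> e"
    and L: "\<bar>l3\<bar> \<le> L" "\<bar>l4\<bar> \<le> L" and n: "n \<le> N"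
  shows "acc \<tau> k a b n \<le> L * amp a b n
      + e / 2 * (acc \<tau> k a b (if n = 0 then 1 else n - 1) + acc \<tau> k a b (Suc n))"
proof -
  have "balance \<tau> e l3 (accel1 \<tau> k a b) a n = 0" "balance \<tau> e l4 (accel2 \<tau> k a b) b n = 0"
    using S n by (auto simp: mode_solution_def mode_eq1_def mode_eq2_def)
  from this[THEN balance_bound] assms
  have *: "cmod (accel1 \<tau> k a b n) \<le> \<bar>l3\<bar> * cmod (a n) + e / 2 * (cmod (accel1 \<tau> k a b (if n = 0 then 1 else n - 1)) + cmod (accel1 \<tau> k a b (Suc n)))"
    "cmod (accel2 \<tau> k a b n) \<le> \<bar>l4\<bar> * cmod (b n) + e / 2 * (cmod (accel2 \<tau> k a b (if n = 0 then 1 else n - 1)) + cmod (accel2 \<tau> k a b (Suc n)))"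
    by blast+
  have "\<bar>l3\<bar> * cmod (a n) \<le> L * cmod (a n)" "\<bar>l4\<bar> * cmod (b n) \<le> L * cmod (b n)"
    using L by (auto intro: mult_right_mono)
  with * show ?thesis unfolding acc_def amp_def by (simp only: distrib_left)
qed

lemma acc_beyond: "mode_solution \<tau> k e l3 l4 N a b \<Longrightarrow> N < n \<Longrightarrow> acc \<tau> k a b n = 0"
  by (simp add: mode_solution_def acc_def accel1_def accel2_def)

text \<open>At the largest acceleration h the neighbours contribute at most e h, and the symbol,
  whose factors have real part k, gives an amplitude of at most 2 h / k^2. So h <= 2 L h / k^2 + e
  h, which forces h = 0 for this k. The bound is uniform in \<tau>, as the homotopy
  requires.\<close>

lemma mode_solution_trivial:
  assumes S: "mode_solution \<tau> k e l3 l4 N a b" and \<tau>: "0 \<le> \<tau>" "\<tau> \<le> 1" and e: "0 \<le> e" "e < 1"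
    and L: "\<bar>l3\<bar> \<le> L" "\<bar>l4\<bar> \<le> L" and k: "0 < k" "2 * L < (1 - e) * k\<^sup>2"
  shows "amp a b n = 0"
proof -
  have L0: "0 \<le> L" using L by linarith
  define h where "h = Max (acc \<tau> k a b ` {..N})"
  have h: "acc \<tau> k a b n \<le> h" for n
  proof (cases "n \<le> N")
    case True then show ?thesis unfolding h_def by (intro Max_ge) auto
  next
    case False
    have "0 \<le> acc \<tau> k a b 0" by simp
    also have "\<dots> \<le> h" unfolding h_def by (intro Max_ge) auto
    finally show ?thesis using acc_beyond[OF S] False by simp
  qed
  have k2: "0 < k\<^sup>2" using k by simp
  have amp: "k\<^sup>2 * amp a b n \<le> 2 * acc \<tau> k a b n" for n
    unfolding amp_def acc_def
  proof (rule symbol_lower_bound)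
    have "k * k \<le> cmod (expo \<tau> k n) * cmod z" if "Re z = k" for z
    proof (intro mult_mono)
      show "k \<le> cmod (expo \<tau> k n)" using abs_Re_le_cmod[of "expo \<tau> k n"] by (simp add: expo_def)
      show "k \<le> cmod z" using abs_Re_le_cmod[of z] that by simp
    qed (use k in auto)
    from this[of "expo \<tau> k n + 2 * \<i> * of_real \<tau>"] this[of "expo \<tau> k n - 2 * \<i> * of_real \<tau>"]
    show "k\<^sup>2 \<le> cmod (expo \<tau> k n * (expo \<tau> k n + 2 * \<i> * of_real \<tau>))"
      "k\<^sup>2 \<le> cmod (expo \<tau> k n * (expo \<tau> k n - 2 * \<i> * of_real \<tau>))"
      by (simp_all add: norm_mult power2_eq_square expo_def)
  qed simp
  have step: "acc \<tau> k a b n \<le> L * (2 * h / k\<^sup>2) + e * h" if "n \<le> N" for n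
  proof -
    have "amp a b n \<le> 2 * acc \<tau> k a b n / k\<^sup>2" using amp[of n] k2 by (simp add: field_simps)
    also have "\<dots> \<le> 2 * h / k\<^sup>2" using h k2 by (intro divide_right_mono) auto
    finally have "L * amp a b n \<le> L * (2 * h / k\<^sup>2)" using L0 by (rule mult_left_mono)
    moreover have "e / 2 * (acc \<tau> k a b (if n = 0 then 1 else n - 1) + acc \<tau> k a b (Suc n)) \<le> e / 2 * (h + h)"
      using e by (intro mult_left_mono add_mono h) auto
    ultimately show ?thesis using mode_solution_acc[OF S \<tau> e(1) L that] by simp
  qed
  have "h \<in> acc \<tau> k a b ` {..N}" unfolding h_def by (intro Max_in) auto
  then have "h \<le> L * (2 * h / k\<^sup>2) + e * h" using step by auto
  then have "((1 - e) * k\<^sup>2 - 2 * L) * h \<le> 0" using k2 by (simp add: field_simps)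
  then have "h \<le> 0" using k by (simp add: mult_le_0_iff)
  then have "2 * acc \<tau> k a b n \<le> 0" using h[of n] by linarith
  then have "k\<^sup>2 * amp a b n \<le> 0" using amp[of n] by linarith
  then have "amp a b n \<le> 0" using k2 by (simp add: mult_le_0_iff)
  then show ?thesis using amp_acc_nonneg(1)[of a b n] by linarith
qed

lemma galerkin_kernel:
  assumes det: "Determinant.det (seq_mat (2 + 2 * (2 * N)) (galerkin e l3 l4 N \<tau> k)) = 0"
  obtains a b where "mode_solution \<tau> k e l3 l4 N a b" "\<exists>n. amp a b n \<noteq> 0"
proof -
  obtain x where x: "\<exists>j<2 + 2 * (2 * N). x j \<noteq> 0" "\<And>i. i < 2 + 2 * (2 * N) \<Longrightarrow> galerkin e l3 l4 N \<tau> k x i = 0"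
    using seq_mat_singular[OF seq_linear_galerkin det] by blast
  have "mode_solution \<tau> k e l3 l4 N (mode_a N x) (mode_b N x)"
    unfolding mode_solution_def using galerkin_eq_0D[OF x(2)] by (auto simp: mode_a_def mode_b_def)
  moreover have "\<exists>n. amp (mode_a N x) (mode_b N x) n \<noteq> 0"
  proof (rule ccontr)
    assume "\<not> ?thesis"
    then have z: "mode_a N x n = 0 \<and> mode_b N x n = 0" for n
      by (metis amp_def add_nonneg_eq_0_iff norm_ge_zero norm_eq_zero)
    obtain j where j: "j < 2 + 2 * (2 * N)" "x j \<noteq> 0" using x by blast
    consider "j = 0" | "j = 1" | n where "j = 2 * n" "1 \<le> n" "n \<le> N" | n where "j = 2 * n + 1" "1 \<le> n" "n \<le> N"
      | n where "j = 2 * N + 2 * n" "1 \<le> n" "n \<le> N" | n where "j = 2 * N + 2 * n + 1" "1 \<le> n" "n \<le> N"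
    proof -
      have "j = 0 \<or> j = 1 \<or> 1 \<le> j div 2 \<and> j div 2 \<le> N \<or> 1 \<le> j div 2 - N \<and> j div 2 - N \<le> N \<and> j div 2 = N + (j div 2 - N)"
        using j(1) by auto
      moreover have "j = 2 * (j div 2) \<or> j = 2 * (j div 2) + 1" by presburger
      ultimately show thesis using that by (metis add_mult_distrib2 add.assoc)
    qed
    then show False
      using z[of 0] j(2)
    proof cases
      case (3 n) then show ?thesis using z[of n] j(2) by (auto simp: mode_a_def complex_eq_iff)
    next
      case (4 n) then show ?thesis using z[of n] j(2) by (auto simp: mode_b_def complex_eq_iff)
    next
      case (5 n) then show ?thesis using z[of n] j(2) by (auto simp: mode_a_def complex_eq_iff)
    next
      case (6 n) then show ?thesis using z[of n] j(2) by (auto simp: mode_b_def complex_eq_iff)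
    qed (auto simp: mode_a_def mode_b_def)
  qed
  ultimately show thesis using that by blast
qed


lemma continuous_on_galerkin:
  assumes "continuous_on S (\<lambda>s. \<tau> s)" "continuous_on S (\<lambda>s. k s)"
  shows "continuous_on S (\<lambda>s. galerkin e l3 l4 N (\<tau> s) (k s) x i)"
proof -
  have expo: "expo (\<tau> s) (k s) n = of_real (k s) + \<i> * of_real (\<tau> s) * of_nat n" for s n
    by (simp add: expo_def complex_eq_iff)
  have [continuous_intros]: "continuous_on S (\<lambda>s. accel1 (\<tau> s) (k s) a b n)" "continuous_on S (\<lambda>s. accel2 (\<tau> s) (k s) a b n)" for a b n
    unfolding accel1_def accel2_def expo by (intro continuous_intros assms)+
  have [continuous_intros]: "continuous_on S (\<lambda>s. prv (c s) n)" if "\<And>n. continuous_on S (\<lambda>s. c s n)" for c n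
    using that by (cases n) (auto intro!: continuous_intros)
  have [continuous_intros]: "continuous_on S (\<lambda>s. mode_eq1 (\<tau> s) (k s) e l a b n)" "continuous_on S (\<lambda>s. mode_eq2 (\<tau> s) (k s) e l a b n)" for l a b n
    unfolding mode_eq1_def mode_eq2_def balance_def by (intro continuous_intros assms | simp)+
  show ?thesis unfolding galerkin_def Let_def
    by (cases "i = 0"; cases "i = 1"; cases "i < 2 * N + 2"; cases "even i"; simp only: if_True if_False simp_thms)
       (intro continuous_intros)+
qed

text \<open>Two intermediate value arguments. At k = K the determinant vanishes for no \<tau>, so it
  keeps the sign of its value at \<tau> = 0, a power of K^2. At \<tau> = 1 it therefore has a zero
  between k = 0, where it is at most 0, and k = K.\<close>

lemma mode_solution_exists:
  assumes e: "0 \<le> e" "e < 1" and l: "0 \<le> l3" "l4 \<le> 0"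
    and K: "0 < K" "2 * l3 < (1 - e) * K\<^sup>2" "- 2 * l4 < (1 - e) * K\<^sup>2"
  shows "\<exists>k a b. 0 \<le> k \<and> k \<le> K \<and> mode_solution 1 k e l3 l4 N a b \<and> (\<exists>n. amp a b n \<noteq> 0)"
proof -
  let ?m = "2 + 2 * (2 * N)"
  let ?d = "\<lambda>\<tau> k. Determinant.det (seq_mat ?m (galerkin e l3 l4 N \<tau> k))"
  define L where "L = max l3 (- l4)"
  have L: "\<bar>l3\<bar> \<le> L" "\<bar>l4\<bar> \<le> L" "2 * L < (1 - e) * K\<^sup>2"
    using l K by (auto simp: L_def max_def)
  have nz: "?d \<tau> K \<noteq> 0" if "0 \<le> \<tau>" "\<tau> \<le> 1" for \<tau>
  proof
    assume "?d \<tau> K = 0"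
    then obtain a b where "mode_solution \<tau> K e l3 l4 N a b" "\<exists>n. amp a b n \<noteq> 0"
      using galerkin_kernel by blast
    then show False
      using mode_solution_trivial[OF _ that e L(1,2) K(1) L(3)] by blast
  qed
  have pos: "0 < ?d 1 K"
  proof (rule ccontr)
    assume "\<not> ?thesis"
    then have "?d 1 K \<le> 0" by simp
    moreover have "0 \<le> ?d 0 K"
      using det_seq_mat_scalar[of ?m "galerkin e l3 l4 N 0 K" "K\<^sup>2"] galerkin_homotopy_start K(1) by simp
    ultimately have "\<exists>\<tau>. 0 \<le> \<tau> \<and> \<tau> \<le> 1 \<and> ?d \<tau> K = 0"
      by (intro IVT2') (auto intro!: continuous_on_det_seq_mat continuous_on_galerkin continuous_intros)
    then show False using nz by blast
  qed
  have "\<exists>k. 0 \<le> k \<and> k \<le> K \<and> ?d 1 k = 0"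
    using pos det_galerkin_0[OF l] K(1)
    by (intro IVT') (auto intro!: continuous_on_det_seq_mat continuous_on_galerkin continuous_intros)
  then obtain k where k: "0 \<le> k" "k \<le> K" "?d 1 k = 0" by blast
  then show ?thesis using galerkin_kernel[OF k(3)] by metis
qed

subsection \<open>Decay of the truncated solutions\<close>

text \<open>Uniformity in k comes from using imaginary parts only: those of the factors s and s +-
  2i are n and n +- 2.\<close>

lemma mode_solution_amp_decay:
  assumes "2 \<le> n"
  shows "real n * (real n - 2) * amp a b n \<le> 2 * acc 1 k a b n"
  unfolding amp_def acc_def
proof (rule symbol_lower_bound)
  have "real n * (real n - 2) \<le> cmod (expo 1 k n) * cmod z" if "real n - 2 \<le> Im z" for z
  proof (intro mult_mono)
    show "real n \<le> cmod (expo 1 k n)" using abs_Im_le_cmod[of "expo 1 k n"] by (simp add: expo_def)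
    show "real n - 2 \<le> cmod z" using abs_Im_le_cmod[of z] that by simp
  qed (use assms in auto)
  from this[of "expo 1 k n + 2 * \<i> * of_real 1"] this[of "expo 1 k n - 2 * \<i> * of_real 1"]
  show "real n * (real n - 2) \<le> cmod (expo 1 k n * (expo 1 k n + 2 * \<i> * of_real 1))"
    "real n * (real n - 2) \<le> cmod (expo 1 k n * (expo 1 k n - 2 * \<i> * of_real 1))"
    by (simp_all add: norm_mult expo_def)
qed (use assms in auto)

text \<open>The error caused by truncation is governed by the acceleration at mode N, which this
  makes O(1/N) uniformly in k. A linear weight grows so slowly that the dominance e < 1 over the
  neighbours is kept.\<close>

lemma mode_solution_decay:
  assumes e: "0 \<le> e" "e < 1" and L: "\<bar>l3\<bar> \<le> L" "\<bar>l4\<bar> \<le> L"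
  obtains \<delta> C where "0 < \<delta>" "0 \<le> C"
    "\<And>k N a b M. mode_solution 1 k e l3 l4 N a b \<Longrightarrow> (\<And>n. amp a b n \<le> M) \<Longrightarrow>
        acc 1 k a b N * (1 + \<delta> * real N) \<le> C * M"
proof -
  \<comment> \<open>A weight is at most 1 + \<delta> times that of either neighbour, and e (1 +
    \<delta>) <= e + (1 - e)/4 is still below 1.\<close>
  define \<delta> where "\<delta> = (1 - e) / 4"
  define w where "w n = 1 + \<delta> * real n" for n
  \<comment> \<open>From n0 on n (n - 2) >= 8 L / (1 - e), so L times the amplitude is at most (1 -
    e)/4 times the acceleration.\<close>
  define n0 where "n0 = 3 + nat \<lceil>8 * L / (1 - e)\<rceil>"
  have L0: "0 \<le> L" using L by linarith
  have \<delta>: "0 < \<delta>" using e by (simp add: \<delta>_def)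
  have w: "0 < w n" for n unfolding w_def using \<delta> by (intro add_pos_nonneg) auto
  define C where "C = 2 * L * w n0 / (1 - e)"
  have "acc 1 k a b N * (1 + \<delta> * real N) \<le> C * M"
    if S: "mode_solution 1 k e l3 l4 N a b" and M: "\<And>n. amp a b n \<le> M" for k N a b M
  proof -
    define g where "g n = acc 1 k a b n * w n" for n
    have g0: "0 \<le> g n" for n unfolding g_def by (intro mult_nonneg_nonneg less_imp_le[OF w]) simp
    define h where "h = Max (g ` {..N})"
    have h0: "0 \<le> h"
    proof -
      have "g 0 \<le> h" unfolding h_def by (intro Max_ge) auto
      then show ?thesis using g0[of 0] by linarith
    qed
    have h: "g n \<le> h" for n
    proof (cases "n \<le> N")
      case True then show ?thesis unfolding h_def by (intro Max_ge) auto
    next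
      case False
      then show ?thesis using acc_beyond[OF S] h0 by (simp add: g_def)
    qed
    have M0: "0 \<le> M" using M[of 0] amp_acc_nonneg(1)[of a b 0] by linarith
    have step: "g n \<le> L * M * w n0 + (1 - e) / 4 * h + e * (1 + \<delta>) * h" if n: "n \<le> N" for n
    proof -
      let ?p = "if n = 0 then 1 else n - 1"
      have "w n \<le> (1 + \<delta>) * w ?p"
      proof (cases n)
        case 0 then show ?thesis using \<delta> by (simp add: w_def algebra_simps)
      next
        case (Suc m) then show ?thesis using \<delta> by (simp add: w_def algebra_simps)
      qed
      then have "acc 1 k a b ?p * w n \<le> acc 1 k a b ?p * ((1 + \<delta>) * w ?p)" by (rule mult_left_mono) simp
      also have "\<dots> = (1 + \<delta>) * g ?p" by (simp add: g_def)
      also have "\<dots> \<le> (1 + \<delta>) * h" using h \<delta> by (intro mult_left_mono) auto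
      finally have p: "acc 1 k a b ?p * w n \<le> (1 + \<delta>) * h" .
      have "acc 1 k a b (Suc n) * w n \<le> acc 1 k a b (Suc n) * w (Suc n)"
        using \<delta> by (intro mult_left_mono) (auto simp: w_def)
      also have "\<dots> \<le> h" using h[of "Suc n"] by (simp add: g_def)
      also have "\<dots> \<le> (1 + \<delta>) * h" using h0 \<delta> by (simp add: mult_le_cancel_right1)
      finally have q: "acc 1 k a b (Suc n) * w n \<le> (1 + \<delta>) * h" .
      have r: "L * amp a b n * w n \<le> L * M * w n0 + (1 - e) / 4 * h"
      proof (cases "n < n0")
        case True
        have "L * amp a b n * w n \<le> L * M * w n0"
          using True L0 M[of n] M0 \<delta> less_imp_le[OF w[of n]] by (intro mult_mono) (auto simp: w_def)
        moreover have "0 \<le> (1 - e) / 4 * h" using e h0 by simp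
        ultimately show ?thesis by linarith
      next
        case False
        have "8 * L / (1 - e) \<le> real n0 - 3" unfolding n0_def by (simp, linarith)
        also have "\<dots> \<le> real n - 2" using False by simp
        also have "\<dots> \<le> real n * (real n - 2)"
          using False n0_def by (intro mult_right_mono[of 1 "real n" "real n - 2", simplified]) auto
        finally have "8 * L \<le> (1 - e) * (real n * (real n - 2))" using e by (simp add: field_simps)
        then have "8 * L * amp a b n \<le> (1 - e) * (real n * (real n - 2)) * amp a b n"
          by (rule mult_right_mono) simp
        also have "\<dots> = (1 - e) * (real n * (real n - 2) * amp a b n)" by simp
        also have "\<dots> \<le> (1 - e) * (2 * acc 1 k a b n)"
          using False n0_def e by (intro mult_left_mono mode_solution_amp_decay) auto
        finally have "L * amp a b n \<le> (1 - e) / 4 * acc 1 k a b n" by simp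
        then have "L * amp a b n * w n \<le> (1 - e) / 4 * acc 1 k a b n * w n"
          using w[of n] by (intro mult_right_mono) auto
        also have "\<dots> = (1 - e) / 4 * g n" by (simp add: g_def)
        also have "\<dots> \<le> (1 - e) / 4 * h" using e h by (intro mult_left_mono) auto
        finally show ?thesis using L0 M0 w[of n0] by (simp add: add_increasing)
      qed
      have "g n \<le> (L * amp a b n + e / 2 * (acc 1 k a b ?p + acc 1 k a b (Suc n))) * w n"
        unfolding g_def using w[of n] e L n
        by (intro mult_right_mono mode_solution_acc[OF S]) auto
      also have "\<dots> = L * amp a b n * w n + e / 2 * (acc 1 k a b ?p * w n + acc 1 k a b (Suc n) * w n)"
        by (simp only: distrib_right distrib_left mult.assoc)
      also have "\<dots> \<le> L * M * w n0 + (1 - e) / 4 * h + e / 2 * ((1 + \<delta>) * h + (1 + \<delta>) * h)"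
        using e by (intro add_mono r mult_left_mono p q) auto
      finally show ?thesis by (simp add: algebra_simps)
    qed
    have "h \<in> g ` {..N}" unfolding h_def by (intro Max_in) auto
    then have "h \<le> L * M * w n0 + (1 - e) / 4 * h + e * (1 + \<delta>) * h" using step by auto
    moreover have "e * (1 + \<delta>) * h \<le> (e + \<delta>) * h"
      using e \<delta> h0 by (intro mult_right_mono) (auto simp: algebra_simps mult_left_le)
    moreover have "(e + \<delta>) * h = e * h + (h - e * h) / 4" "(1 - e) / 4 * h = (h - e * h) / 4" "(1 - e) * h = h - e * h"
      by (simp_all add: \<delta>_def field_simps)
    \<comment> \<open>The coefficients (1 - e)/4 and e + (1 - e)/4 add up to (1 + e)/2, which leaves
      (1 - e)/2 on the left.\<close>
    ultimately have "(1 - e) * h \<le> 2 * (L * M * w n0)" by argo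
    then have "h \<le> C * M" using e by (simp add: C_def field_simps)
    then show ?thesis using h[of N] by (simp add: g_def w_def)
  qed
  moreover have "0 \<le> C" using e L0 w[of n0] by (simp add: C_def)
  ultimately show thesis using that \<delta> by blast
qed

section \<open>Two-sided Fourier sums and the modes beyond the cut-off\<close>

definition ext :: "(nat \<Rightarrow> complex) \<Rightarrow> int \<Rightarrow> complex" where
  "ext f n = (if 0 \<le> n then f (nat n) else cnj (f (nat (- n))))"

lemma ext_of_nat [simp]: "ext f (int m) = f m" by (simp add: ext_def)

lemma ext_minus: "Im (f 0) = 0 \<Longrightarrow> ext f (- n) = cnj (ext f n)"
  by (cases "n = 0") (auto simp: ext_def complex_eq_iff)

text \<open>For negative n this is the conjugate of the equation at -n, with the two neighbours
  exchanged; mode 0 has its conjugate neighbour built into \<open>prv\<close>.\<close>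

lemma ext_balance:
  assumes c0: "Im (c 0) = 0" and a0: "Im (a 0) = 0"
    and bal: "\<And>m. m \<le> N \<Longrightarrow> balance 1 e l c a m = 0" and n: "\<bar>n\<bar> \<le> int N"
  shows "ext c n + of_real (e / 2) * (ext c (n - 1) + ext c (n + 1)) = of_real l * ext a n"
proof -
  have nat: "ext c (int m) + of_real (e / 2) * (ext c (int m - 1) + ext c (int m + 1)) = of_real l * ext a (int m)"
    if "m \<le> N" for m
  proof -
    have "ext c (int m - 1) = prv c m"
      by (cases m) (auto simp: ext_def)
    moreover have "ext c (int m + 1) = c (Suc m)" using ext_of_nat[of c "Suc m"] by (simp add: add.commute)
    ultimately show ?thesis using bal[OF that] by (simp add: balance_def)
  qed
  show ?thesis
  proof (cases "0 \<le> n")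
    case True
    then obtain m where "n = int m" by (metis nonneg_int_cases)
    then show ?thesis using nat n by simp
  next
    case False
    then obtain m where m: "n = - int m" by (metis int_cases2 of_nat_0_le_iff)
    have "ext c (- int m - 1) = cnj (ext c (int m + 1))" "ext c (- int m + 1) = cnj (ext c (int m - 1))"
      using ext_minus[where f = c, OF c0, of "int m + 1"] ext_minus[where f = c, OF c0, of "int m - 1"]
      by (simp_all only: minus_add_distrib minus_diff_eq diff_conv_add_uminus add.commute[of 1] minus_minus)
    moreover have "cnj (ext c (int m) + of_real (e / 2) * (ext c (int m - 1) + ext c (int m + 1))) = cnj (of_real l * ext a (int m))"
      using nat[of m] n m by simp
    ultimately show ?thesis using m n
      by (simp add: ext_minus[where f = c, OF c0] ext_minus[where f = a, OF a0] add.commute)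
  qed
qed

definition chr :: "real \<Rightarrow> int \<Rightarrow> complex" where
  "chr k n = Complex k (real_of_int n)"

definition wave :: "real \<Rightarrow> int \<Rightarrow> real \<Rightarrow> complex" where
  "wave k n t = exp (chr k n * of_real t)"

lemma ext_accel:
  assumes "Im (a 0) = 0" "Im (b 0) = 0"
  shows "ext (accel1 1 k a b) n = (chr k n)\<^sup>2 * ext a n - 2 * chr k n * ext b n"
    and "ext (accel2 1 k a b) n = 2 * chr k n * ext a n + (chr k n)\<^sup>2 * ext b n"
proof -
  have "cnj (expo 1 k (nat (-n))) = chr k n" if "n < 0"
    using that by (simp add: expo_def chr_def complex_eq_iff)
  moreover have "expo 1 k (nat n) = chr k n" if "0 \<le> n"
    using that by (simp add: expo_def chr_def)
  ultimately show "ext (accel1 1 k a b) n = (chr k n)\<^sup>2 * ext a n - 2 * chr k n * ext b n"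
    and "ext (accel2 1 k a b) n = 2 * chr k n * ext a n + (chr k n)\<^sup>2 * ext b n"
    by (auto simp: ext_def accel1_def accel2_def)
qed

lemma wave_shift: "wave k n t * cis t = wave k (n + 1) t" "wave k n t * cis (- t) = wave k (n - 1) t"
proof -
  have "chr k n * of_real t + \<i> * of_real t = chr k (n + 1) * of_real t"
    "chr k n * of_real t + \<i> * of_real (- t) = chr k (n - 1) * of_real t"
    by (simp_all add: chr_def complex_eq_iff algebra_simps)
  then show "wave k n t * cis t = wave k (n + 1) t" "wave k n t * cis (- t) = wave k (n - 1) t"
    unfolding wave_def cis_conv_exp exp_add[symmetric] by simp_all
qed

lemma sum_shift_up:
  fixes f :: "int \<Rightarrow> complex"
  assumes "f (- int N - 1) = 0"
  shows "(\<Sum>n\<in>{- int N..int N}. f n * g (n + 1)) = (\<Sum>n\<in>{- int N..int N}. f (n - 1) * g n) + f (int N) * g (int N + 1)"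
proof -
  have "(\<Sum>n\<in>{- int N..int N}. f n * g (n + 1)) = (\<Sum>n\<in>{- int N + 1..int N + 1}. f (n - 1) * g n)"
    by (rule sum.reindex_bij_witness[where i = "\<lambda>n. n - 1" and j = "\<lambda>n. n + 1"]) auto
  also have "\<dots> = (\<Sum>n\<in>{- int N..int N + 1}. f (n - 1) * g n)"
  proof (rule sum.mono_neutral_left)
    have "i = - int N" if "i \<in> {- int N..int N + 1} - {- int N + 1..int N + 1}" for i using that by auto
    then show "\<forall>i\<in>{- int N..int N + 1} - {- int N + 1..int N + 1}. f (i - 1) * g i = 0"
      using assms by (metis mult_zero_left)
  qed auto
  also have "{- int N..int N + 1} = insert (int N + 1) {- int N..int N}" by auto
  finally show ?thesis by (simp add: add.commute)
qed

lemma sum_shift_down: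
  fixes f :: "int \<Rightarrow> complex"
  assumes "f (int N + 1) = 0"
  shows "(\<Sum>n\<in>{- int N..int N}. f n * g (n - 1)) = (\<Sum>n\<in>{- int N..int N}. f (n + 1) * g n) + f (- int N) * g (- int N - 1)"
proof -
  have "(\<Sum>n\<in>{- int N..int N}. f n * g (n - 1)) = (\<Sum>n\<in>{- int N - 1..int N - 1}. f (n + 1) * g n)"
    by (rule sum.reindex_bij_witness[where i = "\<lambda>n. n + 1" and j = "\<lambda>n. n - 1"]) auto
  also have "\<dots> = (\<Sum>n\<in>{- int N - 1..int N}. f (n + 1) * g n)"
  proof (rule sum.mono_neutral_left)
    have "i = int N" if "i \<in> {- int N - 1..int N} - {- int N - 1..int N - 1}" for i using that by auto
    then show "\<forall>i\<in>{- int N - 1..int N} - {- int N - 1..int N - 1}. f (i + 1) * g i = 0"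
      using assms by (metis mult_zero_left)
  qed auto
  also have "{- int N - 1..int N} = insert (- int N - 1) {- int N..int N}" by auto
  finally show ?thesis by (simp add: add.commute)
qed

text \<open>No equation is imposed at the modes N + 1 and -N - 1, so multiplication by the cosine
  leaves exactly these two terms unbalanced.\<close>

lemma wave_sum_balance:
  assumes bal: "\<And>n. \<bar>n\<bar> \<le> int N \<Longrightarrow> c n + of_real (e / 2) * (c (n - 1) + c (n + 1)) = of_real l * a n"
    and c: "\<And>n. \<bar>n\<bar> > int N \<Longrightarrow> c n = 0"
  shows "of_real (1 + e * cos t) * (\<Sum>n\<in>{- int N..int N}. c n * wave k n t)
     = of_real l * (\<Sum>n\<in>{- int N..int N}. a n * wave k n t)
       + of_real (e / 2) * (c (int N) * wave k (int N + 1) t + c (- int N) * wave k (- int N - 1) t)"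
proof -
  let ?S = "{- int N..int N}"
  have cosE: "of_real (1 + e * cos t) = 1 + of_real (e / 2) * (cis t + cis (- t))"
    by (simp add: complex_eq_iff)
  have "of_real (1 + e * cos t) * (\<Sum>n\<in>?S. c n * wave k n t) =
     (\<Sum>n\<in>?S. c n * wave k n t) + of_real (e / 2) * ((\<Sum>n\<in>?S. c n * wave k (n + 1) t) + (\<Sum>n\<in>?S. c n * wave k (n - 1) t))"
    unfolding cosE wave_shift[symmetric] by (simp add: sum_distrib_left sum.distrib algebra_simps)
  also have "\<dots> = (\<Sum>n\<in>?S. (c n + of_real (e / 2) * (c (n - 1) + c (n + 1))) * wave k n t)
       + of_real (e / 2) * (c (int N) * wave k (int N + 1) t + c (- int N) * wave k (- int N - 1) t)"
    using sum_shift_up[of c N "\<lambda>n. wave k n t"] sum_shift_down[of c N "\<lambda>n. wave k n t"] c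
    by (simp add: sum_distrib_left sum.distrib algebra_simps)
  also have "(\<Sum>n\<in>?S. (c n + of_real (e / 2) * (c (n - 1) + c (n + 1))) * wave k n t) = (\<Sum>n\<in>?S. of_real l * a n * wave k n t)"
    by (intro sum.cong refl arg_cong2[where f = "(*)"] bal) auto
  finally show ?thesis by (simp add: sum_distrib_left mult.assoc)
qed

subsection \<open>Trigonometric approximate solutions\<close>

lemma cmat_mult: "cmat (A ** B) = cmat A ** cmat B"
  by (simp add: cmat_def matrix_matrix_mult_def vec_eq_iff)

lemma bounded_bilinear_cmat_vec: "bounded_bilinear (\<lambda>(M :: real^4^4) (v :: complex^4). cmat M *v v)"
  unfolding bilinear_conv_bounded_bilinear[symmetric] bilinear_def
  by (intro conjI allI linearI)
     (simp_all add: cmat_def matrix_vector_mult_def vec_eq_iff algebra_simps sum.distrib sum_distrib_left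
       scaleR_conv_of_real[where 'a = complex] scaleR_sum_right)

text \<open>The momenta of the Hamiltonian system are p1 = q1' - q2 and p2 = q2' + q1, which gives
  the first two entries.\<close>

definition trial_coeff :: "real \<Rightarrow> (nat \<Rightarrow> complex) \<Rightarrow> (nat \<Rightarrow> complex) \<Rightarrow> int \<Rightarrow> complex^4" where
  "trial_coeff k a b n = vector [chr k n * ext a n - ext b n, chr k n * ext b n + ext a n, ext a n, ext b n]"

definition trial :: "real \<Rightarrow> nat \<Rightarrow> (nat \<Rightarrow> complex) \<Rightarrow> (nat \<Rightarrow> complex) \<Rightarrow> real \<Rightarrow> complex^4" where
  "trial k N a b t = (\<Sum>n\<in>{- int N..int N}. wave k n t *s trial_coeff k a b n)"

definition boundary_term :: "real \<Rightarrow> real \<Rightarrow> nat \<Rightarrow> (nat \<Rightarrow> complex) \<Rightarrow> real \<Rightarrow> complex" where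
  "boundary_term e k N c t =
     of_real (e / 2) * (ext c (int N) * wave k (int N + 1) t + ext c (- int N) * wave k (- int N - 1) t)"

definition residual :: "real \<Rightarrow> real \<Rightarrow> nat \<Rightarrow> (nat \<Rightarrow> complex) \<Rightarrow> (nat \<Rightarrow> complex) \<Rightarrow> real \<Rightarrow> complex^4" where
  "residual e k N a b t = of_real (1 / (1 + e * cos t)) *s
     vector [boundary_term e k N (accel1 1 k a b) t, boundary_term e k N (accel2 1 k a b) t, 0, 0]"

lemma wave_derivative: "(wave k n has_vector_derivative chr k n * wave k n t) (at t within T)"
proof -
  have "((\<lambda>z. exp (chr k n * z)) has_field_derivative chr k n * exp (chr k n * of_real t)) (at (of_real t))"
    by (auto intro!: derivative_eq_intros)
  from has_vector_derivative_real_field[OF this] show ?thesis by (simp add: wave_def[abs_def])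
qed

lemma trial_derivative_sum:
  "(trial k N a b has_vector_derivative (\<Sum>n\<in>{- int N..int N}. (chr k n * wave k n t) *s trial_coeff k a b n)) (at t within T)"
  unfolding trial_def[abs_def]
proof (rule has_vector_derivative_sum)
  fix n
  have "bounded_linear (\<lambda>z. z *s (v :: complex^4))" for v
    unfolding linear_conv_bounded_linear[symmetric]
    by (intro linearI) (auto simp: vec_eq_iff algebra_simps)
  from bounded_linear.has_vector_derivative[OF this wave_derivative]
  show "((\<lambda>t. wave k n t *s trial_coeff k a b n) has_vector_derivative (chr k n * wave k n t) *s trial_coeff k a b n)
      (at t within T)" .
qed

lemma denominator_pos:
  assumes "0 \<le> e" "e < (1::real)"
  shows "0 < 1 + e * cos t" "1 - e \<le> 1 + e * cos t"
proof -
  have "\<bar>e * cos t\<bar> \<le> e * 1" unfolding abs_mult using assms by (intro mult_mono) auto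
  then show "0 < 1 + e * cos t" "1 - e \<le> 1 + e * cos t" using assms by linarith+
qed

text \<open>The last two rows of the system express q' through p and q and hold exactly. The first
  two are the second-order equations divided by 1 + e cos t, so the unbalanced modes appear there
  only.\<close>

lemma trial_solves:
  assumes S: "mode_solution 1 k e (1 + \<alpha> + 3 * \<beta>) (1 + \<alpha> - 3 * \<beta>) N a b" and e: "0 \<le> e" "e < 1"
  shows "(trial k N a b has_vector_derivative
     cmat (J4 ** B_EH \<alpha> \<beta> e t) *v trial k N a b t + residual e k N a b t) (at t within T)"
proof -
  let ?S = "{- int N..int N}"
  let ?l3 = "1 + \<alpha> + 3 * \<beta>" and ?l4 = "1 + \<alpha> - 3 * \<beta>"
  let ?r = "1 + e * cos t"
  have r: "complex_of_real ?r \<noteq> 0" using denominator_pos[OF e, of t] by (metis less_irrefl of_real_eq_0_iff)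
  have im: "Im (a 0) = 0" "Im (b 0) = 0" using S by (auto simp: mode_solution_def)
  then have im': "Im (accel1 1 k a b 0) = 0" "Im (accel2 1 k a b 0) = 0"
    by (simp_all add: accel1_def accel2_def expo_def power2_eq_square)
  have zero: "ext (accel1 1 k a b) n = 0" "ext (accel2 1 k a b) n = 0" if "int N < \<bar>n\<bar>" for n
    using S that by (auto simp: ext_def mode_solution_def accel1_def accel2_def)
  let ?W = "\<lambda>f. \<Sum>n\<in>?S. f n * wave k n t"
  have solve: "w = of_real (l / ?r) * u + of_real (1 / ?r) * z" if "of_real ?r * w = of_real l * u + z" for w u z :: complex and l
  proof -
    have "w = (of_real l * u + z) / of_real ?r" using that r by (metis nonzero_mult_div_cancel_left)
    then show ?thesis by (simp only: add_divide_distrib of_real_divide times_divide_eq_left of_real_1 mult_1)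
  qed
  have 1: "of_real ?r * ?W (ext (accel1 1 k a b)) = of_real ?l3 * ?W (ext a) + boundary_term e k N (accel1 1 k a b) t"
    unfolding boundary_term_def
    using S by (intro wave_sum_balance ext_balance im im' zero) (auto simp: mode_solution_def mode_eq1_def)
  have 2: "of_real ?r * ?W (ext (accel2 1 k a b)) = of_real ?l4 * ?W (ext b) + boundary_term e k N (accel2 1 k a b) t"
    unfolding boundary_term_def
    using S by (intro wave_sum_balance ext_balance im im' zero) (auto simp: mode_solution_def mode_eq2_def)
  have 1: "?W (ext (accel1 1 k a b)) = of_real (?l3 / ?r) * ?W (ext a) + of_real (1 / ?r) * boundary_term e k N (accel1 1 k a b) t"
    using solve[OF 1] .
  have 2: "?W (ext (accel2 1 k a b)) = of_real (?l4 / ?r) * ?W (ext b) + of_real (1 / ?r) * boundary_term e k N (accel2 1 k a b) t"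
    using solve[OF 2] .
  let ?P = "\<lambda>f. \<Sum>n\<in>?S. chr k n * f n * wave k n t"
  have tr: "trial k N a b t $ 1 = ?P (ext a) - ?W (ext b)" "trial k N a b t $ 2 = ?P (ext b) + ?W (ext a)"
     "trial k N a b t $ 3 = ?W (ext a)" "trial k N a b t $ 4 = ?W (ext b)"
    by (simp_all add: trial_def trial_coeff_def sum_component algebra_simps sum.distrib sum_subtractf)
  define D where "D = (\<Sum>n\<in>?S. (chr k n * wave k n t) *s trial_coeff k a b n)"
  have d: "D $ 1 = ?W (ext (accel1 1 k a b)) + ?P (ext b)" "D $ 2 = ?W (ext (accel2 1 k a b)) - ?P (ext a)"
     "D $ 3 = ?P (ext a)" "D $ 4 = ?P (ext b)"
    unfolding D_def ext_accel[where a = a and b = b, OF im]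
    by (simp_all add: trial_coeff_def sum_component algebra_simps power2_eq_square flip: sum.distrib sum_subtractf)
  have "D = cmat (J4 ** B_EH \<alpha> \<beta> e t) *v trial k N a b t + residual e k N a b t"
    by (simp add: vec_eq_iff forall_4 d tr 1 2 residual_def cmat_def matrix_vector_mult_def matrix_matrix_mult_def sum_4
        J4_def B_EH_def) (simp add: algebra_simps)
  with trial_derivative_sum[of k N a b t T] show ?thesis by (simp add: D_def)
qed

lemma trial_quasiperiodic: "trial k N a b (2 * pi) = exp (2 * pi * k) *\<^sub>R trial k N a b 0"
proof -
  have "wave k n (2 * pi) = of_real (exp (2 * pi * k))" for n
  proof -
    have "wave k n (2 * pi) = exp (complex_of_real (2 * pi * k) + 2 * of_int n * of_real pi * \<i>)"
      unfolding wave_def by (rule arg_cong[where f = exp]) (simp add: chr_def complex_eq_iff)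
    also have "\<dots> = exp (complex_of_real (2 * pi * k))"
      using exp_integer_2pi[of "of_int n"] by (simp add: exp_add mult_ac)
    finally show ?thesis by (simp only: exp_of_real)
  qed
  moreover have "wave k n 0 = 1" for n by (simp add: wave_def)
  ultimately show ?thesis
    by (simp add: trial_def vec_eq_iff sum_component scaleR_conv_of_real[where 'a = complex] sum_distrib_left)
qed

text \<open>The dual exponential cancels e^{kt} as well, which reduces the pairing to Fourier
  orthogonality for every k.\<close>

lemma wave_orthogonal:
  "((\<lambda>t. wave k m t * exp (- chr k n * of_real t)) has_integral (if m = n then 2 * pi else 0)) {0..2 * pi}"
proof (cases "m = n")
  case True
  have "((\<lambda>t. 1 :: complex) has_integral of_real (2 * pi)) {0..2 * pi}"
    using has_integral_const_real[of "1::complex" 0 "2 * pi"] by (simp add: scaleR_conv_of_real)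
  moreover have "wave k n t * exp (- chr k n * of_real t) = 1" for t
    by (simp add: wave_def flip: exp_add)
  ultimately show ?thesis using True by simp
next
  case False
  let ?z = "\<i> * of_int (m - n)"
  have z: "?z \<noteq> 0" using False by simp
  have eq: "wave k m t * exp (- chr k n * of_real t) = exp (?z * of_real t)" for t
    unfolding wave_def exp_add[symmetric] by (rule arg_cong[where f = exp]) (simp add: chr_def complex_eq_iff algebra_simps)
  have "((\<lambda>t. exp (?z * of_real t)) has_integral (exp (?z * of_real (2 * pi)) / ?z - exp (?z * of_real 0) / ?z)) {0..2 * pi}"
  proof (rule fundamental_theorem_of_calculus)
    fix t
    have "((\<lambda>w. exp (?z * w) / ?z) has_field_derivative exp (?z * of_real t)) (at (of_real t))"
      using z by (auto intro!: derivative_eq_intros)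
    from has_vector_derivative_real_field[OF this]
    show "((\<lambda>t. exp (?z * of_real t) / ?z) has_vector_derivative exp (?z * of_real t)) (at t within {0..2 * pi})" .
  qed simp
  moreover have "exp (?z * of_real (2 * pi)) = 1"
    using exp_integer_2pi[of "of_int (m - n)"] by (simp add: mult_ac)
  ultimately show ?thesis using False by (simp only: eq) simp
qed

text \<open>A Fourier coefficient of q1 or q2 is the mean over a period of a component of the trial
  function times a dual exponential of modulus e^{-kt} <= 1. The factor 2 counts the two
  components.\<close>

lemma amp_le_trial:
  assumes Q: "\<And>t. t \<in> {0..2 * pi} \<Longrightarrow> norm (trial k N a b t) \<le> Q" and k: "0 \<le> k" and n: "n \<le> N"
  shows "amp a b n \<le> 2 * Q"
proof -
  have coeff: "cmod (f (int n)) \<le> Q"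
    if f: "\<And>t. t \<in> {0..2 * pi} \<Longrightarrow> cmod (\<Sum>m\<in>{- int N..int N}. f m * wave k m t) \<le> Q" for f
  proof -
    let ?g = "\<lambda>t. \<Sum>m\<in>{- int N..int N}. f m * (wave k m t * exp (- chr k (int n) * of_real t))"
    have "(?g has_integral (\<Sum>m\<in>{- int N..int N}. f m * (if m = int n then 2 * pi else 0))) {0..2 * pi}"
      by (intro has_integral_sum has_integral_mult_right wave_orthogonal) auto
    moreover have "(\<Sum>m\<in>{- int N..int N}. f m * (if m = int n then 2 * pi else 0)) = f (int n) * (2 * pi)"
      using n by (simp add: if_distrib[where f = "\<lambda>x. _ * complex_of_real x"] cong: if_cong)
    ultimately have I: "(?g has_integral (f (int n) * (2 * pi))) {0..2 * pi}" by simp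
    have "cmod (f (int n) * (2 * pi)) \<le> Q * measure lborel {0..2 * pi}"
    proof (rule has_integral_bound_real[OF _ finite.emptyI I])
      show "0 \<le> Q" using f[of 0] by (rule order_trans[OF norm_ge_zero]) simp
      fix t assume t: "t \<in> {0..2 * pi} - {}"
      have "?g t = (\<Sum>m\<in>{- int N..int N}. f m * wave k m t) * exp (- chr k (int n) * of_real t)"
        by (simp add: sum_distrib_right mult.assoc)
      then have "cmod (?g t) = cmod (\<Sum>m\<in>{- int N..int N}. f m * wave k m t) * exp (- k * t)"
        by (simp add: norm_mult norm_exp_eq_Re chr_def)
      also have "\<dots> \<le> Q * 1"
        using t k by (intro mult_mono f) (auto intro: order_trans[OF norm_ge_zero f])
      finally show "cmod (?g t) \<le> Q" by simp
    qed
    then have "cmod (f (int n)) * (2 * pi) \<le> Q * (2 * pi)" by (simp add: norm_mult)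
    then show ?thesis by simp
  qed
  have tr: "trial k N a b t $ 3 = (\<Sum>m\<in>{- int N..int N}. ext a m * wave k m t)"
       "trial k N a b t $ 4 = (\<Sum>m\<in>{- int N..int N}. ext b m * wave k m t)" for t
    by (simp_all add: trial_def trial_coeff_def sum_component mult.commute)
  have "cmod (ext a (int n)) \<le> Q" "cmod (ext b (int n)) \<le> Q"
    by (rule coeff, unfold tr[symmetric], rule order_trans[OF Finite_Cartesian_Product.norm_nth_le Q], assumption)+
  then show ?thesis by (simp add: amp_def)
qed

text \<open>By reality both boundary modes have the size of mode N, so decay is needed at this
  single mode.\<close>

lemma residual_bound:
  assumes e: "0 \<le> e" "e < 1" and k: "0 \<le> k" "k \<le> K" and t: "t \<in> {0..2 * pi}"
    and im: "Im (a 0) = 0" "Im (b 0) = 0"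
  shows "norm (residual e k N a b t) \<le> acc 1 k a b N * (exp (2 * pi * K) / (1 - e))"
proof -
  have w: "cmod (wave k n t) \<le> exp (2 * pi * K)" for n
  proof -
    have "k * t \<le> K * (2 * pi)" using k t by (intro mult_mono) auto
    then show ?thesis by (simp add: wave_def norm_exp_eq_Re chr_def mult.commute)
  qed
  have bt: "cmod (boundary_term e k N c t) \<le> cmod (c N) * exp (2 * pi * K)" if c: "Im (c 0) = 0" for c
  proof -
    have x: "cmod (ext c (- int N)) = cmod (c N)" using ext_minus[where f = c, OF c, of "int N"] by simp
    have "cmod (boundary_term e k N c t) = e / 2 * cmod (ext c (int N) * wave k (int N + 1) t + ext c (- int N) * wave k (- int N - 1) t)"
      unfolding boundary_term_def norm_mult norm_of_real using e by simp
    also have "\<dots> \<le> 1 / 2 * (cmod (c N) * exp (2 * pi * K) + cmod (c N) * exp (2 * pi * K))"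
      using e w by (intro mult_mono order_trans[OF norm_triangle_ineq] add_mono) (auto simp: norm_mult x intro!: mult_left_mono)
    finally show ?thesis by simp
  qed
  have im': "Im (accel1 1 k a b 0) = 0" "Im (accel2 1 k a b 0) = 0"
    using im by (simp_all add: accel1_def accel2_def expo_def power2_eq_square)
  let ?v = "vector [boundary_term e k N (accel1 1 k a b) t, boundary_term e k N (accel2 1 k a b) t, 0, 0] :: complex^4"
  have "norm ?v \<le> (\<Sum>i\<in>UNIV. cmod (?v $ i))" unfolding norm_vec_def by (rule L2_set_le_sum) simp
  also have "\<dots> \<le> cmod (accel1 1 k a b N) * exp (2 * pi * K) + cmod (accel2 1 k a b N) * exp (2 * pi * K)"
    using bt[of "accel1 1 k a b", OF im'(1)] bt[of "accel2 1 k a b", OF im'(2)] by (simp add: sum_4)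
  also have "\<dots> = acc 1 k a b N * exp (2 * pi * K)" by (simp add: acc_def algebra_simps)
  finally have v: "norm ?v \<le> acc 1 k a b N * exp (2 * pi * K)" .
  have "residual e k N a b t = (1 / (1 + e * cos t)) *\<^sub>R ?v"
    unfolding residual_def by (simp add: vec_eq_iff scaleR_conv_of_real[where 'a = complex])
  then have "norm (residual e k N a b t) = \<bar>1 / (1 + e * cos t)\<bar> * norm ?v" by simp
  also have "\<dots> \<le> 1 / (1 - e) * (acc 1 k a b N * exp (2 * pi * K))"
  proof (intro mult_mono v)
    show "\<bar>1 / (1 + e * cos t)\<bar> \<le> 1 / (1 - e)"
      using denominator_pos[OF e, of t] e by (simp add: frac_le)
  qed (use e in auto)
  finally show ?thesis by simp
qed

subsection \<open>A positive real multiplier\<close>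

lemma amp_attains_max:
  assumes S: "mode_solution \<tau> k e l3 l4 N a b" and nz: "amp a b m \<noteq> 0"
  obtains n where "n \<le> N" "0 < amp a b n" "\<And>i. amp a b i \<le> amp a b n"
proof -
  have beyond: "amp a b i = 0" if "N < i" for i using S that by (simp add: mode_solution_def amp_def)
  have "Max (amp a b ` {..N}) \<in> amp a b ` {..N}" by (intro Max_in) auto
  then obtain n where n: "Max (amp a b ` {..N}) = amp a b n" "n \<in> {..N}"
    by (rule imageE)
  have le: "amp a b i \<le> amp a b n" for i
  proof (cases "i \<le> N")
    case True
    then have "amp a b i \<le> Max (amp a b ` {..N})" by (intro Max_ge) auto
    then show ?thesis by (simp only: n(1))
  next
    case False then show ?thesis using beyond[of i] by simp
  qed
  have "0 < amp a b m" using nz amp_acc_nonneg(1)[of a b m] by linarith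
  then have "0 < amp a b n" using le[of m] by linarith
  moreover have "n \<le> N" using n(2) by simp
  ultimately show thesis using le by (intro that)
qed

lemma EH_solution_continuous: "EH_solution \<alpha> \<beta> e X \<Longrightarrow> continuous_on {0..2 * pi} X"
  unfolding EH_solution_def continuous_on_eq_continuous_within
  using has_vector_derivative_continuous by blast

lemma cmat_mat_1: "cmat (mat 1) = mat 1"
  by (simp add: cmat_def Finite_Cartesian_Product.mat_def vec_eq_iff)

text \<open>Multiplication by $X^T J$ removes the homogeneous part of the equation.\<close>

lemma symplectic_transform_derivative:
  assumes X: "EH_solution \<alpha> \<beta> e X" and t: "t \<in> {0..2 * pi}"
    and x: "(x has_vector_derivative cmat (J4 ** B_EH \<alpha> \<beta> e t) *v x t + f) (at t within {0..2 * pi})"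
  shows "((\<lambda>t. cmat (transpose (X t) ** J4) *v x t) has_vector_derivative cmat (transpose (X t) ** J4) *v f)
     (at t within {0..2 * pi})"
proof -
  interpret bb: bounded_bilinear "(**) :: real^4^4 \<Rightarrow> real^4^4 \<Rightarrow> real^4^4"
    by (rule bounded_bilinear_matrix_mult)
  interpret cv: bounded_bilinear "\<lambda>(M :: real^4^4) (v :: complex^4). cmat M *v v"
    by (rule bounded_bilinear_cmat_vec)
  let ?B = "B_EH \<alpha> \<beta> e t"
  have "(X has_vector_derivative J4 ** ?B ** X t) (at t within {0..2 * pi})"
    using X t by (auto simp: EH_solution_def)
  from bb.has_vector_derivative[OF has_vector_derivative_transpose[OF this] has_vector_derivative_const[of J4]]
  have "((\<lambda>t. transpose (X t) ** J4) has_vector_derivative transpose (J4 ** ?B ** X t) ** J4)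
        (at t within {0..2*pi})"
    by (simp add: bb.zero_right)
  also have "transpose (J4 ** ?B ** X t) ** J4 = - (transpose (X t) ** ?B ** (J4 ** J4))"
    by (simp add: matrix_transpose_mul transpose_B_EH J4_simps(1) bb.minus_right bb.minus_left matrix_mul_assoc)
  also have "\<dots> = transpose (X t) ** ?B" by (simp add: J4_simps bb.minus_right)
  finally have "((\<lambda>t. transpose (X t) ** J4) has_vector_derivative transpose (X t) ** ?B) (at t within {0..2*pi})" .
  from cv.has_vector_derivative[OF this x]
  have "((\<lambda>t. cmat (transpose (X t) ** J4) *v x t) has_vector_derivative
     cmat (transpose (X t) ** J4) *v (cmat (J4 ** ?B) *v x t + f) + cmat (transpose (X t) ** ?B) *v x t) (at t within {0..2*pi})" .
  moreover have "cmat (transpose (X t) ** J4) *v (cmat (J4 ** ?B) *v x t) = - (cmat (transpose (X t) ** ?B) *v x t)"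
  proof -
    have "transpose (X t) ** J4 ** (J4 ** ?B) = transpose (X t) ** (J4 ** J4) ** ?B" by (simp add: matrix_mul_assoc)
    also have "\<dots> = - (transpose (X t) ** ?B)" by (simp add: J4_simps bb.minus_right bb.minus_left)
    finally show ?thesis by (simp add: matrix_vector_mul_assoc cmat_mult[symmetric] cv.minus_left)
  qed
  ultimately show ?thesis by (simp add: cv.add_right)
qed

text \<open>By symplecticity the inverse of X^T J is -X J, so both are continuous and hence bounded
  on the interval.\<close>

lemma symplectic_transform_bounds:
  assumes X: "EH_solution \<alpha> \<beta> e X"
  obtains C where "1 \<le> C"
    "\<And>t u. t \<in> {0..2 * pi} \<Longrightarrow> norm (cmat (transpose (X t) ** J4) *v u) \<le> C * norm u"
    "\<And>t u. t \<in> {0..2 * pi} \<Longrightarrow> norm u \<le> C * norm (cmat (transpose (X t) ** J4) *v u)"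
proof -
  interpret bb: bounded_bilinear "(**) :: real^4^4 \<Rightarrow> real^4^4 \<Rightarrow> real^4^4"
    by (rule bounded_bilinear_matrix_mult)
  interpret cv: bounded_bilinear "\<lambda>(M :: real^4^4) (v :: complex^4). cmat M *v v"
    by (rule bounded_bilinear_cmat_vec)
  obtain C0 where C0: "0 < C0" "\<And>(M :: real^4^4) (v :: complex^4). norm (cmat M *v v) \<le> norm M * norm v * C0"
    using cv.pos_bounded by blast
  have "continuous_on {0..2 * pi} (\<lambda>t. transpose (X t) ** J4)"
    by (rule bb.continuous_on[OF bounded_linear.continuous_on[OF bounded_linear_transpose EH_solution_continuous[OF X]] continuous_on_const])
  then have "bounded ((\<lambda>t. transpose (X t) ** J4) ` {0..2 * pi})"
    by (intro compact_imp_bounded compact_continuous_image) auto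
  then obtain C1 where "0 < C1 \<and> (\<forall>x\<in>(\<lambda>t. transpose (X t) ** J4) ` {0..2 * pi}. norm x \<le> C1)"
    unfolding bounded_pos by (rule exE)
  then have C1: "0 < C1" "\<And>t. t \<in> {0..2 * pi} \<Longrightarrow> norm (transpose (X t) ** J4) \<le> C1"
    by (simp_all del: norm_minus_cancel)
  have "continuous_on {0..2 * pi} (\<lambda>t. - (X t ** J4))"
    by (rule continuous_on_minus[OF bb.continuous_on[OF EH_solution_continuous[OF X] continuous_on_const]])
  then have "bounded ((\<lambda>t. - (X t ** J4)) ` {0..2 * pi})"
    by (intro compact_imp_bounded compact_continuous_image) auto
  then obtain C2 where "0 < C2 \<and> (\<forall>x\<in>(\<lambda>t. - (X t ** J4)) ` {0..2 * pi}. norm x \<le> C2)"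
    unfolding bounded_pos by (rule exE)
  then have C2: "0 < C2" "\<And>t. t \<in> {0..2 * pi} \<Longrightarrow> norm (- (X t ** J4)) \<le> C2"
    by (simp_all del: norm_minus_cancel)
  define C where "C = max 1 (max (C1 * C0) (C2 * C0))"
  have "norm (cmat (transpose (X t) ** J4) *v u) \<le> C * norm u" if "t \<in> {0..2 * pi}" for t u
  proof -
    have "norm (cmat (transpose (X t) ** J4) *v u) \<le> norm (transpose (X t) ** J4) * norm u * C0" by (rule C0)
    also have "\<dots> \<le> C1 * norm u * C0" using C0 C1(2)[OF that] by (intro mult_right_mono) auto
    also have "\<dots> = (C1 * C0) * norm u" by simp
    also have "\<dots> \<le> C * norm u" by (intro mult_right_mono) (auto simp: C_def)
    finally show ?thesis .
  qed
  moreover have "norm u \<le> C * norm (cmat (transpose (X t) ** J4) *v u)" if "t \<in> {0..2 * pi}" for t u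
  proof -
    have "(transpose (X t) ** J4) ** (- (X t ** J4)) = mat 1"
      using EH_solution_symplectic_product[OF X X that]
      by (simp add: bb.minus_right matrix_mul_assoc) (simp add: J4_simps)
    then have "- (X t ** J4) ** (transpose (X t) ** J4) = mat 1" using matrix_left_right_inverse by blast
    then have "u = cmat (- (X t ** J4)) *v (cmat (transpose (X t) ** J4) *v u)"
      by (simp add: matrix_vector_mul_assoc cmat_mult[symmetric] cmat_mat_1)
    then have "norm u = norm (cmat (- (X t ** J4)) *v (cmat (transpose (X t) ** J4) *v u))" by (rule arg_cong)
    also have "\<dots> \<le> norm (- (X t ** J4)) * norm (cmat (transpose (X t) ** J4) *v u) * C0" by (rule C0(2))
    also have "\<dots> \<le> C2 * norm (cmat (transpose (X t) ** J4) *v u) * C0"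
      using C0 C2(2)[OF that] by (intro mult_right_mono) auto
    also have "\<dots> = (C2 * C0) * norm (cmat (transpose (X t) ** J4) *v u)" by simp
    also have "\<dots> \<le> C * norm (cmat (transpose (X t) ** J4) *v u)" by (intro mult_right_mono) (auto simp: C_def)
    finally show ?thesis .
  qed
  moreover have "1 \<le> C" by (simp add: C_def)
  ultimately show thesis using that by blast
qed

text \<open>The truncations make the defect \<open>\<phi>\<close> of the equation M v = e^{2 pi k} v
  arbitrarily small. The same K serves every truncation order, so k stays in [0,K] and v on the unit
  sphere; by compactness \<open>\<phi>\<close> attains its infimum, which must be 0.\<close>

lemma positive_multiplier:
  assumes X: "EH_solution \<alpha> \<beta> e X" and e: "0 \<le> e" "e < 1"
    and l: "0 \<le> 1 + \<alpha> + 3 * \<beta>" "1 + \<alpha> - 3 * \<beta> \<le> 0"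
  obtains \<mu> v where "0 < \<mu>" "v \<noteq> 0" "cmat (X (2 * pi)) *v v = of_real \<mu> *s v"
proof -
  interpret cv: bounded_bilinear "\<lambda>(M :: real^4^4) (v :: complex^4). cmat M *v v"
    by (rule bounded_bilinear_cmat_vec)
  let ?l3 = "1 + \<alpha> + 3 * \<beta>" and ?l4 = "1 + \<alpha> - 3 * \<beta>"
  define L where "L = max ?l3 (- ?l4)"
  have L: "\<bar>?l3\<bar> \<le> L" "\<bar>?l4\<bar> \<le> L" "?l3 \<le> L" "- ?l4 \<le> L" "0 \<le> L" using l by (auto simp: L_def)
  \<comment> \<open>Since K >= 1, K^2 >= K, and (1 - e) K = (1 - e) + 2 L already exceeds 2
    L.\<close>
  define K where "K = 1 + 2 * L / (1 - e)"
  have K: "0 < K" "2 * L < (1 - e) * K\<^sup>2"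
  proof -
    have K1: "1 \<le> K" using e L by (simp add: K_def)
    then show "0 < K" by simp
    have "(1 - e) * K = (1 - e) + 2 * L" using e by (simp add: K_def distrib_left)
    then have "2 * L < (1 - e) * K" using e by simp
    also have "\<dots> \<le> (1 - e) * K\<^sup>2" using K1 e by (intro mult_left_mono) (auto simp: power2_eq_square)
    finally show "2 * L < (1 - e) * K\<^sup>2" .
  qed
  obtain \<delta> D where D: "0 < \<delta>" "0 \<le> D"
    "\<And>k N a b M. mode_solution 1 k e ?l3 ?l4 N a b \<Longrightarrow> (\<And>n. amp a b n \<le> M) \<Longrightarrow>
        acc 1 k a b N * (1 + \<delta> * real N) \<le> D * M"
    using mode_solution_decay[OF e L(1,2)] by blast
  obtain C where C: "1 \<le> C"
    "\<And>t u. t \<in> {0..2 * pi} \<Longrightarrow> norm (cmat (transpose (X t) ** J4) *v u) \<le> C * norm u"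
    "\<And>t u. t \<in> {0..2 * pi} \<Longrightarrow> norm u \<le> C * norm (cmat (transpose (X t) ** J4) *v u)"
    using symplectic_transform_bounds[OF X] by blast
  let ?G = "\<lambda>t u. cmat (transpose (X t) ** J4) *v u"
  have G0: "?G 0 u = cmat J4 *v u" for u using X by (simp add: EH_solution_def transpose_mat)
  \<comment> \<open>Because M^T J M = J for M = X(2 pi), the vector inside the norm is M^T J (e^{2
    pi k} v - M v).\<close>
  define \<phi> where "\<phi> = (\<lambda>(k, v). norm (?G (2 * pi) (exp (2 * pi * k) *\<^sub>R v) - cmat J4 *v v))"
  define E where "E = C * (exp (2 * pi * K) / (1 - e)) * D * (2 * pi)"
  have E: "0 \<le> E" using C(1) D(2) e by (simp add: E_def)
  have approx: "\<exists>k v. k \<in> {0..K} \<and> v \<in> sphere 0 1 \<and> \<phi> (k, v) < \<epsilon>" if \<epsilon>: "0 < \<epsilon>" for \<epsilon>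
  proof -
    \<comment> \<open>The first bound makes the drift small against the largest amplitude, so that
      the initial vector is not tiny; the second makes it smaller than \<epsilon> after
      normalisation.\<close>
    obtain N :: nat where N: "4 * C * E / \<delta> < real N" "4 * C\<^sup>2 * E / (\<epsilon> * \<delta>) < real N"
      using reals_Archimedean2[of "max (4 * C * E / \<delta>) (4 * C\<^sup>2 * E / (\<epsilon> * \<delta>))"] by auto
    have N1: "4 * C * E < 1 + \<delta> * real N" "4 * C\<^sup>2 * E < \<epsilon> * (1 + \<delta> * real N)" "0 < 1 + \<delta> * real N"
    proof -
      have "4 * C * E < \<delta> * real N" using N(1) D(1) by (simp add: field_simps)
      then show "4 * C * E < 1 + \<delta> * real N" by simp
      have "4 * C\<^sup>2 * E < \<epsilon> * \<delta> * real N" using N(2) D(1) \<epsilon> by (simp add: field_simps)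
      then show "4 * C\<^sup>2 * E < \<epsilon> * (1 + \<delta> * real N)" using \<epsilon> by (simp add: algebra_simps)
      show "0 < 1 + \<delta> * real N" using D(1) by (intro add_pos_nonneg) auto
    qed
    obtain k a b m where k: "0 \<le> k" "k \<le> K" and S: "mode_solution 1 k e ?l3 ?l4 N a b" and "amp a b m \<noteq> 0"
    proof -
      have "2 * ?l3 \<le> 2 * L" "- 2 * ?l4 \<le> 2 * L" using L(3,4) by auto
      then have "2 * ?l3 < (1 - e) * K\<^sup>2" "- 2 * ?l4 < (1 - e) * K\<^sup>2"
        by (auto intro: le_less_trans[OF _ K(2)])
      from mode_solution_exists[OF e l K(1) this, of N] show thesis using that by blast
    qed
    then obtain n where n: "n \<le> N" "0 < amp a b n" "\<And>i. amp a b i \<le> amp a b n"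
      using amp_attains_max by blast
    let ?A = "amp a b n"
    have im: "Im (a 0) = 0" "Im (b 0) = 0" using S by (auto simp: mode_solution_def)
    let ?x = "trial k N a b"
    \<comment> \<open>A bound for the speed at which \<open>?G t (?x t)\<close> drifts; for an exact
      solution that vector would be constant.\<close>
    define \<rho> where "\<rho> = C * (exp (2 * pi * K) / (1 - e)) * acc 1 k a b N"
    have \<rho>: "0 \<le> \<rho>" using C(1) e by (simp add: \<rho>_def)
    have "\<rho> * (2 * pi) * (1 + \<delta> * real N) = C * (exp (2 * pi * K) / (1 - e)) * (2 * pi) * (acc 1 k a b N * (1 + \<delta> * real N))"
      by (simp add: \<rho>_def)
    also have "\<dots> \<le> C * (exp (2 * pi * K) / (1 - e)) * (2 * pi) * (D * ?A)"
      using C(1) e by (intro mult_left_mono D(3)[OF S n(3)]) auto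
    also have "\<dots> = E * ?A" by (simp add: E_def)
    finally have small: "\<rho> * (2 * pi) * (1 + \<delta> * real N) \<le> E * ?A" .
    have deriv: "((\<lambda>t. ?G t (?x t)) has_vector_derivative ?G t (residual e k N a b t)) (at t within {0..2 * pi})"
      if "t \<in> {0..2 * pi}" for t
      by (rule symplectic_transform_derivative[OF X that trial_solves[OF S e]])
    have drift: "norm (?G t (?x t) - ?G 0 (?x 0)) \<le> \<rho> * (2 * pi)" if t: "t \<in> {0..2 * pi}" for t
    proof -
      have "norm (?G t (?x t) - ?G 0 (?x 0)) \<le> \<rho> * norm (t - 0)"
      proof (rule differentiable_bound[where S = "{0..2 * pi}" and f' = "\<lambda>s h. h *\<^sub>R ?G s (residual e k N a b s)"])
        fix s assume s: "s \<in> {0..2 * pi}"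
        show "((\<lambda>t. ?G t (?x t)) has_derivative (\<lambda>h. h *\<^sub>R ?G s (residual e k N a b s))) (at s within {0..2 * pi})"
          using deriv[OF s] by (simp add: has_vector_derivative_def)
        have "norm (?G s (residual e k N a b s)) \<le> C * norm (residual e k N a b s)" by (rule C(2)[OF s])
        also have "\<dots> \<le> C * (acc 1 k a b N * (exp (2 * pi * K) / (1 - e)))"
          using C(1) by (intro mult_left_mono residual_bound[where a = a and b = b, OF e k s im]) auto
        finally have "norm (?G s (residual e k N a b s)) \<le> \<rho>" by (simp add: \<rho>_def mult_ac)
        then show "onorm (\<lambda>h. h *\<^sub>R ?G s (residual e k N a b s)) \<le> \<rho>"
          by (intro onorm_bound \<rho>) (simp add: mult.commute[of \<rho>] mult_left_mono)
      qed (use t in auto)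
      also have "\<dots> \<le> \<rho> * (2 * pi)" using t \<rho> by (intro mult_left_mono) auto
      finally show ?thesis .
    qed
    have "norm (?x t) \<le> C * (C * norm (?x 0) + \<rho> * (2 * pi))" if t: "t \<in> {0..2 * pi}" for t
    proof -
      have "norm (?x t) \<le> C * norm (?G t (?x t))" by (rule C(3)[OF t])
      also have "norm (?G t (?x t)) \<le> norm (?G 0 (?x 0)) + norm (?G t (?x t) - ?G 0 (?x 0))"
        using norm_triangle_ineq[of "?G 0 (?x 0)" "?G t (?x t) - ?G 0 (?x 0)"] by simp
      also have "\<dots> \<le> C * norm (?x 0) + \<rho> * (2 * pi)" by (intro add_mono C(2) drift t) auto
      finally show ?thesis using C(1) by simp
    qed
    from amp_le_trial[OF this k(1) n(1)]
    have A: "?A \<le> 2 * (C * (C * norm (?x 0) + \<rho> * (2 * pi)))" .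
    have "2 * C * (\<rho> * (2 * pi)) * (1 + \<delta> * real N) \<le> 2 * C * (E * ?A)"
      using mult_left_mono[OF small, of "2 * C"] C(1) by (simp add: mult_ac)
    also have "\<dots> \<le> (?A / 2) * (1 + \<delta> * real N)"
    proof -
      have "4 * C * E * ?A \<le> (1 + \<delta> * real N) * ?A" using N1(1) n(2) by (intro mult_right_mono) auto
      moreover have "2 * C * (E * ?A) = 4 * C * E * ?A / 2" by simp
      moreover have "(?A / 2) * (1 + \<delta> * real N) = (1 + \<delta> * real N) * ?A / 2" by (simp only: mult.commute times_divide_eq_right)
      ultimately show ?thesis by linarith
    qed
    finally have "(2 * C * (\<rho> * (2 * pi))) * (1 + \<delta> * real N) \<le> (?A / 2) * (1 + \<delta> * real N)" .
    then have half: "2 * C * (\<rho> * (2 * pi)) \<le> ?A / 2"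
      using N1(3) by (rule mult_right_le_imp_le)
    \<comment> \<open>Half of the amplitude absorbs the drift. What remains is a lower bound for the
      initial vector, which makes division by its norm safe.\<close>
    have A2: "?A \<le> 4 * C\<^sup>2 * norm (?x 0)"
    proof -
      have "2 * (C * (C * norm (?x 0) + \<rho> * (2 * pi))) = 2 * C\<^sup>2 * norm (?x 0) + 2 * C * (\<rho> * (2 * pi))"
        by (simp add: distrib_left power2_eq_square)
      then show ?thesis using A half by linarith
    qed
    have x0: "0 < norm (?x 0)"
    proof (rule ccontr)
      assume "\<not> ?thesis"
      then have "4 * C\<^sup>2 * norm (?x 0) = 0" by simp
      then show False using A2 n(2) by linarith
    qed
    define v where "v = (1 / norm (?x 0)) *\<^sub>R ?x 0"
    have v: "v \<in> sphere 0 1" using x0 by (simp add: v_def)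
    have "?G (2 * pi) (exp (2 * pi * k) *\<^sub>R v) - cmat J4 *v v = (1 / norm (?x 0)) *\<^sub>R (?G (2 * pi) (?x (2 * pi)) - ?G 0 (?x 0))"
      unfolding trial_quasiperiodic G0 v_def scaleR_left_commute[of "exp (2 * pi * k)" "1 / norm (?x 0)"]
        scaleR_diff_right by (simp only: cv.scaleR_right)
    then have "\<phi> (k, v) = norm (?G (2 * pi) (?x (2 * pi)) - ?G 0 (?x 0)) / norm (?x 0)"
      by (simp add: \<phi>_def)
    also have "\<dots> \<le> \<rho> * (2 * pi) / norm (?x 0)" by (intro divide_right_mono drift) auto
    also have "\<dots> < \<epsilon>"
    proof -
      have "\<rho> * (2 * pi) * (1 + \<delta> * real N) \<le> E * (4 * C\<^sup>2 * norm (?x 0))"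
        by (rule order_trans[OF small mult_left_mono[OF A2 E]])
      also have "\<dots> < \<epsilon> * norm (?x 0) * (1 + \<delta> * real N)"
        using mult_strict_right_mono[OF N1(2) x0] by (simp add: mult_ac)
      finally have "\<rho> * (2 * pi) < \<epsilon> * norm (?x 0)" using N1(3) by (simp add: mult_less_cancel_right)
      then show ?thesis using x0 by (simp add: field_simps)
    qed
    finally show ?thesis using k v by auto
  qed
  have cont: "continuous_on ({0..K} \<times> sphere 0 1) \<phi>"
    unfolding \<phi>_def split_beta by (intro continuous_intros cv.continuous_on)
  have "\<exists>p\<in>{0..K} \<times> sphere 0 1. \<forall>q\<in>{0..K} \<times> sphere 0 1. \<phi> p \<le> \<phi> q"
  proof (rule continuous_attains_inf[OF _ _ cont])
    show "compact ({0..K} \<times> sphere (0 :: complex^4) 1)" by (intro compact_Times) auto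
    show "{0..K} \<times> sphere (0 :: complex^4) 1 \<noteq> {}" using approx[of 1] by auto
  qed
  then obtain p where p: "p \<in> {0..K} \<times> sphere 0 1" "\<And>q. q \<in> {0..K} \<times> sphere 0 1 \<Longrightarrow> \<phi> p \<le> \<phi> q"
    by blast
  obtain k v where kv: "p = (k, v)" by force
  have "\<phi> p = 0"
  proof (rule ccontr)
    assume "\<phi> p \<noteq> 0"
    moreover have "0 \<le> \<phi> p" by (simp add: kv \<phi>_def)
    ultimately have "0 < \<phi> p" by simp
    from approx[OF this] obtain k' v' where "k' \<in> {0..K}" "v' \<in> sphere 0 1" "\<phi> (k', v') < \<phi> p" by blast
    with p(2)[of "(k', v')"] show False by simp
  qed
  then have eq: "?G (2 * pi) (exp (2 * pi * k) *\<^sub>R v) = cmat J4 *v v" by (simp add: kv \<phi>_def)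
  let ?M = "X (2 * pi)"
  \<comment> \<open>Rewriting J v as M^T J (M v) allows the injective factor M^T J to be
    cancelled.\<close>
  have "?G (2 * pi) (cmat ?M *v v) = cmat J4 *v v"
    using EH_solution_symplectic_product[OF X X, of "2 * pi"]
    by (simp add: matrix_vector_mul_assoc flip: cmat_mult)
  then have "?G (2 * pi) (cmat ?M *v v - exp (2 * pi * k) *\<^sub>R v) = 0" using eq by (simp add: cv.diff_right)
  then have "norm (cmat ?M *v v - exp (2 * pi * k) *\<^sub>R v) \<le> 0"
    using C(3)[of "2 * pi" "cmat ?M *v v - exp (2 * pi * k) *\<^sub>R v"] by simp
  then have "cmat ?M *v v = exp (2 * pi * k) *\<^sub>R v" by simp
  then have "cmat ?M *v v = of_real (exp (2 * pi * k)) *s v"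
    by (simp add: vec_eq_iff scaleR_conv_of_real[where 'a = complex])
  moreover have "v \<noteq> 0" using p(1) kv by auto
  ultimately show thesis using that by (metis exp_gt_zero)
qed

subsection \<open>Diagonalisation of isometries\<close>

text \<open>A root z of p splits off: if W u - z u = 0 then u is an eigenvector, and otherwise W u -
  z u is a nonzero vector of U annihilated by the quotient of p by X - z. The induction runs over a
  bound for the degree.\<close>

lemma krylov_eigenvector:
  fixes W :: "complex^'n^'n"
  assumes inv: "\<And>v. v \<in> U \<Longrightarrow> W *v v \<in> U" and diff: "\<And>u v. u \<in> U \<Longrightarrow> v \<in> U \<Longrightarrow> u - v \<in> U"
    and smult: "\<And>c v. v \<in> U \<Longrightarrow> c *s v \<in> U"
  shows "degree p \<le> n \<Longrightarrow> p \<noteq> 0 \<Longrightarrow> u \<in> U \<Longrightarrow> u \<noteq> 0 \<Longrightarrow>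
    (\<Sum>i\<le>n. coeff p i *s (((*v) W) ^^ i) u) = 0 \<Longrightarrow> \<exists>v\<in>U. \<exists>c. v \<noteq> 0 \<and> W *v v = c *s v"
proof (induction n arbitrary: p u)
  case 0
  then have "coeff p 0 *s u = 0" by simp
  moreover have "coeff p 0 \<noteq> 0" using 0 by (metis degree_0_id le_0_eq leading_coeff_0_iff)
  ultimately show ?case using 0 by (simp add: vector_mul_eq_0)
next
  case (Suc n)
  show ?case
  proof (cases "degree p = 0")
    case True
    then have "coeff p i = 0" if "0 < i" for i using that by (simp add: coeff_eq_0)
    then have "(\<Sum>i\<le>Suc n. coeff p i *s (((*v) W) ^^ i) u) = coeff p 0 *s u"
      by (subst sum.atMost_Suc_shift) simp
    moreover have "coeff p 0 \<noteq> 0" using Suc.prems(2) True by (metis leading_coeff_0_iff)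
    ultimately show ?thesis using Suc.prems by (simp add: vector_mul_eq_0)
  next
    case False
    then obtain z where "poly p z = 0"
      using fundamental_theorem_of_algebra[of p] by (auto simp: Fundamental_Theorem_Algebra.constant_degree)
    then obtain q where p: "p = [:- z, 1:] * q" by (auto simp: poly_eq_0_iff_dvd elim: dvdE)
    have q: "q \<noteq> 0" using Suc.prems(2) p by auto
    have "degree p = Suc (degree q)" unfolding p using q by (subst degree_mult_eq) auto
    then have dq: "degree q \<le> n" using Suc.prems(1) by simp
    let ?L = "\<lambda>u. \<Sum>i\<le>n. coeff q i *s (((*v) W) ^^ i) u"
    have pw_diff: "(((*v) W) ^^ i) (a - b) = (((*v) W) ^^ i) a - (((*v) W) ^^ i) b" for i a b
      by (induction i) (simp_all add: matrix_vector_mult_diff_distrib)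
    have pw_smult: "(((*v) W) ^^ i) (c *s a) = c *s (((*v) W) ^^ i) a" for i c a
      by (induction i) (simp_all add: matrix_vector_mult_scaleR vector_scalar_commute)
    have "p = pCons 0 q - Polynomial.smult z q" unfolding p by simp
    then have "(\<Sum>i\<le>Suc n. coeff p i *s (((*v) W) ^^ i) u) =
      (\<Sum>i\<le>Suc n. coeff (pCons 0 q) i *s (((*v) W) ^^ i) u) - (\<Sum>i\<le>Suc n. (z * coeff q i) *s (((*v) W) ^^ i) u)"
      by (simp only: coeff_diff coeff_smult vector_ssub_ldistrib sum_subtractf vector_sub_rdistrib)
    also have "(\<Sum>i\<le>Suc n. coeff (pCons 0 q) i *s (((*v) W) ^^ i) u) = ?L (W *v u)"
      by (subst sum.atMost_Suc_shift) (simp add: funpow_swap1)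
    also have "(\<Sum>i\<le>Suc n. (z * coeff q i) *s (((*v) W) ^^ i) u) = ?L (z *s u)"
      using dq by (simp add: coeff_eq_0 pw_smult vector_smult_assoc mult.commute)
    also have "?L (W *v u) - ?L (z *s u) = ?L (W *v u - z *s u)"
      by (simp add: pw_diff vector_ssub_ldistrib sum_subtractf)
    finally have L: "?L (W *v u - z *s u) = 0" using Suc.prems(5) by simp
    show ?thesis
    proof (cases "W *v u - z *s u = 0")
      case True then show ?thesis using Suc.prems by auto
    next
      case False
      then show ?thesis using Suc.IH[OF dq q _ False L] inv diff smult Suc.prems(3) by blast
    qed
  qed
qed

text \<open>The vectors u, W u, ..., W^n u are too many to be independent in dimension n, so a
  nonzero polynomial in W annihilates u. If two iterates coincide, X^i - X^j is such a
  polynomial.\<close>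

lemma invariant_subspace_eigenvector:
  fixes W :: "complex^'n^'n"
  assumes inv: "\<And>v. v \<in> U \<Longrightarrow> W *v v \<in> U" and diff: "\<And>u v. u \<in> U \<Longrightarrow> v \<in> U \<Longrightarrow> u - v \<in> U"
    and smult: "\<And>c v. v \<in> U \<Longrightarrow> c *s v \<in> U" and u: "u \<in> U" "u \<noteq> 0"
  shows "\<exists>v\<in>U. \<exists>c. v \<noteq> 0 \<and> W *v v = c *s v"
proof -
  let ?n = "CARD('n)" and ?f = "\<lambda>i. (((*v) W) ^^ i) u"
  have "\<exists>p. degree p \<le> ?n \<and> p \<noteq> 0 \<and> (\<Sum>i\<le>?n. coeff p i *s ?f i) = 0"
  proof (cases "inj_on ?f {..?n}")
    case True
    then have card: "card (?f ` {..?n}) = Suc ?n" by (simp add: card_image)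
    have "vec.dependent (?f ` {..?n})"
    proof (rule ccontr)
      assume "vec.independent (?f ` {..?n})"
      then have "card (?f ` {..?n}) \<le> vec.dim (UNIV :: (complex^'n) set)"
        by (intro vec.independent_card_le_dim) auto
      then show False using card by (simp add: card_cart_basis)
    qed
    then obtain c w where c: "w \<in> ?f ` {..?n}" "c w \<noteq> 0" "(\<Sum>v\<in>?f ` {..?n}. c v *s v) = 0"
      by (auto simp: vec.dependent_finite)
    obtain j where j: "j \<le> ?n" "w = ?f j" using c(1) by auto
    let ?p = "\<Sum>i\<le>?n. monom (c (?f i)) i"
    have co: "coeff ?p i = (if i \<le> ?n then c (?f i) else 0)" for i
      by (simp add: coeff_sum)
    have "degree ?p \<le> ?n" by (intro degree_le) (simp add: co)
    moreover have "?p \<noteq> 0"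
    proof
      assume "?p = 0"
      then have "coeff ?p j = 0" by simp
      then show False using co[of j] c(2) j by simp
    qed
    moreover have "(\<Sum>i\<le>?n. coeff ?p i *s ?f i) = 0"
      using c(3) by (simp add: co sum.reindex[OF True])
    ultimately show ?thesis by blast
  next
    case False
    then obtain i j where ij: "i \<le> ?n" "j \<le> ?n" "i \<noteq> j" "?f i = ?f j" by (auto simp: inj_on_def)
    let ?p = "monom (1::complex) i - monom 1 j"
    have "degree ?p \<le> ?n" using ij by (intro degree_le) auto
    moreover have "?p \<noteq> 0"
    proof
      assume "?p = 0"
      then have "coeff ?p i = 0" by simp
      then show False using ij by simp
    qed
    moreover have "(\<Sum>l\<le>?n. coeff ?p l *s ?f l) = 0"
    proof -
      have "(\<Sum>l\<le>?n. coeff ?p l *s ?f l) = (\<Sum>l\<le>?n. if l = i then ?f i else 0) - (\<Sum>l\<le>?n. if l = j then ?f j else 0)"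
        unfolding sum_subtractf[symmetric] using ij(3) by (intro sum.cong) (auto simp: vec_eq_iff)
      then show ?thesis using ij by simp
    qed
    ultimately show ?thesis by blast
  qed
  then show ?thesis using krylov_eigenvector[of U W] inv diff smult u by blast
qed

lemma matrix_vector_mult_sum:
  fixes A :: "complex^'n^'m"
  shows "A *v (\<Sum>j\<in>S. f j) = (\<Sum>j\<in>S. A *v f j)"
  by (induction S rule: infinite_finite_induct) (simp_all add: matrix_vector_right_distrib)

lemma det_eigenbasis:
  fixes A :: "complex^'n^'n" and y :: "'n \<Rightarrow> complex^'n"
  assumes eig: "\<And>j. A *v y j = l j *s y j"
    and indep: "\<And>c i. (\<Sum>j\<in>UNIV. c j *s y j) = 0 \<Longrightarrow> c i = 0"
  shows "det A = (\<Prod>j\<in>UNIV. l j)"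
proof -
  let ?Y = "\<chi> i j. y j $ i" and ?Z = "(\<chi> i j. if i = j then l j else 0) :: complex^'n^'n"
  have "A ** ?Y = ?Y ** ?Z"
  proof -
    have "(A ** ?Y) $ i $ j = (A *v y j) $ i" for i j by (simp add: matrix_matrix_mult_def matrix_vector_mult_def)
    moreover have "(?Y ** ?Z) $ i $ j = l j * y j $ i" for i j
      by (simp add: matrix_matrix_mult_def if_distrib[where f = "\<lambda>x. _ * x"] mult.commute cong: if_cong)
    ultimately show ?thesis by (simp add: vec_eq_iff eig)
  qed
  then have "det A * det ?Y = det ?Y * det ?Z" by (simp only: det_mul[symmetric])
  moreover have "det ?Y \<noteq> 0"
  proof -
    have "x = 0" if "?Y *v x = 0" for x
    proof -
      have "(\<Sum>j\<in>UNIV. x $ j *s y j) = 0" using that by (simp add: vec_eq_iff matrix_vector_mult_def mult.commute)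
      from indep[OF this] show ?thesis by (simp add: vec_eq_iff)
    qed
    then have "invertible ?Y" by (simp add: invertible_left_inverse matrix_left_invertible_ker)
    then show ?thesis by (simp add: invertible_det_nz)
  qed
  moreover have "det ?Z = (\<Prod>j\<in>UNIV. l j)" by (subst det_diagonal) auto
  ultimately show ?thesis by simp
qed

text \<open>Definiteness is asked in the form H u u = 0 ==> u = 0, in place of positivity. The
  instance will be the standard form pulled back by \<open>Qmat M\<close>.\<close>

locale hermitian_form =
  fixes H :: "complex^'n \<Rightarrow> complex^'n \<Rightarrow> complex"
  assumes add: "H (u + v) w = H u w + H v w" and smult: "H (c *s u) w = c * H u w"
    and sym: "H u v = cnj (H v u)" and definite: "H u u = 0 \<Longrightarrow> u = 0"
begin

lemma zero: "H 0 w = 0" using smult[of 0 0 w] by simp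
lemma diff: "H (u - v) w = H u w - H v w"
  using add[of u "(-1) *s v" w] smult[of "-1" v w] by (simp add: vec_eq_iff)
lemma sum: "H (\<Sum>i\<in>A. f i) w = (\<Sum>i\<in>A. H (f i) w)"
  by (induction A rule: infinite_finite_induct) (simp_all add: zero add)
lemma zero_sym: "H u v = 0 \<Longrightarrow> H v u = 0" using sym[of v u] by simp
lemma smult_right: "H u (c *s v) = cnj c * H u v" using sym[of u "c *s v"] smult[of c v u] sym[of u v] by simp

lemma orthogonal_expansion:
  assumes "finite S" "\<And>i j. i \<in> S \<Longrightarrow> j \<in> S \<Longrightarrow> i \<noteq> j \<Longrightarrow> H (y i) (y j) = 0" "j \<in> S"
  shows "H (\<Sum>i\<in>S. c i *s y i) (y j) = c j * H (y j) (y j)"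
proof -
  have "H (\<Sum>i\<in>S. c i *s y i) (y j) = (\<Sum>i\<in>S. if i = j then c j * H (y j) (y j) else 0)"
    unfolding sum by (intro sum.cong) (auto simp: smult assms)
  then show ?thesis using assms by simp
qed

text \<open>Eigenvectors are collected one index at a time. The orthogonal complement of those
  already found is nonzero by dimension, and W leaves it invariant because W is an isometry and the
  eigenvalues found are nonzero.\<close>

lemma isometry_eigenbasis:
  assumes iso: "\<And>u v. H (W *v u) (W *v v) = H u v"
  obtains y :: "'n \<Rightarrow> complex^'n" and z where "\<And>j. y j \<noteq> 0" "\<And>j. W *v y j = z j *s y j" "\<And>j. cmod (z j) = 1"
    "\<And>i j. i \<noteq> j \<Longrightarrow> H (y i) (y j) = 0"
proof -
  have unit: "cmod c = 1" if "v \<noteq> 0" "W *v v = c *s v" for v c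
  proof -
    have "H (W *v v) (W *v v) = c * (cnj c * H v v)" unfolding that(2) by (simp only: smult smult_right mult.left_commute)
    then have "c * cnj c * H v v = H v v" using iso[of v v] by (simp only: mult.assoc)
    moreover have "H v v \<noteq> 0" using definite that(1) by blast
    ultimately have "c * cnj c = 1" using mult_right_cancel[of "H v v" "c * cnj c" 1] by simp
    then have "(cmod c)\<^sup>2 = 1" by (metis complex_norm_square of_real_eq_1_iff)
    then show ?thesis using norm_ge_zero[of c] unfolding power2_eq_1_iff by linarith
  qed
  have "\<exists>y z. (\<forall>i\<in>S. y i \<noteq> 0 \<and> W *v y i = z i *s y i) \<and> (\<forall>i\<in>S. \<forall>j\<in>S. i \<noteq> j \<longrightarrow> H (y i) (y j) = 0)"
    if "finite S" for S :: "'n set" using that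
  proof (induction S rule: finite_induct)
    case (insert s S)
    from insert.IH obtain y z
      where yz: "(\<forall>i\<in>S. y i \<noteq> 0 \<and> W *v y i = z i *s y i) \<and> (\<forall>i\<in>S. \<forall>j\<in>S. i \<noteq> j \<longrightarrow> H (y i) (y j) = 0)"
      by (elim exE)
    then have y: "\<And>i. i \<in> S \<Longrightarrow> y i \<noteq> 0 \<and> W *v y i = z i *s y i"
      and orth: "\<And>i j. i \<in> S \<Longrightarrow> j \<in> S \<Longrightarrow> i \<noteq> j \<Longrightarrow> H (y i) (y j) = 0" by blast+
    define U where "U = {v. \<forall>i\<in>S. H v (y i) = 0}"
    have "card S < CARD('n)"
      using insert.hyps by (intro psubset_card_mono) auto
    moreover have "vec.dim (y ` S) \<le> card (y ` S)" using insert.hyps by (intro vec.dim_le_card') simp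
    moreover have "card (y ` S) \<le> card S" using insert.hyps by (intro card_image_le)
    ultimately have dim: "vec.dim (y ` S) < CARD('n)" by linarith
    have "vec.span (y ` S) \<noteq> UNIV"
    proof
      assume "vec.span (y ` S) = UNIV"
      then have "vec.dim (y ` S) = vec.dim (UNIV :: (complex^'n) set)" using vec.dim_span[of "y ` S"] by simp
      then show False using dim by (simp add: card_cart_basis)
    qed
    then obtain x where x: "x \<notin> vec.span (y ` S)" by blast
    let ?u = "x - (\<Sum>i\<in>S. (H x (y i) / H (y i) (y i)) *s y i)"
    have "(\<Sum>i\<in>S. (H x (y i) / H (y i) (y i)) *s y i) \<in> vec.span (y ` S)"
      by (intro vec.span_sum vec.span_scale vec.span_base) auto
    then have u0: "?u \<noteq> 0" using x by auto
    have uU: "?u \<in> U" unfolding U_def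
    proof (clarify)
      fix i assume i: "i \<in> S"
      have "H (y i) (y i) \<noteq> 0" using definite y[OF i] by blast
      moreover have "H (\<Sum>i\<in>S. (H x (y i) / H (y i) (y i)) *s y i) (y i) = H x (y i) / H (y i) (y i) * H (y i) (y i)"
        by (rule orthogonal_expansion[OF insert.hyps(1) _ i]) (rule orth)
      ultimately show "H ?u (y i) = 0" by (simp add: diff)
    qed
    have "\<exists>v\<in>U. \<exists>c. v \<noteq> 0 \<and> W *v v = c *s v"
    proof (rule invariant_subspace_eigenvector[OF _ _ _ uU u0])
      fix v assume v: "v \<in> U"
      show "W *v v \<in> U" unfolding U_def
      proof clarify
        fix i assume i: "i \<in> S"
        then have "cnj (z i) * H (W *v v) (y i) = H (W *v v) (W *v y i)" using y by (simp add: smult_right)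
        also have "\<dots> = 0" using iso v i by (simp add: U_def)
        finally show "H (W *v v) (y i) = 0" using unit[of "y i" "z i"] y[OF i] by auto
      qed
    qed (auto simp: U_def diff smult)
    then obtain v c where v: "v \<in> U" "v \<noteq> 0" "W *v v = c *s v" by blast
    have vS: "H v (y i) = 0 \<and> H (y i) v = 0" if "i \<in> S" for i
      using v(1) that zero_sym by (auto simp: U_def)
    show ?case
      by (rule exI[of _ "y(s := v)"], rule exI[of _ "z(s := c)"])
         (simp add: insert.hyps, intro conjI ballI impI; use insert.hyps y orth v vS in force)
  qed simp
  from this[of UNIV] obtain y :: "'n \<Rightarrow> complex^'n" and z where yz: "\<And>i. y i \<noteq> 0 \<and> W *v y i = z i *s y i" "\<And>i j. i \<noteq> j \<Longrightarrow> H (y i) (y j) = 0"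
    by auto
  show thesis
  proof (rule that[of y z])
    show "cmod (z j) = 1" for j using unit[of "y j" "z j"] yz(1)[of j] by simp
  qed (simp_all add: yz)
qed

end

context hermitian_form
begin

text \<open>Ties the kernel dimensions counted by \<open>eig_lift\<close> to the roots of a
  characteristic polynomial, the side on which continuity in M is visible.\<close>

lemma eigenbasis_multiplicities:
  fixes y :: "'n \<Rightarrow> complex^'n"
  assumes y: "\<And>j. y j \<noteq> 0" "\<And>j. W *v y j = z j *s y j" and orth: "\<And>i j. i \<noteq> j \<Longrightarrow> H (y i) (y j) = 0"
  shows eigenspace_dim: "vec.dim {v. W *v v = w *s v} = card {j. z j = w}"
    and det_eigenvalues: "det (\<chi> i j. (if i = j then w else 0) - W $ i $ j) = (\<Prod>j\<in>UNIV. w - z j)"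
proof -
  have Hy: "H (y j) (y j) \<noteq> 0" for j using definite y(1) by blast
  have coeff: "c j = 0" if "finite S" "(\<Sum>i\<in>S. c i *s y i) = 0" "j \<in> S" for S c j
  proof -
    have "H (\<Sum>i\<in>S. c i *s y i) (y j) = c j * H (y j) (y j)"
      by (rule orthogonal_expansion[OF that(1) _ that(3)]) (rule orth)
    then show ?thesis using that(2) Hy[of j] by (simp add: zero)
  qed
  have inj: "inj y"
  proof
    fix i j assume "y i = y j"
    then show "i = j" using orth[of i j] Hy[of j] by (cases "i = j") auto
  qed
  have indep: "vec.independent (y ` S)" for S
  proof (rule vec.independent_if_scalars_zero)
    fix f x assume s: "(\<Sum>x\<in>y ` S. f x *s x) = 0" and x: "x \<in> y ` S"
    obtain j where j: "j \<in> S" "x = y j" using x by blast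
    have "(\<Sum>i\<in>S. f (y i) *s y i) = 0"
      using s sum.reindex[OF inj_on_subset[OF inj], of S "\<lambda>x. f x *s x"] by simp
    from coeff[OF _ this j(1)] show "f x = 0" using j(2) by simp
  qed simp
  have spans: "\<exists>c. v = (\<Sum>j\<in>UNIV. c j *s y j)" for v
  proof -
    have "card (range y) = CARD('n)" using inj by (simp add: card_image)
    then have "UNIV \<subseteq> vec.span (range y)"
      by (intro vec.card_ge_dim_independent indep) (auto simp: card_cart_basis)
    then have "v \<in> vec.span (range y)" by blast
    then have "v \<in> range (\<lambda>u. \<Sum>x\<in>range y. u x *s x)" by (simp only: vec.span_finite[OF finite_imageI[OF finite]])
    then obtain u where "v = (\<Sum>x\<in>range y. u x *s x)" by (rule rangeE)
    then have "v = (\<Sum>j\<in>UNIV. u (y j) *s y j)" using sum.reindex[OF inj, of "\<lambda>x. u x *s x"] by simp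
    then show ?thesis by (rule exI[where x = "\<lambda>j. u (y j)"])
  qed
  let ?J = "{j. z j = w}" and ?E = "{v. W *v v = w *s v}"
  have sub: "y ` ?J \<subseteq> ?E" using y(2) by auto
  have sup: "?E \<subseteq> vec.span (y ` ?J)"
  proof
    fix v assume v: "v \<in> ?E"
    obtain c where c: "v = (\<Sum>j\<in>UNIV. c j *s y j)" using spans[of v] by (rule exE)
    have "W *v v = (\<Sum>j\<in>UNIV. c j *s (z j *s y j))"
      unfolding c by (simp add: matrix_vector_mult_sum vector_scalar_commute y(2) del: vector_smult_assoc)
    moreover have "w *s v = (\<Sum>j\<in>UNIV. c j *s (w *s y j))"
      unfolding c by (simp add: vec.scale_sum_right mult.commute)
    ultimately have "(\<Sum>j\<in>UNIV. (c j * (z j - w)) *s y j) = W *v v - w *s v"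
      by (simp add: sum_subtractf[symmetric] vector_sub_rdistrib right_diff_distrib)
    also have "\<dots> = 0" using v by simp
    finally have "c j * (z j - w) = 0" for j using coeff[of UNIV "\<lambda>j. c j * (z j - w)" j] by simp
    then have "c j = 0" if "j \<notin> ?J" for j using that by auto
    then have "v = (\<Sum>j\<in>?J. c j *s y j)" unfolding c by (intro sum.mono_neutral_right) auto
    moreover have "(\<Sum>j\<in>?J. c j *s y j) \<in> vec.span (y ` ?J)"
      by (intro vec.span_sum vec.span_scale vec.span_base) auto
    ultimately show "v \<in> vec.span (y ` ?J)" by simp
  qed
  have "vec.dim ?E = card (y ` ?J)"
    by (rule vec.dim_unique[OF sub sup indep refl])
  then show "vec.dim ?E = card ?J" using inj by (simp add: card_image inj_on_subset)
  let ?A = "\<chi> i j. (if i = j then w else 0) - W $ i $ j"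
  have Av: "?A *v v = w *s v - W *v v" for v
    by (simp add: vec_eq_iff matrix_vector_mult_def left_diff_distrib sum_subtractf if_distrib[where f = "\<lambda>x. x * _"] cong: if_cong)
  show "det ?A = (\<Prod>j\<in>UNIV. w - z j)"
  proof (rule det_eigenbasis)
    show "?A *v y j = (w - z j) *s y j" for j by (simp add: Av y(2) vector_sub_rdistrib)
    show "c i = 0" if "(\<Sum>j\<in>UNIV. c j *s y j) = 0" for c i by (rule coeff[OF _ that]) simp_all
  qed
qed

end

subsection \<open>The pencil of a symplectic matrix\<close>

text \<open>For a symplectic matrix the map sending $Q v$ to $R v$ is unitary, and the pencil at $z$ has the kernel
  of $z Q - R$.\<close>

definition Qmat :: "real^4^4 \<Rightarrow> complex^4^4" where
  "Qmat M = Pplus ** cmat M + Pminus"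
definition Rmat :: "complex \<Rightarrow> real^4^4 \<Rightarrow> complex^4^4" where
  "Rmat \<omega> M = (\<chi> i j. \<omega> * Pplus $ i $ j + inverse \<omega> * (Pminus ** cmat M) $ i $ j)"

definition herm :: "complex^4 \<Rightarrow> complex^4 \<Rightarrow> complex" where
  "herm u v = (\<Sum>i\<in>UNIV. u $ i * cnj (v $ i))"

definition proj_plus :: "complex^4 \<Rightarrow> complex^4" where
  "proj_plus v = vector [(v$1 - \<i> * v$3) / 2, (v$2 - \<i> * v$4) / 2, (v$3 + \<i> * v$1) / 2, (v$4 + \<i> * v$2) / 2]"
definition proj_minus :: "complex^4 \<Rightarrow> complex^4" where
  "proj_minus v = vector [(v$1 + \<i> * v$3) / 2, (v$2 + \<i> * v$4) / 2, (v$3 - \<i> * v$1) / 2, (v$4 - \<i> * v$2) / 2]"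

lemma Pplus_vec: "Pplus *v v = proj_plus v" and Pminus_vec: "Pminus *v v = proj_minus v"
  by (simp_all add: vec_eq_iff forall_4 Pplus_def Pminus_def proj_plus_def proj_minus_def
      matrix_vector_mult_def sum_4 J4_def field_simps)

lemma proj_simps:
  "proj_plus (proj_plus v) = proj_plus v" "proj_minus (proj_minus v) = proj_minus v"
  "proj_plus (proj_minus v) = 0" "proj_minus (proj_plus v) = 0"
  "proj_plus (u + v) = proj_plus u + proj_plus v" "proj_minus (u + v) = proj_minus u + proj_minus v"
  "proj_plus (u - v) = proj_plus u - proj_plus v" "proj_minus (u - v) = proj_minus u - proj_minus v"
  "proj_plus (c *s v) = c *s proj_plus v" "proj_minus (c *s v) = c *s proj_minus v"
  "proj_plus v + proj_minus v = v"
  by (simp_all add: vec_eq_iff forall_4 proj_plus_def proj_minus_def field_simps)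

lemma herm_proj:
  "herm (a *s proj_plus u + b *s proj_minus x) (a' *s proj_plus v + b' *s proj_minus y)
    = a * cnj a' * herm (proj_plus u) (proj_plus v) + b * cnj b' * herm (proj_minus x) (proj_minus y)"
proof -
  have lin: "herm (x + y) z = herm x z + herm y z" "herm z (x + y) = herm z x + herm z y"
     "herm (c *s x) z = c * herm x z" "herm z (c *s x) = cnj c * herm z x" for x y z c
    by (simp_all add: herm_def algebra_simps sum.distrib sum_distrib_left)
  have "herm (proj_plus p) (proj_minus q) = 0" "herm (proj_minus q) (proj_plus p) = 0" for p q
    by (simp_all add: herm_def sum_4 proj_plus_def proj_minus_def) (simp_all add: field_simps)
  then show ?thesis by (simp add: lin)
qed

text \<open>The matrix iJ is 1 and -1 on the ranges of the two projections, so its Hermitian form is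
  the difference of their inner products.\<close>

lemma herm_signature:
  "herm (proj_plus u) (proj_plus v) - herm (proj_minus u) (proj_minus v) = \<i> * herm (cmat J4 *v u) v"
  by (simp add: herm_def sum_4 proj_plus_def proj_minus_def J4_def cmat_def matrix_vector_mult_def field_simps)

lemma herm_transpose: "herm (cmat A *v u) (cmat M *v v) = herm (cmat (transpose M ** A) *v u) v"
proof -
  have "herm a (cmat M *v v) = herm (cmat (transpose M) *v a) v" for a
  proof -
    have "herm a (cmat M *v v) = (\<Sum>i\<in>UNIV. \<Sum>k\<in>UNIV. a $ i * (M $ i $ k * cnj (v $ k)))"
      by (simp add: herm_def cmat_def matrix_vector_mult_def sum_distrib_left)
    also have "\<dots> = (\<Sum>k\<in>UNIV. \<Sum>i\<in>UNIV. a $ i * (M $ i $ k * cnj (v $ k)))"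
      by (rule sum.swap)
    also have "\<dots> = herm (cmat (transpose M) *v a) v"
      by (simp add: herm_def cmat_def matrix_vector_mult_def transpose_def sum_distrib_left sum_distrib_right mult_ac)
    finally show ?thesis .
  qed
  then show ?thesis by (simp add: matrix_vector_mul_assoc cmat_mult)
qed

text \<open>Moving the two negative terms to the opposite sides turns this into the equality of the
  forms of Q v and R v, which is the unitarity used below.\<close>

lemma herm_symplectic:
  assumes "transpose M ** J4 ** M = J4"
  shows "herm (proj_plus (cmat M *v u)) (proj_plus (cmat M *v v)) - herm (proj_minus (cmat M *v u)) (proj_minus (cmat M *v v))
    = herm (proj_plus u) (proj_plus v) - herm (proj_minus u) (proj_minus v)"
proof -
  have "herm (cmat J4 *v (cmat M *v u)) (cmat M *v v) = herm (cmat J4 *v u) v"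
    using herm_transpose[of "J4 ** M" u M v] assms by (simp add: matrix_vector_mul_assoc cmat_mult[symmetric] matrix_mul_assoc)
  then show ?thesis unfolding herm_signature by simp
qed

lemma Qmat_vec: "Qmat M *v v = proj_plus (cmat M *v v) + proj_minus v"
  by (simp add: Qmat_def matrix_vector_mult_add_rdistrib matrix_vector_mul_assoc[symmetric] Pplus_vec Pminus_vec)

lemma Rmat_vec: "Rmat \<omega> M *v v = \<omega> *s proj_plus v + inverse \<omega> *s proj_minus (cmat M *v v)"
proof -
  have "Rmat \<omega> M *v v = \<omega> *s (Pplus *v v) + inverse \<omega> *s ((Pminus ** cmat M) *v v)"
    by (simp add: vec_eq_iff Rmat_def matrix_vector_mult_def algebra_simps sum.distrib sum_distrib_left)
  then show ?thesis by (simp add: matrix_vector_mul_assoc[symmetric] Pplus_vec Pminus_vec)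
qed

lemma pencil_vec: "pencil \<omega> M z *v v = cmat M *v v - \<omega> *s (inverse z *s proj_plus v + z *s proj_minus v)"
proof -
  have "pencil \<omega> M z *v v = cmat M *v v - \<omega> *s (inverse z *s (Pplus *v v) + z *s (Pminus *v v))"
    by (simp add: vec_eq_iff pencil_def matrix_vector_mult_def algebra_simps sum.distrib sum_distrib_left sum_subtractf)
  then show ?thesis by (simp add: Pplus_vec Pminus_vec)
qed

text \<open>The pencil contains both z and its inverse. Its two projections can be rescaled
  separately, by -z and by the inverse of \<omega>, and this makes the equation linear in z.\<close>

lemma pencil_kernel:
  assumes "\<omega> \<noteq> 0" "z \<noteq> 0"
  shows "pencil \<omega> M z *v v = 0 \<longleftrightarrow> Rmat \<omega> M *v v = z *s (Qmat M *v v)"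
proof -
  let ?p = "proj_plus (cmat M *v v)" and ?m = "proj_minus (cmat M *v v)"
  have zero: "proj_plus 0 = 0" "proj_minus 0 = 0"
    by (simp_all add: proj_plus_def proj_minus_def vec_eq_iff forall_4)
  have split: "u = 0 \<longleftrightarrow> proj_plus u = 0 \<and> proj_minus u = 0" for u
  proof
    assume "proj_plus u = 0 \<and> proj_minus u = 0"
    then show "u = 0" using proj_simps(11)[of u] by simp
  qed (simp add: zero)
  have "proj_plus (pencil \<omega> M z *v v) = ?p - (\<omega> * inverse z) *s proj_plus v"
       "proj_minus (pencil \<omega> M z *v v) = ?m - (\<omega> * z) *s proj_minus v"
    by (simp_all add: pencil_vec proj_simps zero)
  then have "pencil \<omega> M z *v v = 0 \<longleftrightarrow> ?p - (\<omega> * inverse z) *s proj_plus v = 0 \<and> ?m - (\<omega> * z) *s proj_minus v = 0"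
    using split[of "pencil \<omega> M z *v v"] by (simp only:)
  also have "\<dots> \<longleftrightarrow> \<omega> *s proj_plus v - z *s ?p = 0 \<and> inverse \<omega> *s ?m - z *s proj_minus v = 0"
  proof -
    have "\<omega> *s a - z *s p = (- z) *s (p - (\<omega> * inverse z) *s a)" for a p :: "complex^4"
      using assms by (simp add: vec_eq_iff right_diff_distrib)
    moreover have "inverse \<omega> *s m - z *s b = inverse \<omega> *s (m - (\<omega> * z) *s b)" for m b :: "complex^4"
      using assms by (simp add: vec_eq_iff right_diff_distrib)
    ultimately show ?thesis using assms by (simp only: vector_mul_eq_0) simp
  qed
  also have "\<dots> \<longleftrightarrow> Rmat \<omega> M *v v - z *s (Qmat M *v v) = 0"
  proof -
    have "proj_plus (Rmat \<omega> M *v v - z *s (Qmat M *v v)) = \<omega> *s proj_plus v - z *s ?p"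
      "proj_minus (Rmat \<omega> M *v v - z *s (Qmat M *v v)) = inverse \<omega> *s ?m - z *s proj_minus v"
      by (simp_all add: Rmat_vec Qmat_vec proj_simps zero)
    then show ?thesis using split[of "Rmat \<omega> M *v v - z *s (Qmat M *v v)"] by (simp only:)
  qed
  finally show ?thesis by simp
qed

text \<open>W = Q^-1 R is an isometry of the form pulled back by Q, so it is diagonalisable with
  eigenvalues on the circle. The last conclusion presents them as roots of a polynomial whose
  coefficients are polynomial in the entries of M.\<close>

lemma pencil_spectrum:
  assumes M: "transpose M ** J4 ** M = J4" and \<omega>: "cmod \<omega> = 1"
  obtains z :: "4 \<Rightarrow> complex" where "\<And>j. cmod (z j) = 1" "det (Qmat M) \<noteq> 0"
    "\<And>w. cmod w = 1 \<Longrightarrow> card {j. z j = w} = cnullity (pencil \<omega> M w)"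
    "\<And>w. det (\<chi> i j. w * Qmat M $ i $ j - Rmat \<omega> M $ i $ j) = det (Qmat M) * (\<Prod>j\<in>UNIV. w - z j)"
proof -
  let ?Q = "Qmat M" and ?R = "Rmat \<omega> M"
  have \<omega>0: "\<omega> \<noteq> 0" "\<omega> * cnj \<omega> = 1" using \<omega> by (auto simp: complex_norm_square[symmetric])
  have self: "herm u u = of_real (\<Sum>i\<in>UNIV. (cmod (u $ i))\<^sup>2)" for u
    by (simp only: herm_def of_real_sum complex_norm_square)
  have def0: "u = 0" if "herm u u = 0" for u
  proof -
    have "(\<Sum>i\<in>UNIV. (cmod (u $ i))\<^sup>2) = 0" using that self[of u] by (metis of_real_eq_0_iff)
    then show ?thesis by (simp add: sum_nonneg_eq_0_iff vec_eq_iff)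
  qed
  have hp: "herm (proj_plus a + proj_minus b) (proj_plus c + proj_minus d) = herm (proj_plus a) (proj_plus c) + herm (proj_minus b) (proj_minus d)"
    for a b c d using herm_proj[of 1 a 1 b 1 c 1 d] by simp
  have RQ: "herm (?R *v u) (?R *v v) = herm (?Q *v u) (?Q *v v)" for u v
  proof -
    have "inverse \<omega> * cnj (inverse \<omega>) = inverse (\<omega> * cnj \<omega>)" by simp
    also have "\<dots> = 1" using \<omega>0(2) by simp
    finally have "herm (?R *v u) (?R *v v) = herm (proj_plus u) (proj_plus v) + herm (proj_minus (cmat M *v u)) (proj_minus (cmat M *v v))"
      unfolding Rmat_vec herm_proj using \<omega>0(2) by simp
    also have "\<dots> = herm (proj_plus (cmat M *v u)) (proj_plus (cmat M *v v)) + herm (proj_minus u) (proj_minus v)"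
      using herm_symplectic[OF M, of u v] by (simp add: algebra_simps)
    also have "\<dots> = herm (?Q *v u) (?Q *v v)" unfolding Qmat_vec hp ..
    finally show ?thesis .
  qed
  have herm0: "herm 0 0 = 0" by (simp add: herm_def)
  \<comment> \<open>If Q u = 0 then also R u = 0 by equality of the forms, and the two equations
    make \<open>proj_minus u\<close> and \<open>proj_plus u\<close> vanish.\<close>
  have Qker: "u = 0" if "?Q *v u = 0" for u
  proof -
    have "proj_plus (?R *v u) = \<omega> *s proj_plus u" "proj_minus (?Q *v u) = proj_minus u"
      by (simp_all add: Qmat_vec Rmat_vec proj_simps)
    moreover have "?R *v u = 0" using RQ[of u u] that herm0 def0 by simp
    moreover have "proj_plus 0 = 0" "proj_minus 0 = 0"
      by (simp_all add: proj_plus_def proj_minus_def vec_eq_iff forall_4)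
    ultimately have "proj_plus u = 0" "proj_minus u = 0" using \<omega>0 that by simp_all
    then show "u = 0" using proj_simps(11)[of u] by simp
  qed
  then have "invertible ?Q" by (simp add: invertible_left_inverse matrix_left_invertible_ker)
  then have detQ: "det ?Q \<noteq> 0" by (simp add: invertible_det_nz)
  obtain Qi where Qi: "Qi ** ?Q = mat 1" "?Q ** Qi = mat 1" using \<open>invertible ?Q\<close> by (auto simp: invertible_def)
  define W where "W = Qi ** ?R"
  have QW: "?Q ** W = ?R" by (simp add: W_def matrix_mul_assoc Qi)
  have QWv: "?Q *v (W *v v) = ?R *v v" for v by (simp add: matrix_vector_mul_assoc QW)
  interpret hf: hermitian_form "\<lambda>u v. herm (?Q *v u) (?Q *v v)"
  proof
    fix u v w :: "complex^4" and c
    show "herm (?Q *v (u + v)) (?Q *v w) = herm (?Q *v u) (?Q *v w) + herm (?Q *v v) (?Q *v w)"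
      by (simp add: matrix_vector_right_distrib herm_def distrib_right sum.distrib)
    show "herm (?Q *v (c *s u)) (?Q *v w) = c * herm (?Q *v u) (?Q *v w)"
      by (simp add: vector_scalar_commute herm_def sum_distrib_left mult.assoc)
    show "herm (?Q *v u) (?Q *v v) = cnj (herm (?Q *v v) (?Q *v u))" by (simp add: herm_def mult.commute)
    show "herm (?Q *v u) (?Q *v u) = 0 \<Longrightarrow> u = 0" using def0 Qker by blast
  qed
  have iso: "herm (?Q *v (W *v u)) (?Q *v (W *v v)) = herm (?Q *v u) (?Q *v v)" for u v
    unfolding QWv by (rule RQ)
  obtain y :: "4 \<Rightarrow> complex^4" and z where y: "\<And>j. y j \<noteq> 0" "\<And>j. W *v y j = z j *s y j" "\<And>j. cmod (z j) = 1"
    "\<And>i j. i \<noteq> j \<Longrightarrow> herm (?Q *v y i) (?Q *v y j) = 0"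
    using hf.isometry_eigenbasis[OF iso] by blast
  have "card {j. z j = w} = cnullity (pencil \<omega> M w)" if w: "cmod w = 1" for w
  proof -
    have "w \<noteq> 0" using w by auto
    have "pencil \<omega> M w *v v = 0 \<longleftrightarrow> W *v v = w *s v" for v
    proof -
      have "pencil \<omega> M w *v v = 0 \<longleftrightarrow> ?Q *v (W *v v) = ?Q *v (w *s v)"
        unfolding pencil_kernel[OF \<omega>0(1) \<open>w \<noteq> 0\<close>] QWv by (simp add: vector_scalar_commute)
      also have "\<dots> \<longleftrightarrow> W *v v = w *s v"
        using Qker[of "W *v v - w *s v"] by (auto simp: matrix_vector_mult_diff_distrib)
      finally show ?thesis .
    qed
    then show ?thesis using hf.eigenspace_dim[OF y(1,2,4), where w = w] by (simp add: cnullity_def)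
  qed
  moreover have "det (\<chi> i j. w * ?Q $ i $ j - ?R $ i $ j) = det ?Q * (\<Prod>j\<in>UNIV. w - z j)" for w
  proof -
    have "(\<chi> i j. w * ?Q $ i $ j - ?R $ i $ j) = ?Q ** (\<chi> i j. (if i = j then w else 0) - W $ i $ j)"
      unfolding QW[symmetric]
      by (simp add: vec_eq_iff matrix_matrix_mult_def right_diff_distrib sum_subtractf if_distrib[where f = "\<lambda>x. _ * x"] mult.commute cong: if_cong)
    then show ?thesis by (simp add: det_mul hf.det_eigenvalues[OF y(1,2,4)])
  qed
  ultimately show thesis using that[of z] y(3) detQ by blast
qed

subsection \<open>Lifts of points on the circle\<close>

text \<open>Products of linear factors encode a multiset of points in a form that survives limits;
  \<open>proots\<close> recovers the multiset.\<close>

lemma prod_linear_factors_determine_mset: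
  fixes u :: "'a \<Rightarrow> complex" and v :: "'b \<Rightarrow> complex"
  assumes fin: "finite I" "finite J" and eq: "\<And>w. (\<Prod>j\<in>I. w - u j) = (\<Prod>j\<in>J. w - v j)"
  shows "image_mset u (mset_set I) = image_mset v (mset_set J)"
proof -
  have roots: "proots (\<Prod>j\<in>A. [:- f j, 1:]) = image_mset f (mset_set A)" if "finite A" for A and f :: "'c \<Rightarrow> complex"
    using that
  proof (induction A rule: finite_induct)
    case (insert a A)
    have "(\<Prod>j\<in>A. [:- f j, 1:]) \<noteq> 0" using insert.hyps by (simp add: prod_zero_iff)
    then show ?case using insert by (simp add: proots_mult del: mult_pCons_left)
  qed simp
  have "poly (\<Prod>j\<in>I. [:- u j, 1:]) = poly (\<Prod>j\<in>J. [:- v j, 1:])"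
    using eq by (auto simp: poly_prod fun_eq_iff)
  then have "(\<Prod>j\<in>I. [:- u j, 1:]) = (\<Prod>j\<in>J. [:- v j, 1:])" by (simp add: poly_eq_poly_eq_iff)
  then show ?thesis using roots[OF fin(1), of u] roots[OF fin(2), of v] by simp
qed

lemma mset_eq_iff_card_fibres:
  fixes u :: "'a \<Rightarrow> 'c" and v :: "'b \<Rightarrow> 'c"
  assumes "finite I" "finite J"
  shows "image_mset u (mset_set I) = image_mset v (mset_set J) \<longleftrightarrow> (\<forall>z. card {j\<in>I. u j = z} = card {j\<in>J. v j = z})"
proof -
  have "count (image_mset f (mset_set A)) z = card {j\<in>A. f j = z}" if "finite A" for A and f :: "'d \<Rightarrow> 'c" and z
    using that by (simp add: count_image_mset Collect_conj_eq Int_commute vimage_def)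
  then show ?thesis using assms by (metis (mono_tags, lifting) multiset_eqI)
qed

lemma sum_eq_of_mset_eq:
  assumes "image_mset u (mset_set I) = image_mset v (mset_set J)"
  shows "(\<Sum>j\<in>I. h (u j)) = (\<Sum>j\<in>J. h (v j))"
proof -
  have "(\<Sum>j\<in>I. h (u j)) = sum_mset (image_mset h (image_mset u (mset_set I)))"
    by (simp add: sum_unfold_sum_mset multiset.map_comp comp_def)
  also have "\<dots> = (\<Sum>j\<in>J. h (v j))"
    unfolding assms by (simp add: sum_unfold_sum_mset multiset.map_comp comp_def)
  finally show ?thesis .
qed

lemma prod_eq_of_mset_eq:
  assumes "image_mset u (mset_set I) = image_mset v (mset_set J)"
  shows "(\<Prod>j\<in>I. h (u j)) = (\<Prod>j\<in>J. h (v j))"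
proof -
  have "(\<Prod>j\<in>I. h (u j)) = prod_mset (image_mset h (image_mset u (mset_set I)))"
    by (simp add: prod_unfold_prod_mset multiset.map_comp comp_def)
  also have "\<dots> = (\<Prod>j\<in>J. h (v j))"
    unfolding assms by (simp add: prod_unfold_prod_mset multiset.map_comp comp_def)
  finally show ?thesis .
qed

lemma cis_eq_cisD: assumes "cis a = cis b" shows "\<exists>m::int. a = b + 2 * pi * of_int m"
proof -
  have "sin a = sin b \<and> cos a = cos b" using assms by (simp add: complex_eq_iff)
  then show ?thesis unfolding sin_cos_eq_iff .
qed

lemma cis_add_2pi_int: "cis (a + 2 * pi * of_int m) = cis a"
  by (simp flip: cis_mult)

lemma cis_sum: "cis (\<Sum>j\<in>A. f j) = (\<Prod>j\<in>A. cis (f j))"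
  by (induction A rule: infinite_finite_induct) (simp_all flip: cis_mult)

lemma cis_Arg2pi: "cmod z = 1 \<Longrightarrow> cis (Arg2pi z) = z"
  using Arg2pi[of z] by (simp add: is_Arg_def cis_conv_exp)

text \<open>The fractional part of $(a - \theta)/2\pi$ only depends on $e^{i\theta}$, so that sums of
  integer parts of lifts are determined by the points and by the sum of the lifts.\<close>

lemma frac_lift: "frac ((a - \<theta>) / (2 * pi)) = frac ((a - Arg2pi (cis \<theta>)) / (2 * pi))"
proof -
  obtain m :: int where m: "\<theta> = Arg2pi (cis \<theta>) + 2 * pi * of_int m"
    using cis_eq_cisD[of \<theta> "Arg2pi (cis \<theta>)"] cis_Arg2pi[of "cis \<theta>"] by auto
  have "(a - \<theta>) / (2 * pi) = (a - Arg2pi (cis \<theta>)) / (2 * pi) + of_int (- m)"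
    by (subst m) (simp add: field_simps)
  then show ?thesis by (simp only: frac_add_of_int_right)
qed

lemma sum_floor_lifts:
  assumes mset: "image_mset (\<lambda>j. cis (x j)) (mset_set I) = image_mset (\<lambda>j. cis (y j)) (mset_set J)"
  shows "(\<Sum>j\<in>I. real_of_int \<lfloor>(a - x j) / (2 * pi)\<rfloor>) - (\<Sum>j\<in>I. (a - x j) / (2 * pi))
    = (\<Sum>j\<in>J. real_of_int \<lfloor>(a - y j) / (2 * pi)\<rfloor>) - (\<Sum>j\<in>J. (a - y j) / (2 * pi))"
proof -
  have *: "(\<Sum>j\<in>A. real_of_int \<lfloor>(a - f j) / (2 * pi)\<rfloor>) - (\<Sum>j\<in>A. (a - f j) / (2 * pi)) =
     (\<Sum>j\<in>A. - frac ((a - Arg2pi (cis (f j))) / (2 * pi)))" for f :: "'d \<Rightarrow> real" and A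
  proof -
    have "real_of_int \<lfloor>(a - \<theta>) / (2 * pi)\<rfloor> - (a - \<theta>) / (2 * pi) = - frac ((a - Arg2pi (cis \<theta>)) / (2 * pi))" for \<theta>
      using frac_lift[of a \<theta>] frac_def[of "(a - \<theta>) / (2 * pi)"] by linarith
    then show ?thesis by (simp only: sum_subtractf[symmetric])
  qed
  show ?thesis unfolding * by (rule sum_eq_of_mset_eq[OF mset, of "\<lambda>z. - frac ((a - Arg2pi z) / (2 * pi))"])
qed

text \<open>Sorted lifts spread over at most one turn are determined by the points together with the sum
  of the lifts; this makes them depend continuously on the points.\<close>

definition normal_lift :: "nat \<Rightarrow> (nat \<Rightarrow> real) \<Rightarrow> bool" where
  "normal_lift n x \<longleftrightarrow> (\<forall>i<n. \<forall>j<n. (i \<le> j \<longrightarrow> x i \<le> x j) \<and> x j \<le> x i + 2 * pi)"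

text \<open>If x k <= a, the floors are at least 0 for j <= k and at least -1 afterwards; if a < x
  k, they are at most 0 for j < k and at most -1 from k on. The totals k + 1 - n and k - n separate
  the cases, so floor sums determine every entry.\<close>

lemma normal_lift_le_iff:
  assumes x: "normal_lift n x" and k: "k < n"
  shows "x k \<le> a \<longleftrightarrow> real k + 1 - real n \<le> (\<Sum>j<n. real_of_int \<lfloor>(a - x j) / (2 * pi)\<rfloor>)"
proof
  assume a: "x k \<le> a"
  have "(\<Sum>j<n. if j \<le> k then 0 else -1) \<le> (\<Sum>j<n. real_of_int \<lfloor>(a - x j) / (2 * pi)\<rfloor>)"
  proof (intro sum_mono)
    fix j assume j: "j \<in> {..<n}"
    show "(if j \<le> k then 0 else -1) \<le> real_of_int \<lfloor>(a - x j) / (2 * pi)\<rfloor>"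
    proof (cases "j \<le> k")
      case True
      then have "x j \<le> x k" using x j k by (simp add: normal_lift_def)
      then have "0 \<le> (a - x j) / (2 * pi)" using a by simp
      then show ?thesis using True by simp
    next
      case False
      have "x j \<le> x k + 2 * pi" using x j k by (simp add: normal_lift_def)
      then have "-1 \<le> (a - x j) / (2 * pi)" using a by (simp add: field_simps)
      then have "-1 \<le> \<lfloor>(a - x j) / (2 * pi)\<rfloor>" by (simp add: le_floor_iff)
      then show ?thesis using False by simp
    qed
  qed
  moreover have "(\<Sum>j<n. if j \<le> k then 0 else -1 :: real) = real k + 1 - real n"
  proof -
    have "(\<Sum>j<n. if j \<le> k then 0 else -1 :: real) = (\<Sum>j\<in>{k<..<n}. -1)"
      by (intro sum.mono_neutral_cong_right) auto
    then show ?thesis using k by (simp add: of_nat_diff)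
  qed
  ultimately show "real k + 1 - real n \<le> (\<Sum>j<n. real_of_int \<lfloor>(a - x j) / (2 * pi)\<rfloor>)" by simp
next
  assume sum: "real k + 1 - real n \<le> (\<Sum>j<n. real_of_int \<lfloor>(a - x j) / (2 * pi)\<rfloor>)"
  show "x k \<le> a"
  proof (rule ccontr)
    assume "\<not> x k \<le> a"
    then have a: "a < x k" by simp
    have "(\<Sum>j<n. real_of_int \<lfloor>(a - x j) / (2 * pi)\<rfloor>) \<le> (\<Sum>j<n. if j < k then 0 else -1)"
    proof (intro sum_mono)
      fix j assume j: "j \<in> {..<n}"
      show "real_of_int \<lfloor>(a - x j) / (2 * pi)\<rfloor> \<le> (if j < k then 0 else -1)"
      proof (cases "j < k")
        case True
        have "x k \<le> x j + 2 * pi" using x j k by (simp add: normal_lift_def)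
        then have "(a - x j) / (2 * pi) < 1" using a by (simp add: field_simps)
        then have "\<lfloor>(a - x j) / (2 * pi)\<rfloor> < 1" by (simp add: floor_less_iff)
        then show ?thesis using True by simp
      next
        case False
        then have "x k \<le> x j" using x j k by (simp add: normal_lift_def)
        then have "(a - x j) / (2 * pi) < 0" using a by (simp add: field_simps)
        then have "\<lfloor>(a - x j) / (2 * pi)\<rfloor> < 0" by (simp add: floor_less_iff)
        then have "\<lfloor>(a - x j) / (2 * pi)\<rfloor> \<le> -1" by linarith
        then show ?thesis using False by simp
      qed
    qed
    also have "(\<Sum>j<n. if j < k then 0 else -1 :: real) = (\<Sum>j\<in>{k..<n}. -1)"
      by (intro sum.mono_neutral_cong_right) auto
    also have "\<dots> = real k - real n" using k by (simp add: of_nat_diff)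
    finally show False using sum by simp
  qed
qed

text \<open>Floor sums depend only on the points and on the total, so x k <= a and y k <= a hold for
  the same reals a.\<close>

lemma normal_lift_unique:
  assumes x: "normal_lift n x" and y: "normal_lift n y"
    and mset: "image_mset (\<lambda>j. cis (x j)) (mset_set {..<n}) = image_mset (\<lambda>j. cis (y j)) (mset_set {..<n})"
    and sum: "(\<Sum>j<n. x j) = (\<Sum>j<n. y j)" and k: "k < n"
  shows "x k = y k"
proof -
  have "(\<Sum>j<n. (a - x j) / (2 * pi)) = (\<Sum>j<n. (a - y j) / (2 * pi))" for a
    using sum by (simp add: sum_subtractf flip: sum_divide_distrib)
  then have "(\<Sum>j<n. real_of_int \<lfloor>(a - x j) / (2 * pi)\<rfloor>) = (\<Sum>j<n. real_of_int \<lfloor>(a - y j) / (2 * pi)\<rfloor>)" for a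
    using sum_floor_lifts[OF mset, of a] by simp
  then have "x k \<le> a \<longleftrightarrow> y k \<le> a" for a
    unfolding normal_lift_le_iff[OF x k] normal_lift_le_iff[OF y k] by simp
  then show ?thesis by (metis order.antisym order.refl)
qed

text \<open>Moving the smallest entry up by a full turn, or the largest one down, keeps the entries
  sortable within one turn. It changes the total by 2 pi and leaves the points where they
  are.\<close>

lemma normal_lift_rotate:
  assumes x: "normal_lift (Suc m) x"
  shows normal_lift_up: "\<exists>y. normal_lift (Suc m) y \<and> (\<Sum>j<Suc m. y j) = (\<Sum>j<Suc m. x j) + 2 * pi \<and>
      (\<forall>w. (\<Prod>j<Suc m. w - cis (y j)) = (\<Prod>j<Suc m. w - cis (x j)))"
    and normal_lift_down: "\<exists>y. normal_lift (Suc m) y \<and> (\<Sum>j<Suc m. y j) = (\<Sum>j<Suc m. x j) - 2 * pi \<and>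
      (\<forall>w. (\<Prod>j<Suc m. w - cis (y j)) = (\<Prod>j<Suc m. w - cis (x j)))"
proof -
  have mono: "i \<le> j \<Longrightarrow> j \<le> m \<Longrightarrow> x i \<le> x j" and spread: "i \<le> m \<Longrightarrow> j \<le> m \<Longrightarrow> x j \<le> x i + 2 * pi" for i j
    using x by (auto simp: normal_lift_def)
  have per: "cis (a + 2 * pi) = cis a" "cis (a - 2 * pi) = cis a" for a
    using cis_add_2pi_int[of a 1] cis_add_2pi_int[of a "-1"] by simp_all
  let ?y = "\<lambda>j. if j < m then x (Suc j) else x 0 + 2 * pi"
  have "normal_lift (Suc m) ?y"
    using mono spread by (auto simp: normal_lift_def intro: order_trans[OF spread])
  moreover have "(\<Sum>j<Suc m. ?y j) = (\<Sum>j<Suc m. x j) + 2 * pi"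
    by (subst (2) sum.lessThan_Suc_shift) simp
  moreover have "(\<Prod>j<Suc m. w - cis (?y j)) = (\<Prod>j<Suc m. w - cis (x j))" for w
    by (subst (2) prod.lessThan_Suc_shift) (simp add: per)
  ultimately show "\<exists>y. normal_lift (Suc m) y \<and> (\<Sum>j<Suc m. y j) = (\<Sum>j<Suc m. x j) + 2 * pi \<and>
      (\<forall>w. (\<Prod>j<Suc m. w - cis (y j)) = (\<Prod>j<Suc m. w - cis (x j)))" by blast
  let ?z = "\<lambda>j. if j = 0 then x m - 2 * pi else x (j - 1)"
  have "normal_lift (Suc m) ?z"
    unfolding normal_lift_def
  proof (intro allI impI conjI)
    fix i j assume ij: "i < Suc m" "j < Suc m"
    then have le: "i - 1 \<le> m" "j - 1 \<le> m" by auto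
    show "?z i \<le> ?z j" if "i \<le> j" using mono[of "i - 1" "j - 1"] spread[of "j - 1" m] ij le that by auto
    show "?z j \<le> ?z i + 2 * pi"
      using mono[of "j - 1" m] mono[of m m] spread[of "i - 1" "j - 1"] spread[of "i - 1" m] ij le
      by auto (use pi_gt_zero in linarith)
  qed
  moreover have "(\<Sum>j<Suc m. ?z j) = (\<Sum>j<Suc m. x j) - 2 * pi"
    by (subst sum.lessThan_Suc_shift) simp
  moreover have "(\<Prod>j<Suc m. w - cis (?z j)) = (\<Prod>j<Suc m. w - cis (x j))" for w
    by (subst prod.lessThan_Suc_shift) (simp add: per mult.commute[of "w - cis (x m)"])
  ultimately show "\<exists>y. normal_lift (Suc m) y \<and> (\<Sum>j<Suc m. y j) = (\<Sum>j<Suc m. x j) - 2 * pi \<and>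
      (\<forall>w. (\<Prod>j<Suc m. w - cis (y j)) = (\<Prod>j<Suc m. w - cis (x j)))" by blast
qed

text \<open>The sorted arguments in [0, 2 pi) have the right total up to a multiple of 2 pi, and
  rotations correct it.\<close>

lemma normal_lift_exists:
  assumes n: "0 < n" and z: "\<And>j. j < n \<Longrightarrow> cmod (z j) = 1" and \<phi>: "cis \<phi> = (\<Prod>j<n. z j)"
  shows "\<exists>x. normal_lift n x \<and> (\<Sum>j<n. x j) = \<phi> \<and> (\<forall>w. (\<Prod>j<n. w - cis (x j)) = (\<Prod>j<n. w - z j))"
proof -
  define xs where "xs = sort (map (\<lambda>j. Arg2pi (z j)) [0..<n])"
  have len: "length xs = n" by (simp add: xs_def)
  have range: "0 \<le> a \<and> a < 2 * pi" if "a \<in> set xs" for a using that Arg2pi by (auto simp: xs_def)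
  have prod: "(\<Prod>j<n. f (xs ! j)) = (\<Prod>j<n. f (Arg2pi (z j)))" for f :: "real \<Rightarrow> complex"
  proof -
    have "(\<Prod>j<n. f (xs ! j)) = prod_list (map f xs)"
      using len by (simp add: prod.list_conv_set_nth lessThan_atLeast0)
    also have "\<dots> = prod_mset (mset (map f xs))" by (simp only: prod_mset_prod_list)
    also have "mset (map f xs) = mset (map (\<lambda>j. f (Arg2pi (z j))) [0..<n])"
      by (simp add: xs_def multiset.map_comp comp_def)
    also have "prod_mset \<dots> = (\<Prod>j<n. f (Arg2pi (z j)))"
      by (simp only: prod_mset_prod_list prod.distinct_set_conv_list[OF distinct_upt, symmetric] set_upt lessThan_atLeast0)
    finally show ?thesis .
  qed
  have base: "normal_lift n (\<lambda>j. xs ! j)"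
    unfolding normal_lift_def
  proof (intro allI impI conjI)
    fix i j assume ij: "i < n" "j < n"
    show "xs ! i \<le> xs ! j" if "i \<le> j" using that ij len by (intro sorted_nth_mono) (auto simp: xs_def)
    have "xs ! j < 2 * pi" "0 \<le> xs ! i" using ij len range nth_mem by auto
    then show "xs ! j \<le> xs ! i + 2 * pi" by linarith
  qed
  have zA: "cis (Arg2pi (z j)) = z j" if "j < n" for j using cis_Arg2pi z that by simp
  have "cis (\<Sum>j<n. xs ! j) = cis \<phi>"
    unfolding cis_sum prod[of cis] \<phi> by (intro prod.cong) (auto simp: zA)
  then obtain m :: int where m: "\<phi> = (\<Sum>j<n. xs ! j) + 2 * pi * of_int m" using cis_eq_cisD by metis
  have factors: "(\<Prod>j<n. w - cis (xs ! j)) = (\<Prod>j<n. w - z j)" for w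
    unfolding prod[of "\<lambda>a. w - cis a"] by (intro prod.cong) (auto simp: zA)
  have "\<exists>x. normal_lift n x \<and> (\<Sum>j<n. x j) = (\<Sum>j<n. xs ! j) + 2 * pi * of_int m \<and> (\<forall>w. (\<Prod>j<n. w - cis (x j)) = (\<Prod>j<n. w - z j))" for m
  proof (induction m rule: int_induct[where k = 0])
    case base
    then show ?case using \<open>normal_lift n (\<lambda>j. xs ! j)\<close> factors by (intro exI[of _ "\<lambda>j. xs ! j"]) simp
  next
    case (step1 i)
    then obtain x where x: "normal_lift n x" "(\<Sum>j<n. x j) = (\<Sum>j<n. xs ! j) + 2 * pi * of_int i"
      "\<forall>w. (\<Prod>j<n. w - cis (x j)) = (\<Prod>j<n. w - z j)" by (elim exE conjE)
    obtain n' where n': "n = Suc n'" using n by (cases n) auto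
    from normal_lift_up[OF x(1)[unfolded n'], folded n'] show ?case
      unfolding x(2) using x(3) by (simp add: distrib_left add.assoc)
  next
    case (step2 i)
    then obtain x where x: "normal_lift n x" "(\<Sum>j<n. x j) = (\<Sum>j<n. xs ! j) + 2 * pi * of_int i"
      "\<forall>w. (\<Prod>j<n. w - cis (x j)) = (\<Prod>j<n. w - z j)" by (elim exE conjE)
    obtain n' where n': "n = Suc n'" using n by (cases n) auto
    from normal_lift_down[OF x(1)[unfolded n'], folded n'] show ?case
      unfolding x(2) using x(3) by (simp add: right_diff_distrib add_diff_eq)
  qed
  from this[of m] show ?thesis unfolding m .
qed

section \<open>Continuity of sorted lifts\<close>

lemma componentwise_convergent_subsequence:
  fixes x :: "nat \<Rightarrow> nat \<Rightarrow> real"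
  assumes "\<And>j m. j < n \<Longrightarrow> \<bar>x j m\<bar> \<le> b"
  shows "\<exists>r y. strict_mono (r :: nat \<Rightarrow> nat) \<and> (\<forall>j<n. (\<lambda>m. x j (r m)) \<longlonglongrightarrow> y j)"
  using assms
proof (induction n)
  case 0
  show ?case by (intro exI[of _ id]) (auto simp: strict_mono_def)
next
  case (Suc n)
  then obtain r y where r: "strict_mono (r :: nat \<Rightarrow> nat)" "\<And>j. j < n \<Longrightarrow> (\<lambda>m. x j (r m)) \<longlonglongrightarrow> y j"
    by (metis less_Suc_eq)
  have "bounded (range (\<lambda>m. x n (r m)))"
    unfolding bounded_iff by (rule exI[of _ b]) (use Suc.prems in auto)
  then obtain l s where s: "strict_mono (s :: nat \<Rightarrow> nat)" "((\<lambda>m. x n (r m)) \<circ> s) \<longlonglongrightarrow> l"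
    using bounded_imp_convergent_subsequence by blast
  have "(\<lambda>m. x j ((r \<circ> s) m)) \<longlonglongrightarrow> (y(n := l)) j" if "j < Suc n" for j
  proof (cases "j = n")
    case True then show ?thesis using s(2) by (simp add: comp_def)
  next
    case False
    then have "(\<lambda>m. x j (r m)) \<longlonglongrightarrow> y j" using r(2) that by simp
    from LIMSEQ_subseq_LIMSEQ[OF this s(1)] show ?thesis using False by (simp add: comp_def)
  qed
  then show ?case using strict_mono_o[OF r(1) s(1)] by blast
qed

lemma not_tendsto_subsequence:
  fixes f :: "nat \<Rightarrow> 'a::metric_space"
  assumes "\<not> f \<longlonglongrightarrow> l"
  obtains \<epsilon> r where "0 < \<epsilon>" "strict_mono (r :: nat \<Rightarrow> nat)" "\<And>m. \<epsilon> \<le> dist (f (r m)) l"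
proof -
  obtain \<epsilon> where \<epsilon>: "0 < \<epsilon>" "\<not> (\<forall>\<^sub>F m in sequentially. dist (f m) l < \<epsilon>)"
    using assms by (auto simp: tendsto_iff)
  then have "infinite {m. \<epsilon> \<le> dist (f m) l}"
    by (simp add: infinite_nat_iff_unbounded_le eventually_sequentially not_less)
  then obtain r where "strict_mono (r :: nat \<Rightarrow> nat)" "\<forall>m. r m \<in> {m. \<epsilon> \<le> dist (f m) l}"
    using infinite_enumerate by blast
  then show thesis using that[of \<epsilon> r] \<epsilon>(1) by blast
qed

text \<open>Every entry lies within a full turn of the mean. This supplies the compactness for the
  continuity argument.\<close>

lemma normal_lift_bound:
  assumes "normal_lift n x" "j < n"
  shows "\<bar>x j\<bar> \<le> \<bar>\<Sum>i<n. x i\<bar> + 2 * pi"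
proof -
  have n: "1 \<le> real n" using assms(2) by simp
  have "(\<Sum>i<n. x j) \<le> (\<Sum>i<n. x i + 2 * pi)"
    by (rule sum_mono) (use assms in \<open>auto simp: normal_lift_def\<close>)
  moreover have "(\<Sum>i<n. x i) \<le> (\<Sum>i<n. x j + 2 * pi)"
    by (rule sum_mono) (use assms in \<open>auto simp: normal_lift_def\<close>)
  ultimately have "\<bar>real n * x j - (\<Sum>i<n. x i)\<bar> \<le> real n * (2 * pi)" by (simp add: sum.distrib abs_le_iff distrib_left)
  then have "\<bar>real n * x j\<bar> \<le> \<bar>\<Sum>i<n. x i\<bar> + real n * (2 * pi)" by linarith
  also have "\<dots> \<le> real n * (\<bar>\<Sum>i<n. x i\<bar> + 2 * pi)"
    using mult_right_mono[OF n, of "\<bar>\<Sum>i<n. x i\<bar>"] by (simp add: distrib_left)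
  finally have "real n * \<bar>x j\<bar> \<le> real n * (\<bar>\<Sum>i<n. x i\<bar> + 2 * pi)" using n by (simp add: abs_mult)
  then show ?thesis using n by simp
qed

text \<open>Along a convergent sequence of parameters the entries stay bounded, and a subsequential
  limit is again a normal lift, with the points and the total of the limit parameter. Uniqueness
  identifies it, whether or not points collide.\<close>

lemma continuous_on_normal_lift:
  fixes x :: "nat \<Rightarrow> 'p::metric_space \<Rightarrow> real"
  assumes x: "\<And>p. p \<in> K \<Longrightarrow> normal_lift n (\<lambda>j. x j p)"
    and sum: "\<And>p. p \<in> K \<Longrightarrow> (\<Sum>j<n. x j p) = \<phi> p" and \<phi>: "continuous_on K \<phi>"
    and fac: "\<And>p w. p \<in> K \<Longrightarrow> (\<Prod>j<n. w - cis (x j p)) = q p w"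
    and q: "\<And>w. continuous_on K (\<lambda>p. q p w)" and k: "k < n"
  shows "continuous_on K (x k)"
  unfolding continuous_on_sequentially
proof (intro allI ballI impI, elim conjE)
  fix s a assume a: "a \<in> K" and s: "\<forall>n. s n \<in> K" "s \<longlonglongrightarrow> a"
  show "(x k \<circ> s) \<longlonglongrightarrow> x k a"
  proof (rule ccontr)
    assume "\<not> ?thesis"
    then obtain \<epsilon> r where r: "0 < \<epsilon>" "strict_mono (r :: nat \<Rightarrow> nat)" "\<And>m. \<epsilon> \<le> dist ((x k \<circ> s) (r m)) (x k a)"
      by (rule not_tendsto_subsequence) blast
    define s' where "s' = s \<circ> r"
    have s': "s' m \<in> K" for m using s(1) by (simp add: s'_def)
    have lim: "s' \<longlonglongrightarrow> a" unfolding s'_def using s(2) r(2) by (rule LIMSEQ_subseq_LIMSEQ)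
    have lims: "(\<lambda>m. f (s' m)) \<longlonglongrightarrow> f a" if "continuous_on K f" for f :: "'p \<Rightarrow> 'z::metric_space"
      using that a s' lim by (rule_tac continuous_on_tendsto_compose) auto
    have "Bseq (\<lambda>m. \<phi> (s' m))" using lims[OF \<phi>] by (intro convergent_imp_Bseq) (auto simp: convergent_def)
    then obtain b where b: "\<And>m. \<bar>\<phi> (s' m)\<bar> \<le> b" by (auto simp: Bseq_def)
    have bd: "\<bar>x j (s' m)\<bar> \<le> b + 2 * pi" if "j < n" for j m
      using normal_lift_bound[OF x[OF s', of m] that] b[of m] sum[OF s', of m] by simp
    have "\<exists>t y. strict_mono (t :: nat \<Rightarrow> nat) \<and> (\<forall>j<n. (\<lambda>m. x j (s' (t m))) \<longlonglongrightarrow> y j)"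
      by (rule componentwise_convergent_subsequence[of n "\<lambda>j m. x j (s' m)", OF bd])
    then obtain t y where ty: "strict_mono (t :: nat \<Rightarrow> nat) \<and> (\<forall>j<n. (\<lambda>m. x j (s' (t m))) \<longlonglongrightarrow> y j)"
      by (elim exE)
    then have t: "strict_mono t" "\<And>j. j < n \<Longrightarrow> (\<lambda>m. x j (s' (t m))) \<longlonglongrightarrow> y j" by blast+
    have lims': "(\<lambda>m. f (s' (t m))) \<longlonglongrightarrow> f a" if "continuous_on K f" for f :: "'p \<Rightarrow> 'z::metric_space"
      using LIMSEQ_subseq_LIMSEQ[OF lims[OF that] t(1)] by (simp add: comp_def)
    have nl: "normal_lift n y"
      unfolding normal_lift_def
    proof (intro allI impI conjI)
      fix i j assume ij: "i < n" "j < n"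
      show "y i \<le> y j" if "i \<le> j"
        using t(2)[OF ij(1)] t(2)[OF ij(2)]
        by (rule LIMSEQ_le) (use x[OF s'] ij that in \<open>auto simp: normal_lift_def\<close>)
      have "(\<lambda>m. x i (s' (t m)) + 2 * pi) \<longlonglongrightarrow> y i + 2 * pi"
        by (intro tendsto_intros t(2) ij)
      with t(2)[OF ij(2)] show "y j \<le> y i + 2 * pi"
        by (rule LIMSEQ_le) (use x[OF s'] ij in \<open>auto simp: normal_lift_def\<close>)
    qed
    have sm: "(\<Sum>j<n. y j) = (\<Sum>j<n. x j a)"
    proof (rule LIMSEQ_unique)
      show "(\<lambda>m. \<Sum>j<n. x j (s' (t m))) \<longlonglongrightarrow> (\<Sum>j<n. y j)" by (intro tendsto_sum t(2)) simp
      show "(\<lambda>m. \<Sum>j<n. x j (s' (t m))) \<longlonglongrightarrow> (\<Sum>j<n. x j a)" using lims'[OF \<phi>] by (simp add: sum[OF s'] sum[OF a])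
    qed
    have pf: "(\<Prod>j<n. w - cis (y j)) = (\<Prod>j<n. w - cis (x j a))" for w
    proof (rule LIMSEQ_unique)
      have "(\<lambda>m. cis (x j (s' (t m)))) \<longlonglongrightarrow> cis (y j)" if "j < n" for j
        unfolding cis_conv_exp by (intro tendsto_intros t(2) that)
      then show "(\<lambda>m. \<Prod>j<n. w - cis (x j (s' (t m)))) \<longlonglongrightarrow> (\<Prod>j<n. w - cis (y j))"
        by (intro tendsto_prod tendsto_diff tendsto_const) simp
      show "(\<lambda>m. \<Prod>j<n. w - cis (x j (s' (t m)))) \<longlonglongrightarrow> (\<Prod>j<n. w - cis (x j a))"
        using lims'[OF q[of w]] by (simp only: fac[OF s'] fac[OF a])
    qed
    have ms: "image_mset (\<lambda>j. cis (y j)) (mset_set {..<n}) = image_mset (\<lambda>j. cis (x j a)) (mset_set {..<n})"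
      by (rule prod_linear_factors_determine_mset[OF finite_lessThan finite_lessThan pf])
    have "y k = x k a" by (rule normal_lift_unique[OF nl x[OF a] ms sm k])
    then have "(\<lambda>m. x k (s' (t m))) \<longlonglongrightarrow> x k a" using t(2)[OF k] by simp
    then have "\<forall>\<^sub>F m in sequentially. dist (x k (s' (t m))) (x k a) < \<epsilon>" using r(1) by (rule tendstoD)
    then obtain m where "\<forall>i\<ge>m. dist (x k (s' (t i))) (x k a) < \<epsilon>" unfolding eventually_sequentially by (rule exE)
    then have "dist (x k (s' (t m))) (x k a) < \<epsilon>" by simp
    then show False using r(3)[of "t m"] by (simp add: s'_def)
  qed
qed

text \<open>The product of the points is (-1)^n q(p, 0), which has a continuous logarithm on a
  convex set. Its imaginary part prescribes the total and so removes the only freedom left in a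
  normal lift.\<close>

lemma continuous_normal_lift_exists:
  fixes K :: "'p::real_normed_vector set" and n :: nat
  assumes K: "convex K" and n: "0 < n"
    and z: "\<And>p. p \<in> K \<Longrightarrow> \<exists>z. (\<forall>j<n. cmod (z j) = 1) \<and> (\<forall>w. (\<Prod>j<n. w - z j) = q p w)"
    and q: "\<And>w. continuous_on K (\<lambda>p. q p w)"
  obtains x where "\<And>j. j < n \<Longrightarrow> continuous_on K (x j)"
    "\<And>p w. p \<in> K \<Longrightarrow> (\<Prod>j<n. w - cis (x j p)) = q p w"
proof -
  have z0: "(\<Prod>j<n. z j) = (-1) ^ n * q p 0" if "\<forall>w. (\<Prod>j<n. w - z j) = q p w" for z p
  proof -
    have "q p 0 = (\<Prod>j<n. (-1) * z j)" using that[rule_format, of 0] by simp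
    also have "\<dots> = (-1) ^ n * (\<Prod>j<n. z j)" by (simp only: prod.distrib) simp
    finally show ?thesis by (simp flip: power_mult_distrib mult.assoc)
  qed
  have unit: "cmod ((-1) ^ n * q p 0) = 1" if "p \<in> K" for p
  proof -
    obtain z where "\<forall>j<n. cmod (z j) = 1" "\<forall>w. (\<Prod>j<n. w - z j) = q p w" using z[OF \<open>p \<in> K\<close>] by blast
    then show ?thesis unfolding z0[OF \<open>\<forall>w. (\<Prod>j<n. w - z j) = q p w\<close>, symmetric] prod_norm[symmetric] by simp
  qed
  obtain g where g: "continuous_on K g" "\<And>p. p \<in> K \<Longrightarrow> (-1) ^ n * q p 0 = exp (g p)"
  proof (rule continuous_logarithm_on_contractible)
    show "continuous_on K (\<lambda>p. (-1) ^ n * q p 0)" by (intro continuous_intros q)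
    show "contractible K" by (rule convex_imp_contractible[OF K])
    show "(-1) ^ n * q p 0 \<noteq> 0" if "p \<in> K" for p using unit[OF that] by auto
  qed blast
  define \<phi> where "\<phi> p = Im (g p)" for p
  have cis\<phi>: "cis (\<phi> p) = (-1) ^ n * q p 0" if "p \<in> K" for p
  proof -
    have "Re (g p) = 0" using unit[OF that] g(2)[OF that] by simp
    then have "g p = \<i> * of_real (\<phi> p)" by (simp add: \<phi>_def complex_eq_iff)
    then show ?thesis using g(2)[OF that] by (simp add: cis_conv_exp)
  qed
  have "\<exists>x. normal_lift n x \<and> (\<Sum>j<n. x j) = \<phi> p \<and> (\<forall>w. (\<Prod>j<n. w - cis (x j)) = q p w)" if p: "p \<in> K" for p
  proof -
    obtain z where z': "\<forall>j<n. cmod (z j) = 1" "\<forall>w. (\<Prod>j<n. w - z j) = q p w" using z[OF p] by blast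
    have "cis (\<phi> p) = (\<Prod>j<n. z j)" using cis\<phi>[OF p] z0[OF z'(2)] by simp
    from normal_lift_exists[OF n _ this] z' show ?thesis by simp
  qed
  then obtain X where X: "\<And>p. p \<in> K \<Longrightarrow> normal_lift n (X p) \<and> (\<Sum>j<n. X p j) = \<phi> p \<and> (\<forall>w. (\<Prod>j<n. w - cis (X p j)) = q p w)"
    by metis
  have "continuous_on K (\<lambda>p. X p j)" if "j < n" for j
    by (rule continuous_on_normal_lift[where x = "\<lambda>j p. X p j" and q = q and \<phi> = \<phi> and n = n])
       (use X q that g(1) in \<open>auto simp: \<phi>_def[abs_def] intro!: continuous_intros\<close>)
  then show thesis using X that[of "\<lambda>j p. X p j"] by blast
qed

subsection \<open>The index\<close>

lemma pencil_one: "pencil \<omega> M 1 = (\<chi> i j. cmat M $ i $ j - (if i = j then \<omega> else 0))"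
  by (auto simp: pencil_def vec_eq_iff Pplus_def Pminus_def field_simps)

lemma nullity_om_pencil: "nullity_om \<omega> \<gamma> = cnullity (pencil \<omega> (\<gamma> (2 * pi)) 1)"
  by (simp add: nullity_om_def pencil_one)

lemma cnullity_eq_0: "cnullity A = 0" if "\<And>v. A *v v = 0 \<Longrightarrow> v = 0"
proof -
  have "{v. A *v v = 0} = {0}" using that by auto
  moreover have "vec.dim ({0} :: (complex^4) set) = card ({} :: (complex^4) set)"
    by (rule vec.dim_unique[OF _ _ vec.independent_empty refl]) auto
  ultimately show ?thesis by (simp add: cnullity_def)
qed

lemma eig_lift_card:
  assumes "eig_lift \<omega> \<gamma> \<theta>" "t \<in> {0..2 * pi}"
  shows "card {j. cis (\<theta> j t) = z} = (if cmod z = 1 then cnullity (pencil \<omega> (\<gamma> t) z) else 0)"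
proof (cases "cmod z = 1")
  case False
  then have "{j. cis (\<theta> j t) = z} = {}" by auto
  then show ?thesis using False by simp
qed (use assms in \<open>auto simp: eig_lift_def\<close>)

text \<open>The totals of two lifts differ by a continuous function with values in 2 pi times the
  integers, hence by a constant in t. The floor sums differ from the totals over 2 pi by amounts
  that the points alone determine.\<close>

lemma eig_lift_sum_floor_diff:
  assumes \<theta>: "eig_lift \<omega> \<gamma> \<theta>" and \<theta>': "eig_lift \<omega> \<gamma> \<theta>'"
  shows "(\<Sum>j\<in>UNIV. \<lfloor>\<theta> j (2 * pi) / (2 * pi)\<rfloor> - \<lfloor>\<theta> j 0 / (2 * pi)\<rfloor>)
    = (\<Sum>j\<in>UNIV. \<lfloor>\<theta>' j (2 * pi) / (2 * pi)\<rfloor> - \<lfloor>\<theta>' j 0 / (2 * pi)\<rfloor>)"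
proof -
  \<comment> \<open>\<open>sum_floor_lifts\<close> evaluates a - x, so the angles enter with
    reversed sign and a = 0.\<close>
  have mset: "image_mset (\<lambda>j. cis (- \<theta> j t)) (mset_set UNIV) = image_mset (\<lambda>j. cis (- \<theta>' j t)) (mset_set UNIV)"
    if t: "t \<in> {0..2 * pi}" for t
  proof -
    have "cis (- a) = z \<longleftrightarrow> cis a = cnj z" for a z by (auto simp: cis_cnj[symmetric])
    then show ?thesis
      by (subst mset_eq_iff_card_fibres) (simp_all add: eig_lift_card[OF \<theta> t] eig_lift_card[OF \<theta>' t])
  qed
  have fl: "(\<Sum>j\<in>UNIV. real_of_int \<lfloor>\<theta> j t / (2 * pi)\<rfloor>) - (\<Sum>j\<in>UNIV. \<theta> j t / (2 * pi))
     = (\<Sum>j\<in>UNIV. real_of_int \<lfloor>\<theta>' j t / (2 * pi)\<rfloor>) - (\<Sum>j\<in>UNIV. \<theta>' j t / (2 * pi))" if t: "t \<in> {0..2 * pi}" for t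
    using sum_floor_lifts[OF mset[OF t], of 0] by simp
  define D where "D t = (\<Sum>j\<in>UNIV. \<theta> j t) - (\<Sum>j\<in>UNIV. \<theta>' j t)" for t
  have D: "\<exists>m::int. D t = 2 * pi * of_int m" if t: "t \<in> {0..2 * pi}" for t
  proof -
    have "cis (- (\<Sum>j\<in>UNIV. \<theta> j t)) = cis (- (\<Sum>j\<in>UNIV. \<theta>' j t))"
      using prod_eq_of_mset_eq[OF mset[OF t], of "\<lambda>z. z"] by (simp add: cis_sum[symmetric] sum_negf)
    then obtain m :: int where "- (\<Sum>j\<in>UNIV. \<theta> j t) = - (\<Sum>j\<in>UNIV. \<theta>' j t) + 2 * pi * of_int m"
      using cis_eq_cisD by blast
    then have "D t = 2 * pi * of_int (- m)" by (simp add: D_def)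
    then show ?thesis by blast
  qed
  have "D constant_on {0..2 * pi}"
  proof (rule continuous_discrete_range_constant)
    show "continuous_on {0..2 * pi} D"
      unfolding D_def[abs_def] using \<theta> \<theta>' by (intro continuous_intros) (auto simp: eig_lift_def)
    fix s assume s: "s \<in> {0..2 * pi}"
    have "2 * pi \<le> norm (D t - D s)" if t: "t \<in> {0..2 * pi}" "D t \<noteq> D s" for t
    proof -
      obtain m k :: int where mk: "D t = 2 * pi * of_int m" "D s = 2 * pi * of_int k" using D s t(1) by blast
      then have "1 \<le> \<bar>m - k\<bar>" using t(2) by auto
      then have "1 \<le> \<bar>real_of_int m - of_int k\<bar>" by linarith
      then have "2 * pi * 1 \<le> 2 * pi * \<bar>real_of_int m - of_int k\<bar>" by (intro mult_left_mono) auto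
      also have "\<dots> = norm (D t - D s)" unfolding mk by (simp add: abs_mult flip: right_diff_distrib)
      finally show ?thesis by simp
    qed
    then show "\<exists>e>0. \<forall>t. t \<in> {0..2 * pi} \<and> D t \<noteq> D s \<longrightarrow> e \<le> norm (D t - D s)"
      by (intro exI[of _ "2 * pi"]) auto
  qed simp
  then have "D (2 * pi) = D 0" by (auto simp: constant_on_def)
  then have "((\<Sum>j\<in>UNIV. \<theta> j (2 * pi)) - (\<Sum>j\<in>UNIV. \<theta>' j (2 * pi))) / (2 * pi)
     = ((\<Sum>j\<in>UNIV. \<theta> j 0) - (\<Sum>j\<in>UNIV. \<theta>' j 0)) / (2 * pi)" by (simp only: D_def)
  then have "(\<Sum>j\<in>UNIV. \<theta> j (2 * pi) / (2 * pi)) - (\<Sum>j\<in>UNIV. \<theta>' j (2 * pi) / (2 * pi))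
     = (\<Sum>j\<in>UNIV. \<theta> j 0 / (2 * pi)) - (\<Sum>j\<in>UNIV. \<theta>' j 0 / (2 * pi))"
    by (simp only: diff_divide_distrib sum_divide_distrib)
  then have "real_of_int (\<Sum>j\<in>UNIV. \<lfloor>\<theta> j (2 * pi) / (2 * pi)\<rfloor> - \<lfloor>\<theta> j 0 / (2 * pi)\<rfloor>)
    = real_of_int (\<Sum>j\<in>UNIV. \<lfloor>\<theta>' j (2 * pi) / (2 * pi)\<rfloor> - \<lfloor>\<theta>' j 0 / (2 * pi)\<rfloor>)"
    unfolding sum_subtractf of_int_diff of_int_sum using fl[of "2 * pi"] fl[of 0] by simp
  then show ?thesis by (simp only: of_int_eq_iff)
qed

lemma cis_eq_1_iff: "cis a = 1 \<longleftrightarrow> a / (2 * pi) = of_int \<lfloor>a / (2 * pi)\<rfloor>"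
proof
  assume "cis a = 1"
  then obtain m :: int where "a = 2 * pi * of_int m" using cis_eq_cisD[of a 0] by auto
  then show "a / (2 * pi) = of_int \<lfloor>a / (2 * pi)\<rfloor>" by simp
next
  assume "a / (2 * pi) = of_int \<lfloor>a / (2 * pi)\<rfloor>"
  then have "a = 0 + 2 * pi * of_int \<lfloor>a / (2 * pi)\<rfloor>" by (simp add: field_simps)
  then show "cis a = 1" using cis_add_2pi_int[of 0 "\<lfloor>a / (2 * pi)\<rfloor>"] by simp
qed

text \<open>Ceiling minus 1 equals the floor except at integers, where it is smaller by 1, and the
  nullity counts exactly these j. The sum of index and nullity is thus a pure floor count.\<close>

lemma index_plus_nullity:
  assumes \<theta>: "eig_lift \<omega> \<gamma> \<theta>" and \<omega>: "\<omega> \<noteq> 1"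
  shows "index_om \<omega> \<gamma> + int (nullity_om \<omega> \<gamma>)
    = (\<Sum>j\<in>UNIV. \<lfloor>\<theta> j (2 * pi) / (2 * pi)\<rfloor> - \<lfloor>\<theta> j 0 / (2 * pi)\<rfloor>)"
proof -
  define \<eta> where "\<eta> = (SOME \<theta>. eig_lift \<omega> \<gamma> \<theta>)"
  have \<eta>: "eig_lift \<omega> \<gamma> \<eta>" unfolding \<eta>_def by (rule someI[where P = "eig_lift \<omega> \<gamma>", OF \<theta>])
  have "nullity_om \<omega> \<gamma> = card {j. cis (\<eta> j (2 * pi)) = 1}"
    using eig_lift_card[OF \<eta>, of "2 * pi" 1] by (simp add: nullity_om_pencil)
  then have "int (nullity_om \<omega> \<gamma>) = (\<Sum>j\<in>UNIV. if cis (\<eta> j (2 * pi)) = 1 then 1 else 0)"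
    by (simp add: sum.If_cases)
  moreover have "index_om \<omega> \<gamma> = (\<Sum>j\<in>UNIV. \<lceil>\<eta> j (2 * pi) / (2 * pi)\<rceil> - 1 - \<lfloor>\<eta> j 0 / (2 * pi)\<rfloor>)"
    using \<omega> by (simp add: index_om_def \<eta>_def Let_def)
  ultimately have "index_om \<omega> \<gamma> + int (nullity_om \<omega> \<gamma>) = (\<Sum>j\<in>UNIV. \<lceil>\<eta> j (2 * pi) / (2 * pi)\<rceil> - 1 - \<lfloor>\<eta> j 0 / (2 * pi)\<rfloor>
     + (if cis (\<eta> j (2 * pi)) = 1 then 1 else 0))"
    by (simp only: sum.distrib)
  also have "\<dots> = (\<Sum>j\<in>UNIV. \<lfloor>\<eta> j (2 * pi) / (2 * pi)\<rfloor> - \<lfloor>\<eta> j 0 / (2 * pi)\<rfloor>)"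
    unfolding cis_eq_1_iff ceiling_altdef by (intro sum.cong refl) auto
  also have "\<dots> = (\<Sum>j\<in>UNIV. \<lfloor>\<theta> j (2 * pi) / (2 * pi)\<rfloor> - \<lfloor>\<theta> j 0 / (2 * pi)\<rfloor>)"
    by (rule eig_lift_sum_floor_diff[OF \<eta> \<theta>])
  finally show ?thesis .
qed

section \<open>Lifts joint in time and parameter, and local constancy of the index\<close>

lemma continuous_on_det:
  fixes A :: "'p::topological_space \<Rightarrow> 'a::{real_normed_field}^'n^'n"
  assumes "\<And>i j. continuous_on S (\<lambda>x. A x $ i $ j)"
  shows "continuous_on S (\<lambda>x. det (A x))"
  unfolding Determinants.det_def by (intro continuous_on_sum continuous_on_mult continuous_on_const continuous_on_prod assms)

lemma xi_tilde_symplectic: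
  assumes e: "0 \<le> e" "e < 1" and t: "t \<in> {0..2 * pi}"
  shows "transpose (xi_tilde ta tb e t) ** J4 ** xi_tilde ta tb e t = J4"
  using EH_solution_symplectic_product[OF xi_tilde_solution[OF e] xi_tilde_solution[OF e] t] .

text \<open>One lift serves a whole interval of tb, because the rectangle of pairs (tb, t) is convex
  and the characteristic polynomial varies continuously on it.\<close>

lemma xi_tilde_eig_lifts:
  assumes e: "0 \<le> e" "e < 1" and \<omega>: "cmod \<omega> = 1"
  obtains x where "\<And>j. continuous_on ({b0..b1} \<times> {0..2 * pi}) (x j)"
    "\<And>tb. tb \<in> {b0..b1} \<Longrightarrow> eig_lift \<omega> (xi_tilde ta tb e) (\<lambda>j t. x j (tb, t))"
proof -
  let ?K = "{b0..b1} \<times> {0..2 * pi}"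
  let ?M = "\<lambda>p. xi_tilde ta (fst p) e (snd p)"
  \<comment> \<open>The characteristic polynomial of Q^-1 R, written as a quotient of determinants
    so that continuity needs no inverse matrix.\<close>
  define q where "q p w = det (\<chi> i j. w * Qmat (?M p) $ i $ j - Rmat \<omega> (?M p) $ i $ j) / det (Qmat (?M p))" for p w
  \<comment> \<open>\<open>normal_lift\<close> is indexed by natural numbers; h and its inverse g
    translate to the index type of \<open>eig_lift\<close>.\<close>
  obtain h where h: "bij_betw h {..<4::nat} (UNIV :: 4 set)"
    using ex_bij_betw_nat_finite[of "UNIV :: 4 set"] by (auto simp: lessThan_atLeast0)
  have spec: "\<exists>z :: 4 \<Rightarrow> complex. (\<forall>j. cmod (z j) = 1) \<and> det (Qmat (?M p)) \<noteq> 0 \<and>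
      (\<forall>w. cmod w = 1 \<longrightarrow> card {j. z j = w} = cnullity (pencil \<omega> (?M p) w)) \<and> (\<forall>w. (\<Prod>j\<in>UNIV. w - z j) = q p w)"
    if p: "p \<in> ?K" for p
  proof -
    have sy: "transpose (?M p) ** J4 ** ?M p = J4" by (rule xi_tilde_symplectic[OF e]) (use p in auto)
    obtain z :: "4 \<Rightarrow> complex" where z: "\<And>j. cmod (z j) = 1" "det (Qmat (?M p)) \<noteq> 0"
      "\<And>w. cmod w = 1 \<Longrightarrow> card {j. z j = w} = cnullity (pencil \<omega> (?M p) w)"
      "\<And>w. det (\<chi> i j. w * Qmat (?M p) $ i $ j - Rmat \<omega> (?M p) $ i $ j) = det (Qmat (?M p)) * (\<Prod>j\<in>UNIV. w - z j)"
      by (rule pencil_spectrum[OF sy \<omega>]) (rule that)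
    show ?thesis by (rule exI[of _ z]) (simp add: q_def z)
  qed
  have contM: "continuous_on ?K (\<lambda>p. ?M p $ i $ j)" for i j
    using continuous_on_xi_tilde[OF e, of b0 b1 ta] unfolding split_beta
    by (rule bounded_linear.continuous_on[OF bounded_linear_vec_nth bounded_linear.continuous_on[OF bounded_linear_vec_nth]])
  have contQ: "continuous_on ?K (\<lambda>p. Qmat (?M p) $ i $ j)" and contR: "continuous_on ?K (\<lambda>p. Rmat \<omega> (?M p) $ i $ j)" for i j
    unfolding Qmat_def Rmat_def matrix_matrix_mult_def cmat_def
    by (simp_all, (intro continuous_intros contM)+)
  have contq: "continuous_on ?K (\<lambda>p. q p w)" for w
  proof -
    have nz: "det (Qmat (?M p)) \<noteq> 0" if "p \<in> ?K" for p using spec[OF that] by blast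
    have "continuous_on ?K (\<lambda>p. (\<chi> i j. w * Qmat (?M p) $ i $ j - Rmat \<omega> (?M p) $ i $ j) $ i $ j)" for i j
      by simp (intro continuous_intros contQ contR)
    from continuous_on_det[OF this] continuous_on_det[OF contQ] show ?thesis
      unfolding q_def using nz by (intro continuous_on_divide ballI)
  qed
  obtain x :: "nat \<Rightarrow> real \<times> real \<Rightarrow> real" where x: "\<And>j. j < 4 \<Longrightarrow> continuous_on ?K (x j)" "\<And>p w. p \<in> ?K \<Longrightarrow> (\<Prod>j<4. w - cis (x j p)) = q p w"
  proof (rule continuous_normal_lift_exists[of ?K 4 q, OF _ _ _ contq])
    show "convex ?K" by (intro convex_Times) auto
    fix p assume "p \<in> ?K"
    from spec[OF this] obtain z :: "4 \<Rightarrow> complex" where z: "\<forall>j. cmod (z j) = 1" "\<forall>w. (\<Prod>j\<in>UNIV. w - z j) = q p w" by blast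
    have hz: "(\<Prod>j<4. w - z (h j)) = q p w" for w
      using prod.reindex_bij_betw[OF h, of "\<lambda>j. w - z j"] z(2) by simp
    show "\<exists>z. (\<forall>j<(4::nat). cmod (z j) = 1) \<and> (\<forall>w. (\<Prod>j<4. w - z j) = q p w)"
      by (rule exI[of _ "\<lambda>j. z (h j)"]) (simp add: z(1) hz)
  qed (simp, blast)
  define g where "g = the_inv_into {..<4} h"
  have g: "bij_betw g UNIV {..<4::nat}" unfolding g_def by (rule bij_betw_the_inv_into[OF h])
  then have g4: "g j < 4" for j by (auto simp: bij_betw_def)
  have "eig_lift \<omega> (xi_tilde ta tb e) (\<lambda>j t. x (g j) (tb, t))" if tb: "tb \<in> {b0..b1}" for tb
    unfolding eig_lift_def
  proof (intro conjI allI ballI impI)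
    fix j
    show "continuous_on {0..2 * pi} (\<lambda>t. x (g j) (tb, t))"
      by (rule continuous_on_compose2[OF x(1)[OF g4]]) (use tb in \<open>auto intro!: continuous_intros\<close>)
  next
    fix t w assume t: "t \<in> {0..2 * pi}" and w: "cmod w = 1"
    have p: "(tb, t) \<in> ?K" using tb t by simp
    from spec[OF p] obtain z :: "4 \<Rightarrow> complex" where z: "card {j. z j = w} = cnullity (pencil \<omega> (xi_tilde ta tb e t) w)"
        "\<And>w. (\<Prod>j\<in>UNIV. w - z j) = q (tb, t) w" using w by auto
    have "(\<Prod>j\<in>UNIV. w - cis (x (g j) (tb, t))) = (\<Prod>j\<in>UNIV. w - z j)" for w
      using prod.reindex_bij_betw[OF g, of "\<lambda>j. w - cis (x j (tb, t))"] x(2)[OF p] z(2) by simp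
    then have "image_mset (\<lambda>j. cis (x (g j) (tb, t))) (mset_set UNIV) = image_mset z (mset_set UNIV)"
      by (rule prod_linear_factors_determine_mset[OF finite finite])
    then have "card {j. cis (x (g j) (tb, t)) = w} = card {j. z j = w}"
      by (simp add: mset_eq_iff_card_fibres)
    then show "card {j. cis (x (g j) (tb, t)) = w} = cnullity (pencil \<omega> (xi_tilde ta tb e t) w)" using z(1) by simp
  qed
  then show thesis using that[of "\<lambda>j. x (g j)"] x(1)[OF g4] by blast
qed

text \<open>At t = 2 pi no angle is a multiple of 2 pi by nondegeneracy, and at t = 0 none is
  because the path starts at the identity and \<omega> differs from 1. So all floors are locally
  constant in the parameter. A smaller parameter is what contradicts a minimum.\<close>

lemma index_locally_constant_left:
  assumes e: "0 \<le> e" "e < 1" and \<omega>: "cmod \<omega> = 1" "\<omega> \<noteq> 1" and b: "0 < b"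
    and nondeg: "nullity_om \<omega> (xi_tilde ta b e) = 0"
  shows "\<exists>b'. 0 < b' \<and> b' < b \<and> index_om \<omega> (xi_tilde ta b' e) + int (nullity_om \<omega> (xi_tilde ta b' e))
     = index_om \<omega> (xi_tilde ta b e) + int (nullity_om \<omega> (xi_tilde ta b e))"
proof -
  let ?B = "{b / 2..b}"
  obtain x where x: "\<And>j. continuous_on (?B \<times> {0..2 * pi}) (x j)"
    "\<And>tb. tb \<in> ?B \<Longrightarrow> eig_lift \<omega> (xi_tilde ta tb e) (\<lambda>j t. x j (tb, t))"
    using xi_tilde_eig_lifts[OF e \<omega>(1), of "b / 2" b ta] by blast
  have bB: "b \<in> ?B" using b by simp
  have nonint: "x j (b, t) / (2 * pi) \<notin> \<int>" if t: "t \<in> {0..2 * pi}" and 0: "cnullity (pencil \<omega> (xi_tilde ta b e t) 1) = 0" for j t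
  proof
    assume "x j (b, t) / (2 * pi) \<in> \<int>"
    then have "x j (b, t) / (2 * pi) = of_int \<lfloor>x j (b, t) / (2 * pi)\<rfloor>" by (metis Ints_cases floor_of_int)
    then have "cis (x j (b, t)) = 1" by (simp only: cis_eq_1_iff[symmetric])
    moreover have "card {j. cis (x j (b, t)) = 1} = 0" using eig_lift_card[OF x(2)[OF bB] t, of 1] 0 by simp
    ultimately show False by auto
  qed
  have ev: "\<forall>\<^sub>F b' in at b within ?B. \<lfloor>x j (b', t) / (2 * pi)\<rfloor> = \<lfloor>x j (b, t) / (2 * pi)\<rfloor>"
    if t: "t \<in> {0..2 * pi}" and 0: "cnullity (pencil \<omega> (xi_tilde ta b e t) 1) = 0" for j t
  proof (rule eventually_floor_eq[OF _ nonint[OF t 0]])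
    have "continuous_on ?B (\<lambda>b'. x j (b', t) / (2 * pi))"
      by (intro continuous_on_divide continuous_on_compose2[OF x(1)]) (use t in \<open>auto intro!: continuous_intros\<close>)
    then show "((\<lambda>b'. x j (b', t) / (2 * pi)) \<longlongrightarrow> x j (b, t) / (2 * pi)) (at b within ?B)"
      using bB by (auto simp: continuous_on_def)
  qed
  have end0: "cnullity (pencil \<omega> (xi_tilde ta b e (2 * pi)) 1) = 0" using nondeg by (simp add: nullity_om_pencil)
  have start0: "cnullity (pencil \<omega> (xi_tilde ta b e 0) 1) = 0"
  proof (rule cnullity_eq_0)
    fix v assume "pencil \<omega> (xi_tilde ta b e 0) 1 *v v = 0"
    moreover have "xi_tilde ta b e 0 = mat 1" using xi_tilde_solution[OF e, of ta b] by (simp add: EH_solution_def)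
    ultimately have "(1 - \<omega>) *s v = 0"
      by (simp add: pencil_vec cmat_mat_1 proj_simps(11) vector_sub_rdistrib)
    then show "v = 0" unfolding vector_mul_eq_0 using \<omega>(2) by simp
  qed
  have "\<forall>\<^sub>F b' in at b within ?B. \<forall>j. \<lfloor>x j (b', 2 * pi) / (2 * pi)\<rfloor> = \<lfloor>x j (b, 2 * pi) / (2 * pi)\<rfloor> \<and> \<lfloor>x j (b', 0) / (2 * pi)\<rfloor> = \<lfloor>x j (b, 0) / (2 * pi)\<rfloor>"
    by (intro eventually_all_finite eventually_conj ev end0 start0) auto
  then obtain d where d: "0 < d" "\<And>b'. b' \<in> ?B \<Longrightarrow> b' \<noteq> b \<Longrightarrow> dist b' b < d \<Longrightarrow>
     (\<forall>j. \<lfloor>x j (b', 2 * pi) / (2 * pi)\<rfloor> = \<lfloor>x j (b, 2 * pi) / (2 * pi)\<rfloor> \<and> \<lfloor>x j (b', 0) / (2 * pi)\<rfloor> = \<lfloor>x j (b, 0) / (2 * pi)\<rfloor>)"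
    unfolding eventually_at by metis
  \<comment> \<open>The bound b/4 keeps the point inside the interval of the lift, and d/2 keeps it
    within the radius of constancy.\<close>
  define b' where "b' = b - min (d / 2) (b / 4)"
  have b': "b' \<in> ?B" "b' < b" "0 < b'" "dist b' b < d" using b d(1) by (auto simp: b'_def dist_real_def min_def)
  have "index_om \<omega> (xi_tilde ta b' e) + int (nullity_om \<omega> (xi_tilde ta b' e))
     = index_om \<omega> (xi_tilde ta b e) + int (nullity_om \<omega> (xi_tilde ta b e))"
    unfolding index_plus_nullity[OF x(2)[OF b'(1)] \<omega>(2)] index_plus_nullity[OF x(2)[OF bB] \<omega>(2)]
    using d(2)[OF b'(1) _ b'(4)] b'(2) by simp
  then show ?thesis using b' by blast
qed

lemma Pi_surf_eigenvector:
  assumes e: "0 \<le> e" "e < 1" and \<omega>: "cmod \<omega> = 1" "\<omega> \<noteq> 1" and P: "(ta, tb, e) \<in> Pi_surf n \<omega> e"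
  shows "\<exists>v. v \<noteq> 0 \<and> cmat (xi_tilde ta tb e (2 * pi)) *v v = \<omega> *s v"
proof (rule ccontr)
  assume no: "\<nexists>v. v \<noteq> 0 \<and> cmat (xi_tilde ta tb e (2 * pi)) *v v = \<omega> *s v"
  have tb: "0 < tb" "int n \<le> idx_gap \<omega> ta tb e" and least: "\<And>b. 0 < b \<Longrightarrow> int n \<le> idx_gap \<omega> ta b e \<Longrightarrow> tb \<le> b"
    using P by (auto simp: Pi_surf_def)
  have "nullity_om \<omega> (xi_tilde ta tb e) = 0"
    unfolding nullity_om_pencil
  proof (rule cnullity_eq_0)
    fix v assume "pencil \<omega> (xi_tilde ta tb e (2 * pi)) 1 *v v = 0"
    then have "cmat (xi_tilde ta tb e (2 * pi)) *v v = \<omega> *s v" by (simp add: pencil_vec proj_simps(11))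
    then show "v = 0" using no by blast
  qed
  from index_locally_constant_left[OF e \<omega> tb(1) this] obtain b' where b': "0 < b'" "b' < tb"
    "index_om \<omega> (xi_tilde ta b' e) + int (nullity_om \<omega> (xi_tilde ta b' e))
     = index_om \<omega> (xi_tilde ta tb e) + int (nullity_om \<omega> (xi_tilde ta tb e))" by blast
  then have "idx_gap \<omega> ta b' e = idx_gap \<omega> ta tb e" by (simp add: idx_gap_def)
  then show False using least[OF b'(1)] tb(2) b'(2) by simp
qed

subsection \<open>Eigenvalues and determinant of the monodromy matrix\<close>

lemma distinct_eigenvalues_independent:
  fixes A :: "complex^'n^'n"
  assumes "finite S" "inj_on l S" "\<And>i. i \<in> S \<Longrightarrow> y i \<noteq> 0 \<and> A *v y i = l i *s y i"
    "(\<Sum>i\<in>S. c i *s y i) = 0"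
  shows "\<forall>i\<in>S. c i = 0"
  using assms
proof (induction S arbitrary: c rule: finite_induct)
  case (insert s S)
  have sum: "c s *s y s + (\<Sum>i\<in>S. c i *s y i) = 0" using insert.prems(3) insert.hyps by simp
  have "A *v (c s *s y s + (\<Sum>i\<in>S. c i *s y i)) = c s *s (l s *s y s) + (\<Sum>i\<in>S. c i *s (l i *s y i))"
    using insert.prems(2)
    by (simp add: matrix_vector_right_distrib matrix_vector_mult_sum vector_scalar_commute del: vector_smult_assoc cong: sum.cong)
  then have "(\<Sum>i\<in>S. c i *s (l i *s y i)) + c s *s (l s *s y s) - l s *s (c s *s y s + (\<Sum>i\<in>S. c i *s y i)) = 0"
    unfolding sum by (simp add: add.commute)
  moreover have "(\<Sum>i\<in>S. c i *s (l i *s y i)) + c s *s (l s *s y s) - l s *s (c s *s y s + (\<Sum>i\<in>S. c i *s y i))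
     = (\<Sum>i\<in>S. (c i * (l i - l s)) *s y i)"
    by (simp add: vec_eq_iff sum_distrib_left algebra_simps sum_subtractf)
  ultimately have "(\<Sum>i\<in>S. (c i * (l i - l s)) *s y i) = 0" by simp
  then have "\<forall>i\<in>S. c i * (l i - l s) = 0"
    using insert.prems by (intro insert.IH) auto
  then have c0: "\<forall>i\<in>S. c i = 0" using insert.prems(1) insert.hyps by (auto simp: inj_on_def)
  then have "c s *s y s = 0" using sum by simp
  then show ?case using c0 insert.prems(2)[of s] by (simp add: vector_mul_eq_0)
qed simp

lemma det_distinct_eigenvalues:
  fixes A :: "complex^'n^'n" and l :: "'n \<Rightarrow> complex"
  assumes "inj l" "\<And>i. y i \<noteq> 0" "\<And>i. A *v y i = l i *s y i"
  shows "det A = (\<Prod>i\<in>UNIV. l i)"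
proof (rule det_eigenbasis[OF assms(3)])
  fix c i assume "(\<Sum>j\<in>UNIV. c j *s y j) = 0"
  then have "\<forall>i\<in>UNIV. c i = 0"
    by (rule distinct_eigenvalues_independent[where A = A and l = l, rotated 3]) (use assms in auto)
  then show "c i = 0" by simp
qed

lemma det_cmat: "det (cmat M) = of_real (det M)"
  by (simp add: Determinants.det_def cmat_def)

lemma cnj_eigenvector:
  assumes "cmat M *v v = c *s v"
  shows "cmat M *v (\<chi> i. cnj (v $ i)) = cnj c *s (\<chi> i. cnj (v $ i))"
proof -
  have "(cmat M *v (\<chi> i. cnj (v $ i))) $ i = cnj ((cmat M *v v) $ i)" for i
    by (simp add: matrix_vector_mult_def cmat_def)
  then show ?thesis by (simp add: vec_eq_iff assms)
qed

text \<open>Symplectic matrices are invertible, so the determinant has no zero along the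
  path.\<close>

lemma EH_solution_det_pos:
  assumes X: "EH_solution \<alpha> \<beta> e X"
  shows "0 < det (X (2 * pi))"
proof (rule ccontr)
  assume "\<not> ?thesis"
  then have "det (X (2 * pi)) \<le> 0" by simp
  moreover have "det (X 0) = 1" using X by (simp add: EH_solution_def)
  moreover have "continuous_on {0..2 * pi} (\<lambda>t. det (X t))"
    by (rule continuous_on_det[OF bounded_linear.continuous_on[OF bounded_linear_vec_nth
          bounded_linear.continuous_on[OF bounded_linear_vec_nth EH_solution_continuous[OF X]]]])
  ultimately have "\<exists>t. 0 \<le> t \<and> t \<le> 2 * pi \<and> det (X t) = 0"
    by (intro IVT2') auto
  then obtain t where t: "0 \<le> t" "t \<le> 2 * pi" "det (X t) = 0" by blast
  interpret bb: bounded_bilinear "(**) :: real^4^4 \<Rightarrow> real^4^4 \<Rightarrow> real^4^4"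
    by (rule bounded_bilinear_matrix_mult)
  have "transpose (X t) ** J4 ** X t = J4"
    by (rule EH_solution_symplectic_product[OF X X]) (use t in auto)
  then have "(- (J4 ** (transpose (X t) ** J4))) ** X t = mat 1"
    by (simp add: bb.minus_left J4_simps flip: matrix_mul_assoc)
  then have "invertible (X t)" unfolding invertible_left_inverse by (rule exI)
  then show False using t(3) by (simp add: invertible_det_nz)
qed

theorem theorem7p6:
  fixes \<omega> :: complex and e :: real and n1 n2 :: nat
  assumes "cmod \<omega> = 1" and "\<omega> \<noteq> 1" and "\<omega> \<noteq> -1"
    and "0 \<le> e" and "e < 1"
    and "n1 \<ge> 1" and "n2 \<ge> 1"
  shows "Pi_surf n1 \<omega> e \<inter> Pi_surf n2 (-1) e = {}"
proof (rule equals0I)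
  fix p assume p: "p \<in> Pi_surf n1 \<omega> e \<inter> Pi_surf n2 (-1) e"
  then obtain ta tb where p_eq: "p = (ta, tb, e)" and pos: "0 < ta" "0 < tb" by (auto simp: Pi_surf_def)
  let ?M = "xi_tilde ta tb e (2 * pi)"
  have "(ta, tb, e) \<in> Pi_surf n1 \<omega> e" "(ta, tb, e) \<in> Pi_surf n2 (-1) e" using p by (simp_all add: p_eq)
  then obtain v u where v: "v \<noteq> 0" "cmat ?M *v v = \<omega> *s v" and u: "u \<noteq> 0" "cmat ?M *v u = (-1) *s u"
    using Pi_surf_eigenvector[of e \<omega> ta tb n1] Pi_surf_eigenvector[of e "-1" ta tb n2] assms by auto
  note sol = xi_tilde_solution[OF assms(4,5), of ta tb]
  obtain \<mu> w where w: "0 < \<mu>" "w \<noteq> 0" "cmat ?M *v w = of_real \<mu> *s w"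
    by (rule positive_multiplier[OF sol assms(4,5)]) (use pos in \<open>auto simp: field_simps\<close>)
  let ?v' = "\<chi> i. cnj (v $ i)"
  have v': "?v' \<noteq> 0" "cmat ?M *v ?v' = cnj \<omega> *s ?v'"
    using v(1) cnj_eigenvector[OF v(2)] by (auto simp: vec_eq_iff)
  have unit: "\<omega> * cnj \<omega> = 1" using assms(1) by (simp add: complex_norm_square[symmetric])
  \<comment> \<open>The hypotheses that \<omega> is neither 1 nor -1 combine here: a nonreal
    \<omega> differs from its conjugate and from the real eigenvalues -1 and \<mu>.\<close>
  have im: "Im \<omega> \<noteq> 0"
  proof
    assume im: "Im \<omega> = 0"
    then have "\<bar>Re \<omega>\<bar> = 1" using assms(1) by (simp add: cmod_def)
    then show False using im assms(2,3) by (auto simp: complex_eq_iff abs_if split: if_splits)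
  qed
  define l :: "4 \<Rightarrow> complex" where "l j = (if j = 1 then \<omega> else if j = 2 then cnj \<omega> else if j = 3 then -1 else of_real \<mu>)" for j
  define y :: "4 \<Rightarrow> complex^4" where "y j = (if j = 1 then v else if j = 2 then ?v' else if j = 3 then u else w)" for j
  have "inj l"
  proof (rule injI)
    fix i j assume "l i = l j"
    then show "i = j" using exhaust_4[of i] exhaust_4[of j] im w(1)
      by (elim disjE) (simp_all add: l_def complex_eq_iff)
  qed
  moreover have "y j \<noteq> 0" "cmat ?M *v y j = l j *s y j" for j
    using exhaust_4[of j] v u w v' by (auto simp: y_def l_def)
  ultimately have "det (cmat ?M) = (\<Prod>j\<in>UNIV. l j)" by (rule det_distinct_eigenvalues)
  also have "\<dots> = l 1 * l 2 * l 3 * l 4" unfolding UNIV_4 by (simp add: ac_simps)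
  also have "\<dots> = (\<omega> * cnj \<omega>) * (- of_real \<mu>)" by (simp add: l_def)
  finally have "complex_of_real (det ?M) = complex_of_real (- \<mu>)" by (simp add: det_cmat unit)
  then have "det ?M = - \<mu>" by (simp only: of_real_eq_iff)
  then show False using EH_solution_det_pos[OF sol] w(1) by simp
qed

end
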